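(* Let $M$ be a Riemannian manifold (separable or non-separable, finite- or infinite-dimensional). Then for every Lipschitz function $f:M\to\mathbb{R}$, every continuous function $\varepsilon:M\to(0,\infty)$ and every $r>0$ there is a $C^1$-smooth and Lipschitz function $g:M\to\mathbb{R}$ such that $|g(p)-f(p)|<\varepsilon(p)$ for every $p\in M$ and $\operatorname{Lip}(g)\le\operatorname{Lip}(f)+r$.
   Context: A Riemannian manifold is a paracompact smooth manifold modeled on a real Hilbert space (not necessarily separable, possibly infinite-dimensional) with a Riemannian metric $\langle\cdot,\cdot\rangle_p$ on each $T_pM$ whose norm $\|v\|_p=\langle v,v\rangle_p^{1/2}$ corresponds in charts to a norm equivalent to the Hilbert norm. The distance $d_M(p,q)$ is the infimum of the lengths $\int_a^b\|c'(t)\|_{c(t)}\,dt$ of piecewise $C^1$ paths $c:[a,b]\to M$ joining $p$ to $q$ (with value $+\infty$ if $p,q$ lie in different connected components). Lipschitz constants on $M$ are with respect to $d_M$: $\operatorname{Lip}(f)$ is the least $L\ge 0$ with $|f(p)-f(q)|\le L\,d_M(p,q)$ for all $p,q$ with $d_M(p,q)<\infty$. *)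

theory Defs
  imports "HOL-Analysis.Analysis"
begin

text \<open>
  \<open>smooth_on S f\<close>, meant for open \<open>S\<close>, says that \<open>f\<close> has Frechet derivatives of every order
  on \<open>S\<close>. The \<open>k\<close>-th derivative at \<open>x\<close> is the bounded \<open>k\<close>-linear map \<open>D k x\<close>, whose
  argument is a list of \<open>k\<close> vectors, and \<open>x \<mapsto> D k x\<close> is Frechet differentiable for the norm
  \<open>sup {norm (T vs) | vs. all vectors in vs have norm at most 1}\<close> of \<open>k\<close>-linear maps.
\<close>

definition bounded_multilinear ::
  "nat \<Rightarrow> ('a::real_normed_vector list \<Rightarrow> 'b::real_normed_vector) \<Rightarrow> bool" where
  "bounded_multilinear k T \<longleftrightarrow>
     (\<forall>vs i. length vs = k \<and> i < k \<longrightarrow> linear (\<lambda>v. T (vs[i := v]))) \<and>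
     (\<exists>C. \<forall>vs. length vs = k \<longrightarrow> norm (T vs) \<le> C * prod_list (map norm vs))"

definition smooth_on ::
  "'a::real_normed_vector set \<Rightarrow> ('a \<Rightarrow> 'b::real_normed_vector) \<Rightarrow> bool" where
  "smooth_on S f \<longleftrightarrow>
     (\<exists>D :: nat \<Rightarrow> 'a \<Rightarrow> 'a list \<Rightarrow> 'b.
        (\<forall>x\<in>S. D 0 x [] = f x) \<and>
        (\<forall>k. \<forall>x\<in>S. bounded_multilinear k (D k x) \<and>
           (\<forall>e>0. \<exists>d>0. \<forall>y\<in>S. dist y x < d \<longrightarrow>
              (\<forall>vs. length vs = k \<longrightarrow>
                 norm (D k y vs - D k x vs - D (Suc k) x ((y - x) # vs))
                   \<le> e * norm (y - x) * prod_list (map norm vs)))))"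

definition C1_on ::
  "'a::real_normed_vector set \<Rightarrow> ('a \<Rightarrow> 'b::real_normed_vector) \<Rightarrow> bool" where
  "C1_on S f \<longleftrightarrow>
     (\<exists>D :: 'a \<Rightarrow> 'a \<Rightarrow>\<^sub>L 'b.
        (\<forall>x\<in>S. (f has_derivative blinfun_apply (D x)) (at x)) \<and> continuous_on S D)"

text \<open>
  The manifold is the whole type \<open>'m\<close>, modeled on the Hilbert space \<open>'h\<close>. A chart is a pair
  \<open>(U, \<phi>)\<close>; the values of \<open>\<phi>\<close> outside \<open>U\<close> are irrelevant. The atlas need not be maximal.
\<close>

type_synonym ('m, 'h) chart = "'m set \<times> ('m \<Rightarrow> 'h)"

definition chart_inv :: "('m, 'h) chart \<Rightarrow> 'h \<Rightarrow> 'm" where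
  "chart_inv c = inv_into (fst c) (snd c)"

definition chart_range :: "('m, 'h) chart \<Rightarrow> 'h set" where
  "chart_range c = snd c ` fst c"

definition smooth_atlas ::
  "('m::topological_space, 'h::{real_inner, complete_space}) chart set \<Rightarrow> bool" where
  "smooth_atlas A \<longleftrightarrow>
     (\<Union>c\<in>A. fst c) = UNIV \<and>
     (\<forall>c\<in>A. open (fst c) \<and> open (chart_range c) \<and>
        homeomorphism (fst c) (chart_range c) (snd c) (chart_inv c)) \<and>
     (\<forall>c\<in>A. \<forall>d\<in>A. smooth_on (snd c ` (fst c \<inter> fst d)) (snd d \<circ> chart_inv c))"

definition paracompact_space :: "'m::t2_space itself \<Rightarrow> bool" where
  "paracompact_space _ \<longleftrightarrow>
     (\<forall>\<U> :: 'm set set. (\<forall>U\<in>\<U>. open U) \<and> \<Union>\<U> = UNIV \<longrightarrow>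
        (\<exists>\<V>. (\<forall>V\<in>\<V>. open V) \<and> \<Union>\<V> = UNIV \<and> (\<forall>V\<in>\<V>. \<exists>U\<in>\<U>. V \<subseteq> U) \<and>
             locally_finite_in euclidean \<V>))"

text \<open>
  A tangent vector at \<open>p\<close> is an equivalence class of pairs \<open>(c, u)\<close> of a chart around \<open>p\<close> and a
  vector of the model space, where \<open>(c, u)\<close> and \<open>(d, v)\<close> are equivalent if the derivative at \<open>p\<close>
  of the transition from \<open>c\<close> to \<open>d\<close> takes \<open>u\<close> to \<open>v\<close>. For a chart \<open>c\<close> around \<open>p\<close> the map
  \<open>tangent_vector A p c\<close> identifies the model space with the tangent space at \<open>p\<close>, and thereby
  gives the latter its vector space structure.
\<close>

type_synonym ('m, 'h) tangent = "(('m, 'h) chart \<times> 'h) set"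

definition tangent_vector ::
  "('m, 'h::real_normed_vector) chart set \<Rightarrow> 'm \<Rightarrow> ('m, 'h) chart \<Rightarrow> 'h \<Rightarrow> ('m, 'h) tangent" where
  "tangent_vector A p c u =
     {(d, v). d \<in> A \<and> p \<in> fst d \<and>
        v = frechet_derivative (snd d \<circ> chart_inv c) (at (snd c p)) u}"

text \<open>
  \<open>\<rho> p X Y\<close> is the inner product of the tangent vectors \<open>X\<close> and \<open>Y\<close> at \<open>p\<close>; \<open>G\<close> is its
  representation in the chart \<open>c\<close>.
\<close>

definition riemannian_metric ::
  "('m, 'h::real_inner) chart set \<Rightarrow>
   ('m \<Rightarrow> ('m, 'h) tangent \<Rightarrow> ('m, 'h) tangent \<Rightarrow> real) \<Rightarrow> bool" where
  "riemannian_metric A \<rho> \<longleftrightarrow>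
     (\<forall>c\<in>A. \<exists>G :: 'h \<Rightarrow> 'h \<Rightarrow>\<^sub>L 'h \<Rightarrow>\<^sub>L real.
        smooth_on (chart_range c) G \<and>
        (\<forall>x\<in>chart_range c.
           (\<forall>u v. \<rho> (chart_inv c x) (tangent_vector A (chart_inv c x) c u)
                                     (tangent_vector A (chart_inv c x) c v)
                  = blinfun_apply (blinfun_apply (G x) u) v) \<and>
           (\<forall>u v. blinfun_apply (blinfun_apply (G x) u) v = blinfun_apply (blinfun_apply (G x) v) u) \<and>
           (\<forall>u. u \<noteq> 0 \<longrightarrow> 0 < blinfun_apply (blinfun_apply (G x) u) u) \<and>
           (\<exists>a>0. \<exists>b>0. \<forall>u.
              a * norm u \<le> sqrt (blinfun_apply (blinfun_apply (G x) u) u) \<and>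
              sqrt (blinfun_apply (blinfun_apply (G x) u) u) \<le> b * norm u)))"

definition riemannian_manifold ::
  "('m::t2_space, 'h::{real_inner, complete_space}) chart set \<Rightarrow>
   ('m \<Rightarrow> ('m, 'h) tangent \<Rightarrow> ('m, 'h) tangent \<Rightarrow> real) \<Rightarrow> bool" where
  "riemannian_manifold A \<rho> \<longleftrightarrow>
     paracompact_space TYPE('m) \<and> smooth_atlas A \<and> riemannian_metric A \<rho>"

text \<open>
  At a point \<open>t\<close> where \<open>\<gamma>\<close> is differentiable, \<open>velocity A \<gamma> t\<close> is a tangent vector at \<open>\<gamma> t\<close> in the
  above sense: the class of all representatives of the velocity in the charts around \<open>\<gamma> t\<close>.
  (It is empty at corners, which are finite in number and do not affect the length.)
\<close>

definition velocity ::
  "('m, 'h::real_normed_vector) chart set \<Rightarrow> (real \<Rightarrow> 'm) \<Rightarrow> real \<Rightarrow> ('m, 'h) tangent" where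
  "velocity A \<gamma> t =
     {(c, u). c \<in> A \<and> \<gamma> t \<in> fst c \<and> ((snd c \<circ> \<gamma>) has_vector_derivative u) (at t)}"

text \<open>One-sided derivatives are required at the end points of the interval.\<close>

definition C1_path_on ::
  "('m::topological_space, 'h::real_normed_vector) chart set \<Rightarrow> (real \<Rightarrow> 'm) \<Rightarrow> real \<Rightarrow> real \<Rightarrow> bool"
  where
  "C1_path_on A \<gamma> a b \<longleftrightarrow>
     continuous_on {a..b} \<gamma> \<and>
     (\<forall>c\<in>A. \<exists>D. (\<forall>t\<in>{a..b} \<inter> \<gamma> -` fst c.
                      ((snd c \<circ> \<gamma>) has_vector_derivative D t) (at t within {a..b})) \<and>
                 continuous_on ({a..b} \<inter> \<gamma> -` fst c) D)"

definition piecewise_C1_path_on ::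
  "('m::topological_space, 'h::real_normed_vector) chart set \<Rightarrow> (real \<Rightarrow> 'm) \<Rightarrow> real \<Rightarrow> real \<Rightarrow> bool"
  where
  "piecewise_C1_path_on A \<gamma> a b \<longleftrightarrow>
     (\<exists>(n::nat) \<tau>. \<tau> 0 = a \<and> \<tau> n = b \<and>
        (\<forall>i<n. \<tau> i < \<tau> (Suc i) \<and> C1_path_on A \<gamma> (\<tau> i) (\<tau> (Suc i))))"

definition path_length ::
  "('m, 'h::real_normed_vector) chart set \<Rightarrow>
   ('m \<Rightarrow> ('m, 'h) tangent \<Rightarrow> ('m, 'h) tangent \<Rightarrow> real) \<Rightarrow> (real \<Rightarrow> 'm) \<Rightarrow> real \<Rightarrow> real \<Rightarrow> real" where
  "path_length A \<rho> \<gamma> a b =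
     integral {a..b} (\<lambda>t. sqrt (\<rho> (\<gamma> t) (velocity A \<gamma> t) (velocity A \<gamma> t)))"

definition riem_dist ::
  "('m::topological_space, 'h::real_normed_vector) chart set \<Rightarrow>
   ('m \<Rightarrow> ('m, 'h) tangent \<Rightarrow> ('m, 'h) tangent \<Rightarrow> real) \<Rightarrow> 'm \<Rightarrow> 'm \<Rightarrow> ennreal" where
  "riem_dist A \<rho> p q =
     Inf {ennreal (path_length A \<rho> \<gamma> a b) | \<gamma> a b.
            a < b \<and> piecewise_C1_path_on A \<gamma> a b \<and> \<gamma> a = p \<and> \<gamma> b = q}"

definition lip_bound ::
  "('m::topological_space, 'h::real_normed_vector) chart set \<Rightarrow>
   ('m \<Rightarrow> ('m, 'h) tangent \<Rightarrow> ('m, 'h) tangent \<Rightarrow> real) \<Rightarrow> ('m \<Rightarrow> real) \<Rightarrow> real \<Rightarrow> bool" where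
  "lip_bound A \<rho> f L \<longleftrightarrow>
     0 \<le> L \<and>
     (\<forall>p q. riem_dist A \<rho> p q < \<infinity> \<longrightarrow> \<bar>f p - f q\<bar> \<le> L * enn2real (riem_dist A \<rho> p q))"

definition riem_lipschitz ::
  "('m::topological_space, 'h::real_normed_vector) chart set \<Rightarrow>
   ('m \<Rightarrow> ('m, 'h) tangent \<Rightarrow> ('m, 'h) tangent \<Rightarrow> real) \<Rightarrow> ('m \<Rightarrow> real) \<Rightarrow> bool" where
  "riem_lipschitz A \<rho> f \<longleftrightarrow> (\<exists>L. lip_bound A \<rho> f L)"

definition Lip ::
  "('m::topological_space, 'h::real_normed_vector) chart set \<Rightarrow>
   ('m \<Rightarrow> ('m, 'h) tangent \<Rightarrow> ('m, 'h) tangent \<Rightarrow> real) \<Rightarrow> ('m \<Rightarrow> real) \<Rightarrow> real" where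
  "Lip A \<rho> f = (LEAST L. lip_bound A \<rho> f L)"

definition C1_smooth :: "('m, 'h::real_normed_vector) chart set \<Rightarrow> ('m \<Rightarrow> real) \<Rightarrow> bool" where
  "C1_smooth A f \<longleftrightarrow> (\<forall>c\<in>A. C1_on (chart_range c) (f \<circ> chart_inv c))"

end

theory Submission
  imports Defs
begin

text \<open>
  On a Hilbert space, the Lasry--Lions regularization (an infimal convolution with a large multiple
  of the squared norm, followed by a supremal one) turns an \<open>L\<close>-Lipschitz function into a
  \<open>C\<^sup>1\<close> function that is still \<open>L\<close>-Lipschitz and as close as desired: the result has
  second differences bounded by a multiple of \<open>\<parallel>h\<parallel>\<^sup>2\<close>, which forces differentiability.
  On a small chart ball the Riemannian norms are almost equal to the norm at the centre, so
  \<open>f\<close> has local \<open>C\<^sup>1\<close> approximations with differential at most \<open>Lip(f) + r/2\<close>.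

  These are glued by a partition of unity \<open>w V m\<close>, where \<open>V\<close> runs through a locally finite
  cover and \<open>m\<close> through the natural numbers. The differentials of \<open>w V m\<close> are bounded by a
  constant \<open>K m\<close> depending on \<open>m\<close> only, and at every point at most \<open>m\<close> of them are nonzero for
  given \<open>m\<close>. Hence it is enough that the local approximation attached to \<open>(V, m)\<close> has an error of
  order \<open>2\<^sup>-\<^sup>m r / (m K m)\<close>. A \<open>C\<^sup>1\<close> function whose differential has norm at most \<open>K\<close>
  everywhere is \<open>K\<close>-Lipschitz, by integration along paths.
\<close>

section \<open>Regularization by second differences\<close>

text \<open>Chart balls need not be compact. Over a single member \<open>V\<close> of a locally
  finite cover the number of overlapping members can be unbounded, and a normalizing sum of bumps
  need not have a positive lower bound. The usual partition of unity may thus have unbounded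
  differentials on \<open>V\<close>, which no constant error of the approximation on
  \<open>V\<close> compensates; nor can errors be distributed by numbering the members, as the cover
  may be uncountable. The index \<open>m\<close> restores uniformity: the bumps of layer
  \<open>m\<close> have differentials bounded by a multiple of \<open>m + 1\<close>, at the price of
  being 1 only well inside \<open>V\<close>, and a point not reached by one layer is reached by a
  later one. These bumps are smoothed distance functions, so the regularization serves twice. Second
  differences are the right quantity because the two convolutions control them from one side each,
  without compactness. Since the given function is not differentiable, the gluing compares the local
  approximations with its value at the point under consideration, which is a constant.\<close>

lemma additive_bounded_imp_bounded_linear:
  fixes D :: "'a::real_normed_vector \<Rightarrow> real"
  assumes add: "\<And>x y. D (x + y) = D x + D y"
    and bd: "\<And>x. \<bar>D x\<bar> \<le> B * norm x"
  shows "bounded_linear D"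
proof -
  have zero: "D 0 = 0" using add[of 0 0] by simp
  have neg: "D (- x) = - D x" for x using add[of x "-x"] zero by simp
  have nat: "D (real n *\<^sub>R x) = real n * D x" for n x
    by (induction n) (simp_all add: zero add scaleR_add_left distrib_right)
  have int: "D (of_int k *\<^sub>R x) = of_int k * D x" for k x
  proof (cases "k \<ge> 0")
    case True then show ?thesis using nat[of "nat k" x] by simp
  next
    case False then show ?thesis using nat[of "nat (- k)" x] neg[of "of_int (- k) *\<^sub>R x"] by simp
  qed
  have scale: "D (c *\<^sub>R x) = c * D x" for c x
  proof -
    \<comment> \<open>Rounding \<open>n c\<close> to an integer leaves a remainder \<open>s\<close>
      of size at most 1, whose contribution is bounded independently of \<open>n\<close>, whereas a
      defect in homogeneity would grow with \<open>n\<close>.\<close>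
    have "real n * \<bar>D (c *\<^sub>R x) - c * D x\<bar> \<le> 2 * (\<bar>B\<bar> * norm x)" for n
    proof -
      define k where "k = \<lfloor>real n * c\<rfloor>"
      define s where "s = real n * c - of_int k"
      have s: "\<bar>s\<bar> \<le> 1" unfolding s_def k_def by linarith
      have "real n * D (c *\<^sub>R x) = D (of_int k *\<^sub>R x + s *\<^sub>R x)"
        unfolding nat[symmetric] s_def by (simp add: scaleR_add_left[symmetric])
      then have eq: "real n * D (c *\<^sub>R x) - real n * c * D x = D (s *\<^sub>R x) - s * D x"
        unfolding add int s_def by (simp add: algebra_simps)
      have "\<bar>D (s *\<^sub>R x)\<bar> \<le> \<bar>B\<bar> * (\<bar>s\<bar> * norm x)"
        using bd[of "s *\<^sub>R x"] mult_right_mono[OF abs_ge_self norm_ge_zero, of B "s *\<^sub>R x"] by simp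
      also have "\<dots> \<le> \<bar>B\<bar> * norm x"
        using s by (intro mult_left_mono mult_left_le_one_le) auto
      finally have 1: "\<bar>D (s *\<^sub>R x)\<bar> \<le> \<bar>B\<bar> * norm x" .
      have Dx: "\<bar>D x\<bar> \<le> \<bar>B\<bar> * norm x"
        using bd[of x] mult_right_mono[OF abs_ge_self norm_ge_zero, of B x] by simp
      have "\<bar>s * D x\<bar> \<le> 1 * (\<bar>B\<bar> * norm x)"
        unfolding abs_mult by (intro mult_mono s Dx) auto
      moreover have "real n * \<bar>D (c *\<^sub>R x) - c * D x\<bar> = \<bar>D (s *\<^sub>R x) - s * D x\<bar>"
        unfolding eq[symmetric] by (simp add: abs_mult right_diff_distrib[symmetric] mult.assoc)
      ultimately show ?thesis using 1 by linarith
    qed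
    then have "\<bar>D (c *\<^sub>R x) - c * D x\<bar> \<le> 0"
      by (metis abs_ge_zero linorder_not_le mult.commute reals_Archimedean3)
    then show ?thesis by simp
  qed
  show ?thesis
    by (rule bounded_linear_intro[where K = B]) (use add scale bd in \<open>auto simp: mult.commute\<close>)
qed

text \<open>The dyadic quotients \<open>E x n h\<close> change by O(2^-n) from one level to the
  next, hence converge, and their limit \<open>D x h\<close> has a quadratic remainder estimate
  uniform in \<open>x\<close>. Comparing this estimate at two base points shows that the
  differential is even Lipschitz in \<open>x\<close>. The Lipschitz bound on \<open>g\<close> makes
  \<open>D x\<close> a bounded map.\<close>

lemma C1_on_second_difference:
  fixes g :: "'a::real_normed_vector \<Rightarrow> real"
  assumes lip: "\<And>x y. \<bar>g x - g y\<bar> \<le> L * norm (x - y)"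
    and sd: "\<And>x h. \<bar>g (x + h) + g (x - h) - 2 * g x\<bar> \<le> C * (norm h)\<^sup>2"
  shows "C1_on UNIV g"
proof -
  define C' where "C' = \<bar>C\<bar>"
  have C': "C' \<ge> 0" unfolding C'_def by simp
  have sd': "\<bar>g (x + h) + g (x - h) - 2 * g x\<bar> \<le> C' * (norm h)\<^sup>2" for x h
    using sd[of x h] mult_right_mono[OF abs_ge_self zero_le_power2, of C "norm h"] unfolding C'_def by linarith
  define E where "E = (\<lambda>x n h. 2 ^ n * (g (x + (1 / 2 ^ n) *\<^sub>R h) - g x))"
  have step: "\<bar>E x (Suc n) h - E x n h\<bar> \<le> C' * (norm h)\<^sup>2 / (4 * 2 ^ n)" for x n h
  proof -
    \<comment> \<open>Consecutive levels differ by a multiple of the second difference centred at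
      the midpoint \<open>x + k\<close>.\<close>
    define k where "k = (1 / 2 ^ Suc n) *\<^sub>R h"
    have kk: "(1 / 2 ^ n) *\<^sub>R h = k + k" unfolding k_def by (simp add: scaleR_add_left[symmetric])
    have "\<bar>E x (Suc n) h - E x n h\<bar> = 2 ^ n * \<bar>g ((x + k) + k) + g ((x + k) - k) - 2 * g (x + k)\<bar>"
    proof -
      have "E x (Suc n) h - E x n h = - (2 ^ n * (g ((x + k) + k) + g ((x + k) - k) - 2 * g (x + k)))"
        unfolding E_def kk k_def[symmetric] by (simp add: algebra_simps)
      then show ?thesis by (simp add: abs_mult)
    qed
    also have "\<dots> \<le> 2 ^ n * (C' * (norm k)\<^sup>2)" by (intro mult_left_mono sd') auto
    also have "\<dots> = C' * (norm h)\<^sup>2 / (4 * 2 ^ n)"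
      unfolding k_def by (simp add: power2_eq_square field_simps)
    finally show ?thesis .
  qed
  have tele: "\<bar>E x (n + k) h - E x n h\<bar> \<le> C' * (norm h)\<^sup>2 / (2 * 2 ^ n) * (1 - 1 / 2 ^ k)" for x n k h
  proof (induction k)
    case (Suc k)
    have "\<bar>E x (n + Suc k) h - E x n h\<bar> \<le>
        C' * (norm h)\<^sup>2 / (4 * 2 ^ (n + k)) + C' * (norm h)\<^sup>2 / (2 * 2 ^ n) * (1 - 1 / 2 ^ k)"
      using Suc step[of x "n + k" h] by simp
    also have "\<dots> = C' * (norm h)\<^sup>2 / (2 * 2 ^ n) * (1 - 1 / 2 ^ Suc k)"
      by (simp add: field_simps power_add)
    finally show ?case .
  qed simp
  have tele': "\<bar>E x m h - E x n h\<bar> \<le> C' * (norm h)\<^sup>2 / 2 * (1 / 2 ^ n)" if "n \<le> m" for x m n h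
  proof -
    have "\<bar>E x m h - E x n h\<bar> \<le> C' * (norm h)\<^sup>2 / (2 * 2 ^ n) * (1 - 1 / 2 ^ (m - n))"
      using tele[of x n "m - n" h] that by simp
    also have "\<dots> \<le> C' * (norm h)\<^sup>2 / (2 * 2 ^ n) * 1"
      by (intro mult_left_mono) (use C' in auto)
    finally show ?thesis by simp
  qed
  have half: "(\<lambda>n. c * (1 / 2 ^ n)) \<longlonglongrightarrow> 0" for c :: real
    using tendsto_mult_right_zero[OF LIMSEQ_realpow_zero[of "1/2"], of c] by (simp add: power_one_over)
  have "Cauchy (\<lambda>n. E x n h)" for x h
  proof (rule metric_CauchyI)
    fix e :: real assume "e > 0"
    with half[of "C' * (norm h)\<^sup>2 / 2"] obtain M where
      M: "\<And>n. n \<ge> M \<Longrightarrow> \<bar>C' * (norm h)\<^sup>2 / 2 * (1 / 2 ^ n)\<bar> < e / 2"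
      unfolding LIMSEQ_iff by (metis diff_zero half_gt_zero real_norm_def)
    have "\<bar>E x m h - E x M h\<bar> < e / 2" if "m \<ge> M" for m
      using tele'[OF that, of x h] M[of M] by linarith
    then show "\<exists>M. \<forall>m\<ge>M. \<forall>n\<ge>M. dist (E x m h) (E x n h) < e"
      unfolding dist_real_def by (intro exI[of _ M]) (smt (verit) field_sum_of_halves)
  qed
  then have "\<exists>l. (\<lambda>n. E x n h) \<longlonglongrightarrow> l" for x h
    using Cauchy_convergent unfolding convergent_def by blast
  then obtain D where D: "\<And>x h. (\<lambda>n. E x n h) \<longlonglongrightarrow> D x h" by metis
  have rem: "\<bar>g (x + h) - g x - D x h\<bar> \<le> C' / 2 * (norm h)\<^sup>2" for x h
  proof (rule LIMSEQ_le_const2)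
    show "(\<lambda>n. \<bar>g (x + h) - g x - E x n h\<bar>) \<longlonglongrightarrow> \<bar>g (x + h) - g x - D x h\<bar>"
      by (intro tendsto_intros D)
    have "\<bar>E x n h - (g (x + h) - g x)\<bar> \<le> C' / 2 * (norm h)\<^sup>2" for n
      using tele'[of 0 n x h] by (simp add: E_def)
    then show "\<exists>M. \<forall>n\<ge>M. \<bar>g (x + h) - g x - E x n h\<bar> \<le> C' / 2 * (norm h)\<^sup>2"
      by (simp add: abs_minus_commute)
  qed
  have Dbd: "\<bar>D x h\<bar> \<le> L * norm h" for x h
  proof (rule LIMSEQ_le_const2)
    show "(\<lambda>n. \<bar>E x n h\<bar>) \<longlonglongrightarrow> \<bar>D x h\<bar>" by (intro tendsto_intros D)
    have "\<bar>E x n h\<bar> \<le> L * norm h" for n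
      using lip[of "x + (1 / 2 ^ n) *\<^sub>R h" x] unfolding E_def
      by (simp add: abs_mult pos_le_divide_eq mult.commute)
    then show "\<exists>M. \<forall>n\<ge>M. \<bar>E x n h\<bar> \<le> L * norm h" by simp
  qed
  have Dadd: "D x (h + k) = D x h + D x k" for x h k
  proof -
    \<comment> \<open>Level \<open>n\<close> for \<open>h\<close> and \<open>k\<close> is compared
      with level \<open>Suc n\<close> for \<open>h + k\<close>: the points \<open>x + h/2^n\<close>
      and \<open>x + k/2^n\<close> are symmetric about \<open>x + (h + k)/2^(n+1)\<close>. What
      remains is 2^n times one second difference of order 4^-n.\<close>
    have "(\<lambda>n. E x n h + E x n k - E x (Suc n) (h + k)) \<longlonglongrightarrow> D x h + D x k - D x (h + k)"
      by (intro tendsto_intros D LIMSEQ_Suc[OF D])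
    moreover have "(\<lambda>n. E x n h + E x n k - E x (Suc n) (h + k)) \<longlonglongrightarrow> 0"
    proof (rule Lim_null_comparison[OF _ half[of "C' * (norm (h - k))\<^sup>2 / 4"]])
      have "\<bar>E x n h + E x n k - E x (Suc n) (h + k)\<bar> \<le> C' * (norm (h - k))\<^sup>2 / 4 * (1 / 2 ^ n)" for n
      proof -
        define a where "a = (1 / 2 ^ Suc n) *\<^sub>R (h + k)"
        define b where "b = (1 / 2 ^ Suc n) *\<^sub>R (h - k)"
        have ab: "x + (1 / 2 ^ n) *\<^sub>R h = x + a + b" "x + (1 / 2 ^ n) *\<^sub>R k = x + a - b"
          unfolding a_def b_def by (simp_all add: algebra_simps scaleR_add_left[symmetric])
        have "E x n h + E x n k - E x (Suc n) (h + k) = 2 ^ n * (g (x + a + b) + g (x + a - b) - 2 * g (x + a))"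
          unfolding E_def ab a_def[symmetric] by (simp add: algebra_simps)
        then have "\<bar>E x n h + E x n k - E x (Suc n) (h + k)\<bar> \<le> 2 ^ n * (C' * (norm b)\<^sup>2)"
          using sd'[of "x + a" b] by (simp add: abs_mult)
        also have "\<dots> = C' * (norm (h - k))\<^sup>2 / 4 * (1 / 2 ^ n)"
          unfolding b_def norm_scaleR by (simp add: power2_eq_square field_simps)
        finally show ?thesis .
      qed
      then show "\<forall>\<^sub>F n in sequentially. norm (E x n h + E x n k - E x (Suc n) (h + k))
          \<le> C' * (norm (h - k))\<^sup>2 / 4 * (1 / 2 ^ n)" by simp
    qed
    ultimately have "D x h + D x k - D x (h + k) = 0" by (rule LIMSEQ_unique)
    then show ?thesis by simp
  qed
  have bl: "bounded_linear (D x)" for x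
    by (rule additive_bounded_imp_bounded_linear[OF Dadd Dbd])
  have der: "(g has_derivative D x) (at x)" for x
    unfolding has_derivative_at_alt
  proof (intro conjI allI impI bl)
    fix e :: real assume e: "e > 0"
    show "\<exists>d>0. \<forall>y. norm (y - x) < d \<longrightarrow> norm (g y - g x - D x (y - x)) \<le> e * norm (y - x)"
    proof (intro exI[of _ "e / (C' + 1)"] conjI allI impI)
      show "e / (C' + 1) > 0" using e C' by simp
      fix y assume "norm (y - x) < e / (C' + 1)"
      then have "norm (y - x) * (C' + 1) \<le> e" using C' by (simp add: pos_less_divide_eq)
      moreover have "C' / 2 * norm (y - x) \<le> norm (y - x) * (C' + 1)"
        using C' by (simp add: field_simps)
      ultimately have "C' / 2 * norm (y - x) \<le> e" by linarith
      then have "C' / 2 * norm (y - x) * norm (y - x) \<le> e * norm (y - x)"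
        by (intro mult_right_mono) auto
      then show "norm (g y - g x - D x (y - x)) \<le> e * norm (y - x)"
        using rem[of x "y - x"] by (simp add: power2_eq_square mult.assoc)
    qed
  qed
  have Dlip: "\<bar>D y h - D x h\<bar> \<le> 3 * C' * norm (y - x) * norm h" for x y h
  proof (cases "h = 0 \<or> y = x")
    case True
    then show ?thesis using bl linear_0[OF bounded_linear.linear[OF bl]] by auto
  next
    case False
    define d where "d = y - x"
    \<comment> \<open>The value \<open>g (y + k)\<close> is expanded around \<open>y\<close>, and
      around \<open>x\<close> by way of \<open>y = x + d\<close>. The three remainders have
      increments of length at most 2|d|, |d| and |d|, which gives the constant C'/2 (4 + 1 + 1) = 3
      C'.\<close>
    have eq1: "\<bar>D y k - D x k\<bar> \<le> 3 * C' * (norm d)\<^sup>2" if k: "norm k = norm d" for k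
    proof -
      have "(norm (d + k))\<^sup>2 \<le> (2 * norm d)\<^sup>2"
        using norm_triangle_ineq[of d k] k by (intro power_mono) auto
      then have "C' / 2 * (norm (d + k))\<^sup>2 \<le> C' / 2 * (4 * (norm d)\<^sup>2)"
        using C' by (intro mult_left_mono) (auto simp: power_mult_distrib)
      moreover define X where "X = g (x + (d + k)) - g x - D x (d + k)"
    moreover define Y where "Y = g (y + k) - g y - D y k"
    moreover define Z where "Z = g (x + d) - g x - D x d"
    moreover have "D y k - D x k = X - Y - Z"
      unfolding X_def Y_def Z_def Dadd d_def by (simp add: algebra_simps)
    moreover have "C' / 2 * (4 * (norm d)\<^sup>2) + C' / 2 * (norm d)\<^sup>2 + C' / 2 * (norm d)\<^sup>2 = 3 * C' * (norm d)\<^sup>2"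
      by (simp add: field_simps)
    ultimately show ?thesis
      using rem[of x "d + k"] rem[of y k] rem[of x d] unfolding k by linarith
  qed
  \<comment> \<open>Both sides of the claim are homogeneous in \<open>h\<close>, so \<open>h\<close>
    may be rescaled to the length of \<open>d\<close>.\<close>
  define c where "c = norm d / norm h"
    have c: "c > 0" using False unfolding c_def d_def by simp
    have sc: "D z (c *\<^sub>R h) = c * D z h" for z
      using linear_cmul[OF bounded_linear.linear[OF bl]] by simp
    have "\<bar>D y (c *\<^sub>R h) - D x (c *\<^sub>R h)\<bar> \<le> 3 * C' * (norm d)\<^sup>2"
      by (rule eq1) (use False in \<open>simp add: c_def\<close>)
    then have "c * \<bar>D y h - D x h\<bar> \<le> 3 * C' * (norm d)\<^sup>2"
      using c unfolding sc by (simp add: right_diff_distrib[symmetric] abs_mult)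
    then have "c * \<bar>D y h - D x h\<bar> \<le> c * (3 * C' * norm d * norm h)"
      using False unfolding c_def by (simp add: power2_eq_square mult_ac)
    then show ?thesis using c unfolding d_def by simp
  qed
  define DD where "DD = (\<lambda>x. Blinfun (D x))"
  have DD: "blinfun_apply (DD x) = D x" for x unfolding DD_def by (rule bounded_linear_Blinfun_apply[OF bl])
  have "dist (DD y) (DD x) \<le> 3 * C' * dist y x" for x y
    unfolding dist_norm
    by (rule norm_blinfun_bound) (use C' Dlip in \<open>auto simp: blinfun.diff_left DD\<close>)
  then have "(3 * C')-lipschitz_on UNIV DD"
    using C' by (intro lipschitz_onI) auto
  then have "continuous_on UNIV DD" by (rule lipschitz_on_continuous_on)
  then show ?thesis unfolding C1_on_def using der DD by (intro exI[of _ DD]) auto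
qed

text \<open>By the parallelogram law the square of \<open>N\<close> has second differences equal to
  \<open>2 * (N h)\<^sup>2\<close>. The infimal convolution \<open>G1\<close> inherits from its
  penalty an upper bound on second differences, the supremal convolution \<open>G2\<close> a lower
  one; the upper bound survives the second convolution because its penalty is twice as steep. Both
  are infima or suprema of translates plus constants and so keep the Lipschitz constant.\<close>

lemma lasry_lions:
  fixes N :: "'a::real_normed_vector \<Rightarrow> real" and F :: "'a \<Rightarrow> real"
  assumes par: "\<And>u v. (N (u + v))\<^sup>2 + (N (u - v))\<^sup>2 = 2 * (N u)\<^sup>2 + 2 * (N v)\<^sup>2"
    and N0: "\<And>v. 0 \<le> N v" and Nb: "\<And>v. N v \<le> b * norm v"
    and L: "0 \<le> L" and lip: "\<And>x y. F x - F y \<le> L * N (x - y)" and \<delta>: "0 < \<delta>"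
  shows "\<exists>g. C1_on UNIV g \<and> (\<forall>x. \<bar>g x - F x\<bar> \<le> \<delta>) \<and> (\<forall>x y. \<bar>g x - g y\<bar> \<le> L * N (x - y))"
proof -
  have Nz: "N 0 = 0" using par[of 0 0] by simp
  have Nm: "N (- v) = N v" for v
    using par[of 0 v] N0[of v] N0[of "-v"] Nz by simp
  \<comment> \<open>The maximum of \<open>L * t - k * t\<^sup>2\<close> is
    \<open>L\<^sup>2 / (4 * k)\<close>, which has to be at most \<open>\<delta>\<close>; the added 1
    keeps \<open>k\<close> positive for \<open>L = 0\<close>.\<close>
  define k where "k = (L\<^sup>2 + 1) / (4 * \<delta>)"
  have k: "k > 0" unfolding k_def using \<delta> by (simp add: add_nonneg_pos)
  have quad: "L * t - k * t\<^sup>2 \<le> \<delta>" for t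
  proof -
    have "0 \<le> (2 * k * t - L)\<^sup>2" by simp
    then have "4 * k * (L * t - k * t\<^sup>2) \<le> L\<^sup>2" by (simp add: power2_eq_square algebra_simps)
    also have "\<dots> \<le> 4 * k * \<delta>" unfolding k_def using \<delta> by simp
    finally show ?thesis using k by simp
  qed
  define G1 where "G1 = (\<lambda>x. INF z. F (x + z) + k * (N z)\<^sup>2)"
  have lowF: "F x - \<delta> \<le> F (x + z) + k * (N z)\<^sup>2" for x z
    using lip[of x "x + z"] quad[of "N z"] by (simp add: Nm)
  have bdd1: "bdd_below (range (\<lambda>z. F (x + z) + k * (N z)\<^sup>2))" for x
    by (rule bdd_belowI[of _ "F x - \<delta>"]) (use lowF in auto)
  have G1_le: "G1 x \<le> F (x + z) + k * (N z)\<^sup>2" for x z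
    unfolding G1_def by (rule cINF_lower[OF bdd1]) simp
  have G1_ge: "c \<le> G1 x" if "\<And>z. c \<le> F (x + z) + k * (N z)\<^sup>2" for c x
    unfolding G1_def by (rule cINF_greatest) (use that in auto)
  have G1_leF: "G1 x \<le> F x" for x using G1_le[of x 0] Nz by simp
  have G1_geF: "F x - \<delta> \<le> G1 x" for x by (rule G1_ge) (rule lowF)
  have G1_lip: "G1 x - G1 y \<le> L * N (x - y)" for x y
  proof -
    have "G1 x - L * N (x - y) \<le> G1 y"
    proof (rule G1_ge)
      fix z
      show "G1 x - L * N (x - y) \<le> F (y + z) + k * (N z)\<^sup>2"
        using G1_le[of x z] lip[of "x + z" "y + z"] by simp
    qed
    then show ?thesis by simp
  qed
  \<comment> \<open>The competitors \<open>z - h\<close> at \<open>x + h\<close> and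
    \<open>z + h\<close> at \<open>x - h\<close> evaluate \<open>F\<close> at the same point
    \<open>x + z\<close>, so only the penalties differ.\<close>
  have G1_sd: "G1 (x + h) + G1 (x - h) \<le> 2 * G1 x + 2 * k * (N h)\<^sup>2" for x h
  proof -
    have "(G1 (x + h) + G1 (x - h)) / 2 - k * (N h)\<^sup>2 \<le> G1 x"
    proof (rule G1_ge)
      fix z
      have "k * (N (z + h))\<^sup>2 + k * (N (z - h))\<^sup>2 = 2 * k * (N z)\<^sup>2 + 2 * k * (N h)\<^sup>2"
        using arg_cong[OF par[of z h], of "\<lambda>t. k * t"] by (simp add: algebra_simps)
      then show "(G1 (x + h) + G1 (x - h)) / 2 - k * (N h)\<^sup>2 \<le> F (x + z) + k * (N z)\<^sup>2"
        using G1_le[of "x + h" "z - h"] G1_le[of "x - h" "z + h"] by (simp add: field_simps)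
    qed
    then show ?thesis by (simp add: field_simps)
  qed
  define G2 where "G2 = (\<lambda>x. SUP z. G1 (x + z) - 2 * k * (N z)\<^sup>2)"
  have up1: "G1 (x + z) - 2 * k * (N z)\<^sup>2 \<le> G1 x + \<delta>" for x z
  proof -
    have "0 \<le> k * (N z)\<^sup>2" using k by simp
    then show ?thesis using G1_lip[of "x + z" x] quad[of "N z"] by simp
  qed
  have bdd2: "bdd_above (range (\<lambda>z. G1 (x + z) - 2 * k * (N z)\<^sup>2))" for x
    by (rule bdd_aboveI[of _ "G1 x + \<delta>"]) (use up1 in auto)
  have G2_ge: "G1 (x + z) - 2 * k * (N z)\<^sup>2 \<le> G2 x" for x z
    unfolding G2_def by (rule cSUP_upper[OF _ bdd2]) simp
  have G2_le: "G2 x \<le> c" if "\<And>z. G1 (x + z) - 2 * k * (N z)\<^sup>2 \<le> c" for c x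
    unfolding G2_def by (rule cSUP_least) (use that in auto)
  have G2_lip: "G2 x - G2 y \<le> L * N (x - y)" for x y
  proof -
    have "G2 x \<le> G2 y + L * N (x - y)"
    proof (rule G2_le)
      fix z
      show "G1 (x + z) - 2 * k * (N z)\<^sup>2 \<le> G2 y + L * N (x - y)"
        using G2_ge[of y z] G1_lip[of "x + z" "y + z"] by simp
    qed
    then show ?thesis by simp
  qed
  have G2_lip': "\<bar>G2 x - G2 y\<bar> \<le> L * N (x - y)" for x y
    using G2_lip[of x y] G2_lip[of y x] Nm[of "x - y"] by simp
  have close: "\<bar>G2 x - F x\<bar> \<le> \<delta>" for x
  proof -
    have "G2 x \<le> G1 x + \<delta>" by (rule G2_le) (rule up1)
    moreover have "G1 x \<le> G2 x" using G2_ge[of x 0] Nz by simp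
    ultimately show ?thesis using G1_leF[of x] G1_geF[of x] by linarith
  qed
  have sd_low: "2 * G2 x \<le> G2 (x + h) + G2 (x - h) + 4 * k * (N h)\<^sup>2" for x h
  proof -
    have "G2 x \<le> (G2 (x + h) + G2 (x - h)) / 2 + 2 * k * (N h)\<^sup>2"
    proof (rule G2_le)
      fix z
      have "2 * k * (N (z + h))\<^sup>2 + 2 * k * (N (z - h))\<^sup>2 = 4 * k * (N z)\<^sup>2 + 4 * k * (N h)\<^sup>2"
        using arg_cong[OF par[of z h], of "\<lambda>t. 2 * k * t"] by (simp add: algebra_simps)
      then show "G1 (x + z) - 2 * k * (N z)\<^sup>2 \<le> (G2 (x + h) + G2 (x - h)) / 2 + 2 * k * (N h)\<^sup>2"
        using G2_ge[of "x + h" "z - h"] G2_ge[of "x - h" "z + h"] by (simp add: field_simps)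
    qed
    then show ?thesis by (simp add: field_simps)
  qed
  have sd_up: "G2 (x + h) + G2 (x - h) \<le> 2 * G2 x + 4 * k * (N h)\<^sup>2" for x h
  proof -
    have key: "G1 (x + h + z) - 2 * k * (N z)\<^sup>2 + (G1 (x - h + w) - 2 * k * (N w)\<^sup>2)
        \<le> 2 * G2 x + 4 * k * (N h)\<^sup>2" for z w
    proof -
      \<comment> \<open>Mean and half difference of the two displacements. The upper bound for
        \<open>G1\<close> is used around \<open>x + m\<close> with increment \<open>h + e\<close>;
        the term \<open>4 * k * (N e)\<^sup>2\<close> that this costs is exactly what the steeper
        penalty \<open>2 * k\<close> supplies.\<close>
      define m where "m = (1/2) *\<^sub>R (z + w)"
      define e where "e = (1/2) *\<^sub>R (z - w)"
      have zw: "z = m + e" "w = m - e" unfolding m_def e_def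
        by (simp_all add: algebra_simps scaleR_add_left[symmetric])
      have "2 * k * (N z)\<^sup>2 + 2 * k * (N w)\<^sup>2 = 4 * k * (N m)\<^sup>2 + 4 * k * (N e)\<^sup>2"
        using arg_cong[OF par[of m e], of "\<lambda>t. 2 * k * t"] unfolding zw by (simp add: algebra_simps)
      moreover have "G1 (x + h + z) + G1 (x - h + w) \<le> 2 * G1 (x + m) + 2 * k * (N (h + e))\<^sup>2"
        using G1_sd[of "x + m" "h + e"] unfolding zw by (simp add: algebra_simps)
      moreover have "2 * k * (N (h + e))\<^sup>2 \<le> 4 * k * (N h)\<^sup>2 + 4 * k * (N e)\<^sup>2"
      proof -
        have "(N (h + e))\<^sup>2 \<le> 2 * (N h)\<^sup>2 + 2 * (N e)\<^sup>2"
          using par[of h e] zero_le_power2[of "N (h - e)"] by linarith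
        then have "2 * k * (N (h + e))\<^sup>2 \<le> 2 * k * (2 * (N h)\<^sup>2 + 2 * (N e)\<^sup>2)"
          using k by (intro mult_left_mono) auto
        then show ?thesis by (simp add: algebra_simps)
      qed
      ultimately show ?thesis using G2_ge[of x m] by linarith
    qed
    have "G2 (x - h) \<le> 2 * G2 x + 4 * k * (N h)\<^sup>2 - (G1 (x + h + z) - 2 * k * (N z)\<^sup>2)" for z
      by (rule G2_le) (use key[of z] in \<open>smt (verit)\<close>)
    then have "G2 (x + h) \<le> 2 * G2 x + 4 * k * (N h)\<^sup>2 - G2 (x - h)"
      by (intro G2_le) (smt (verit))
    then show ?thesis by simp
  qed
  have "C1_on UNIV G2"
  proof (rule C1_on_second_difference)
    show "\<bar>G2 x - G2 y\<bar> \<le> L * b * norm (x - y)" for x y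
      using G2_lip'[of x y] mult_left_mono[OF Nb[of "x - y"] L] by (simp add: mult.assoc)
    show "\<bar>G2 (x + h) + G2 (x - h) - 2 * G2 x\<bar> \<le> 4 * k * b\<^sup>2 * (norm h)\<^sup>2" for x h
    proof -
      have "(N h)\<^sup>2 \<le> (b * norm h)\<^sup>2" by (rule power_mono[OF Nb N0])
      then have "4 * k * (N h)\<^sup>2 \<le> 4 * k * (b * norm h)\<^sup>2" using k by (intro mult_left_mono) auto
      then show ?thesis using sd_up[of x h] sd_low[of x h]
        by (simp add: power_mult_distrib abs_le_iff mult.assoc)
    qed
  qed
  then show ?thesis using close G2_lip' by blast
qed

section \<open>Continuously differentiable functions near a point\<close>

definition C1_at :: "'a::real_normed_vector \<Rightarrow> ('a \<Rightarrow> 'b::real_normed_vector) \<Rightarrow> bool" where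
  "C1_at x F \<longleftrightarrow> (\<exists>T. open T \<and> x \<in> T \<and> C1_on T F)"

lemma C1_on_subset: "C1_on S F \<Longrightarrow> T \<subseteq> S \<Longrightarrow> C1_on T F"
  unfolding C1_on_def by (meson continuous_on_subset subsetD)

lemma C1_on_cong:
  assumes "open S" "C1_on S F" "\<And>x. x \<in> S \<Longrightarrow> F x = G x"
  shows "C1_on S G"
  using assms unfolding C1_on_def by (metis has_derivative_transform_within_open)

lemma C1_on_continuous: "C1_on S F \<Longrightarrow> continuous_on S F"
  unfolding C1_on_def by (meson continuous_at_imp_continuous_on has_derivative_continuous)

text \<open>The derivative maps coming from different neighbourhoods are different functions.
  \<open>frechet_derivative\<close> agrees with each of them by uniqueness and is therefore one map,
  continuous on all of \<open>S\<close>.\<close>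

lemma C1_on_open_iff:
  assumes "open S"
  shows "C1_on S F \<longleftrightarrow> (\<forall>x\<in>S. C1_at x F)"
proof
  assume "C1_on S F" then show "\<forall>x\<in>S. C1_at x F" using assms unfolding C1_at_def by blast
next
  assume *: "\<forall>x\<in>S. C1_at x F"
  define D where "D = (\<lambda>x. Blinfun (frechet_derivative F (at x)))"
  have loc: "(F has_derivative blinfun_apply (D x)) (at x) \<and> continuous (at x) D" if "x \<in> S" for x
  proof -
    obtain T where T: "open T" "x \<in> T" "C1_on T F"
      using * \<open>x \<in> S\<close> unfolding C1_at_def by blast
    obtain E where E: "\<And>y. y \<in> T \<Longrightarrow> (F has_derivative blinfun_apply (E y)) (at y)" "continuous_on T E"
      using T(3) unfolding C1_on_def by auto
    have eq: "D y = E y" if "y \<in> T" for y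
      unfolding D_def frechet_derivative_at[OF E(1)[OF that], symmetric] by (rule blinfun_apply_inverse)
    then have "continuous_on T D" using E(2) continuous_on_cong by metis
    then show ?thesis using eq[OF T(2)] E(1)[OF T(2)] T continuous_on_eq_continuous_at by metis
  qed
  then show "C1_on S F" unfolding C1_on_def
    by (intro exI[of _ D]) (auto intro!: continuous_at_imp_continuous_on)
qed

lemma C1_at_Int:
  assumes "C1_at x F" "C1_at x G"
  obtains T where "open T" "x \<in> T" "C1_on T F" "C1_on T G"
  using assms unfolding C1_at_def by (metis C1_on_subset IntI inf_le1 inf_le2 open_Int)

lemma C1_at_cong:
  assumes "C1_at x F" "open T" "x \<in> T" "\<And>y. y \<in> T \<Longrightarrow> F y = G y"
  shows "C1_at x G"
proof -
  obtain S where "open S" "x \<in> S" "C1_on S F" using assms(1) unfolding C1_at_def by blast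
  then have "C1_on (S \<inter> T) G"
    using assms by (intro C1_on_cong[of "S \<inter> T" F G]) (auto intro: C1_on_subset)
  then show ?thesis using \<open>open S\<close> \<open>x \<in> S\<close> assms unfolding C1_at_def by blast
qed

lemma C1_at_has_derivative:
  assumes "C1_at x F"
  shows "(F has_derivative frechet_derivative F (at x)) (at x)"
  using assms unfolding C1_at_def C1_on_def
  by (meson differentiableI frechet_derivative_works)

section \<open>Sums, products and compositions of functions that are C1 near a point\<close>

lemma C1_at_const: "C1_at x (\<lambda>_. c)"
  unfolding C1_at_def C1_on_def
  by (intro exI[of _ UNIV] conjI exI[of _ "\<lambda>_. 0"]) (auto simp: zero_blinfun.rep_eq)

lemma C1_at_add:
  assumes "C1_at x F" "C1_at x G"
  shows "C1_at x (\<lambda>y. F y + G y)"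
proof -
  obtain T where T: "open T" "x \<in> T" "C1_on T F" "C1_on T G" using C1_at_Int[OF assms] .
  obtain D E where "\<forall>x\<in>T. (F has_derivative blinfun_apply (D x)) (at x)" "continuous_on T D"
    "\<forall>x\<in>T. (G has_derivative blinfun_apply (E x)) (at x)" "continuous_on T E"
    using T unfolding C1_on_def by auto
  then have "C1_on T (\<lambda>y. F y + G y)" unfolding C1_on_def
    by (intro exI[of _ "\<lambda>y. D y + E y"]) (auto intro!: continuous_intros derivative_eq_intros simp: blinfun.add_left)
  then show ?thesis using T unfolding C1_at_def by blast
qed

lemma C1_at_mult:
  fixes F G :: "'a::real_normed_vector \<Rightarrow> real"
  assumes "C1_at x F" "C1_at x G"
  shows "C1_at x (\<lambda>y. F y * G y)"
proof -
  obtain T where T: "open T" "x \<in> T" "C1_on T F" "C1_on T G" using C1_at_Int[OF assms] .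
  obtain D E where DE: "\<forall>x\<in>T. (F has_derivative blinfun_apply (D x)) (at x)" "continuous_on T D"
    "\<forall>x\<in>T. (G has_derivative blinfun_apply (E x)) (at x)" "continuous_on T E"
    using T unfolding C1_on_def by auto
  have "((\<lambda>y. F y * G y) has_derivative blinfun_apply (F y *\<^sub>R E y + G y *\<^sub>R D y)) (at y)" if "y \<in> T" for y
    using has_derivative_mult[OF DE(1)[rule_format, OF that] DE(3)[rule_format, OF that]]
    by (rule has_derivative_eq_rhs) (auto simp: fun_eq_iff blinfun.add_left blinfun.scaleR_left)
  moreover have "continuous_on T (\<lambda>y. F y *\<^sub>R E y + G y *\<^sub>R D y)"
    by (intro continuous_intros DE C1_on_continuous T)
  ultimately have "C1_on T (\<lambda>y. F y * G y)" unfolding C1_on_def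
    by (intro exI[of _ "\<lambda>y. F y *\<^sub>R E y + G y *\<^sub>R D y"] conjI ballI)
  then show ?thesis using T unfolding C1_at_def by blast
qed

lemma C1_on_compose:
  assumes "C1_on S \<Phi>" "C1_on T F" "\<Phi> ` S \<subseteq> T"
  shows "C1_on S (F \<circ> \<Phi>)"
proof -
  obtain D E where DE: "\<forall>x\<in>S. (\<Phi> has_derivative blinfun_apply (D x)) (at x)" "continuous_on S D"
    "\<forall>x\<in>T. (F has_derivative blinfun_apply (E x)) (at x)" "continuous_on T E"
    using assms unfolding C1_on_def by auto
  have "((F \<circ> \<Phi>) has_derivative blinfun_apply (E (\<Phi> x) o\<^sub>L D x)) (at x)" if "x \<in> S" for x
  proof -
    have "((F \<circ> \<Phi>) has_derivative (blinfun_apply (E (\<Phi> x)) \<circ> blinfun_apply (D x))) (at x)"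
      using DE that assms(3) by (intro diff_chain_at) auto
    then show ?thesis by (simp add: o_def blinfun_apply_blinfun_compose[abs_def] fun_eq_iff)
  qed
  moreover have "continuous_on S (\<lambda>x. E (\<Phi> x) o\<^sub>L D x)"
    by (intro bounded_bilinear.continuous_on[OF bounded_bilinear_blinfun_compose] DE(2)
        continuous_on_compose2[OF DE(4) C1_on_continuous[OF assms(1)] assms(3)])
  ultimately show ?thesis unfolding C1_on_def
    by (intro exI[of _ "\<lambda>x. E (\<Phi> x) o\<^sub>L D x"] conjI ballI)
qed

lemma C1_at_compose:
  assumes "C1_at x \<Phi>" "C1_at (\<Phi> x) F"
  shows "C1_at x (F \<circ> \<Phi>)"
proof -
  obtain S T where S: "open S" "x \<in> S" "C1_on S \<Phi>" and T: "open T" "\<Phi> x \<in> T" "C1_on T F"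
    using assms unfolding C1_at_def by blast
  have op: "open (S \<inter> \<Phi> -` T)"
    using continuous_open_preimage[OF C1_on_continuous[OF S(3)] S(1) T(1)] .
  have "C1_on (S \<inter> \<Phi> -` T) (F \<circ> \<Phi>)"
    by (rule C1_on_compose[OF C1_on_subset[OF S(3)] T(3)]) auto
  then show ?thesis unfolding C1_at_def using op S T by (intro exI[of _ "S \<inter> \<Phi> -` T"]) auto
qed

lemma C1_on_real:
  fixes \<phi> :: "real \<Rightarrow> real"
  assumes "\<And>t. (\<phi> has_real_derivative \<phi>' t) (at t)" "continuous_on UNIV \<phi>'"
  shows "C1_on UNIV \<phi>"
proof -
  have "(\<phi> has_derivative blinfun_apply (\<phi>' t *\<^sub>R id_blinfun)) (at t)" for t
    using assms(1)[of t] unfolding has_field_derivative_def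
    by (rule has_derivative_eq_rhs) (simp add: blinfun.scaleR_left fun_eq_iff)
  then show ?thesis unfolding C1_on_def
    by (intro exI[of _ "\<lambda>t. \<phi>' t *\<^sub>R id_blinfun"]) (auto intro!: continuous_intros assms)
qed

text \<open>The gauge \<open>n\<close> is meant to be the norm of the tangent space, read in a chart.\<close>

definition C1b :: "'a::real_normed_vector \<Rightarrow> ('a \<Rightarrow> real) \<Rightarrow> real \<Rightarrow> ('a \<Rightarrow> real) \<Rightarrow> bool" where
  "C1b x n K F \<longleftrightarrow> C1_at x F \<and> (\<forall>v. \<bar>frechet_derivative F (at x) v\<bar> \<le> K * n v)"

section \<open>Bounds for differentials measured in a gauge\<close>

lemma C1bI:
  assumes "C1_at x F" "(F has_derivative D) (at x)" "\<And>v. \<bar>D v\<bar> \<le> K * n v"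
  shows "C1b x n K F"
  using assms frechet_derivative_at[OF assms(2)] unfolding C1b_def by simp

lemma C1bE:
  assumes "C1b x n K F"
  obtains D where "C1_at x F" "(F has_derivative D) (at x)" "\<And>v. \<bar>D v\<bar> \<le> K * n v"
  using assms C1_at_has_derivative unfolding C1b_def by blast

lemma C1b_cong:
  assumes "C1b x n K F" "open T" "x \<in> T" "\<And>y. y \<in> T \<Longrightarrow> F y = G y"
  shows "C1b x n K G"
  using assms(1)
proof (rule C1bE)
  fix D assume D: "C1_at x F" "(F has_derivative D) (at x)" "\<And>v. \<bar>D v\<bar> \<le> K * n v"
  show ?thesis
    by (rule C1bI[OF C1_at_cong[OF D(1) assms(2-4)]
          has_derivative_transform_within_open[OF D(2) assms(2-4)] D(3)])
qed

lemma C1b_const: "C1b x n 0 (\<lambda>_. c)"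
  by (rule C1bI[OF C1_at_const has_derivative_const]) simp

lemma C1b_mono:
  assumes "C1b x n K F" "K \<le> K'" "\<And>v. 0 \<le> n v"
  shows "C1b x n K' F"
  using assms unfolding C1b_def by (meson mult_right_mono order_trans)

lemma C1b_add:
  assumes "C1b x n K F" "C1b x n K' G"
  shows "C1b x n (K + K') (\<lambda>y. F y + G y)"
proof -
  obtain D where D: "C1_at x F" "(F has_derivative D) (at x)" "\<And>v. \<bar>D v\<bar> \<le> K * n v" using C1bE[OF assms(1)] by metis
  obtain E where E: "C1_at x G" "(G has_derivative E) (at x)" "\<And>v. \<bar>E v\<bar> \<le> K' * n v" using C1bE[OF assms(2)] by metis
  show ?thesis
  proof (rule C1bI[OF C1_at_add[OF D(1) E(1)] has_derivative_add[OF D(2) E(2)]])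
    show "\<bar>D v + E v\<bar> \<le> (K + K') * n v" for v
      using D(3)[of v] E(3)[of v] by (simp add: distrib_right)
  qed
qed

lemma C1b_sum:
  assumes "finite I" "\<And>i. i \<in> I \<Longrightarrow> C1b x n (K i) (F i)"
  shows "C1b x n (sum K I) (\<lambda>y. \<Sum>i\<in>I. F i y)"
  using assms by (induction I rule: finite_induct) (auto simp: C1b_const intro!: C1b_add)

lemma C1b_mult:
  assumes "C1b x n K F" "C1b x n K' G" "\<bar>F x\<bar> \<le> a" "\<bar>G x\<bar> \<le> b"
  shows "C1b x n (a * K' + b * K) (\<lambda>y. F y * G y)"
proof -
  obtain D where D: "C1_at x F" "(F has_derivative D) (at x)" "\<And>v. \<bar>D v\<bar> \<le> K * n v" using C1bE[OF assms(1)] by metis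
  obtain E where E: "C1_at x G" "(G has_derivative E) (at x)" "\<And>v. \<bar>E v\<bar> \<le> K' * n v" using C1bE[OF assms(2)] by metis
  show ?thesis
  proof (rule C1bI[OF C1_at_mult[OF D(1) E(1)] has_derivative_mult[OF D(2) E(2)]])
    fix v
    have "\<bar>F x * E v\<bar> \<le> a * (K' * n v)" "\<bar>D v * G x\<bar> \<le> (K * n v) * b"
      unfolding abs_mult using assms(3,4) D(3)[of v] E(3)[of v] by (auto intro!: mult_mono)
    then show "\<bar>F x * E v + D v * G x\<bar> \<le> (a * K' + b * K) * n v"
      by (simp add: algebra_simps)
  qed
qed

lemma C1b_compose:
  assumes "C1b x n K F" "\<And>t. (\<phi> has_real_derivative \<phi>' t) (at t)" "continuous_on UNIV \<phi>'"
    "\<bar>\<phi>' (F x)\<bar> \<le> a"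
  shows "C1b x n (a * K) (\<lambda>y. \<phi> (F y))"
proof -
  obtain D where D: "C1_at x F" "(F has_derivative D) (at x)" "\<And>v. \<bar>D v\<bar> \<le> K * n v" using C1bE[OF assms(1)] by metis
  have "C1_at (F x) \<phi>" using C1_on_real[OF assms(2,3)] unfolding C1_at_def by blast
  from C1_at_compose[OF D(1) this] have 1: "C1_at x (\<lambda>y. \<phi> (F y))" by (simp add: o_def)
  have 2: "((\<lambda>y. \<phi> (F y)) has_derivative (\<lambda>v. \<phi>' (F x) * D v)) (at x)"
    using has_derivative_compose[OF D(2) assms(2)[unfolded has_field_derivative_def]] .
  show ?thesis
  proof (rule C1bI[OF 1 2])
    show "\<bar>\<phi>' (F x) * D v\<bar> \<le> a * K * n v" for v
      using mult_mono[OF assms(4) D(3)[of v]] assms(4) unfolding abs_mult by (simp add: mult_ac)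
  qed
qed

text \<open>The differential vanishes at a minimum. Thus a bump that is 0 at a point contributes no
  differential there, even on the boundary of its support, and overlaps can be counted by membership
  and not by closures.\<close>

lemma C1b_zero_min:
  assumes "C1b x n K F" "F x = 0" "\<And>y. 0 \<le> F y"
  shows "C1b x n 0 F"
proof -
  obtain D where D: "C1_at x F" "(F has_derivative D) (at x)" "\<And>v. \<bar>D v\<bar> \<le> K * n v" using C1bE[OF assms(1)] by metis
  have "D = (\<lambda>h. 0)"
    by (rule has_derivative_local_min[OF D(2)]) (use assms in \<open>auto intro: always_eventually\<close>)
  with D show ?thesis by (intro C1bI[OF D(1,2)]) auto
qed

text \<open>
  As the weights sum to 1, their differentials cancel, so that each differential is multiplied
  only by the small deviation of \<open>F i\<close> from the common value \<open>c\<close>.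
\<close>

lemma C1b_partition:
  assumes fin: "finite I"
    and w: "\<And>i. i \<in> I \<Longrightarrow> C1b x n (\<kappa> i) (w i)" and F: "\<And>i. i \<in> I \<Longrightarrow> C1b x n K (F i)"
    and w0: "\<And>i. i \<in> I \<Longrightarrow> 0 \<le> w i x"
    and T: "open T" "x \<in> T" "\<And>y. y \<in> T \<Longrightarrow> (\<Sum>i\<in>I. w i y) = 1"
    and dev: "\<And>i. i \<in> I \<Longrightarrow> \<bar>F i x - c\<bar> * \<kappa> i \<le> e i"
    and n0: "\<And>v. 0 \<le> n v"
  shows "C1b x n (K + sum e I) (\<lambda>y. \<Sum>i\<in>I. w i y * F i y)"
proof -
  have "\<exists>D. (w i has_derivative D) (at x) \<and> (\<forall>v. \<bar>D v\<bar> \<le> \<kappa> i * n v)" if "i \<in> I" for i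
    using C1bE[OF w[OF that]] by metis
  then obtain Dw where Dw: "\<And>i. i \<in> I \<Longrightarrow> (w i has_derivative Dw i) (at x)"
     "\<And>i v. i \<in> I \<Longrightarrow> \<bar>Dw i v\<bar> \<le> \<kappa> i * n v" by metis
  have "\<exists>D. (F i has_derivative D) (at x) \<and> (\<forall>v. \<bar>D v\<bar> \<le> K * n v)" if "i \<in> I" for i
    using C1bE[OF F[OF that]] by metis
  then obtain DF where DF: "\<And>i. i \<in> I \<Longrightarrow> (F i has_derivative DF i) (at x)"
     "\<And>i v. i \<in> I \<Longrightarrow> \<bar>DF i v\<bar> \<le> K * n v" by metis
  have C1: "C1_at x (\<lambda>y. \<Sum>i\<in>I. w i y * F i y)"
    using fin w F
    by (induction I rule: finite_induct) (auto simp: C1_at_const C1b_def intro!: C1_at_add C1_at_mult)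
  have der: "((\<lambda>y. \<Sum>i\<in>I. w i y * F i y) has_derivative
      (\<lambda>v. \<Sum>i\<in>I. w i x * DF i v + Dw i v * F i x)) (at x)"
    by (intro has_derivative_sum has_derivative_mult Dw DF)
  have "((\<lambda>y. \<Sum>i\<in>I. w i y) has_derivative (\<lambda>v. \<Sum>i\<in>I. Dw i v)) (at x)"
    by (intro has_derivative_sum Dw)
  then have "((\<lambda>y. 1::real) has_derivative (\<lambda>v. \<Sum>i\<in>I. Dw i v)) (at x)"
    by (rule has_derivative_transform_within_open[OF _ T(1,2)]) (rule T(3))
  then have "(\<lambda>v. \<Sum>i\<in>I. Dw i v) = (\<lambda>v. 0)"
    using has_derivative_const has_derivative_unique by blast
  then have zero: "(\<Sum>i\<in>I. Dw i v) = 0" for v by meson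
  show ?thesis
  proof (rule C1bI[OF C1 der])
    fix v
    have "(\<Sum>i\<in>I. w i x * DF i v + Dw i v * F i x)
        = (\<Sum>i\<in>I. w i x * DF i v + Dw i v * (F i x - c)) + (\<Sum>i\<in>I. Dw i v) * c"
      unfolding sum_distrib_right sum.distrib[symmetric] by (simp add: algebra_simps)
    also have "\<bar>\<dots>\<bar> \<le> (\<Sum>i\<in>I. w i x * (K * n v) + e i * n v)"
      unfolding zero mult_zero_left add_0_right
    proof (rule order_trans[OF sum_abs], rule sum_mono)
      fix i assume i: "i \<in> I"
      have "\<bar>w i x * DF i v\<bar> \<le> w i x * (K * n v)"
        unfolding abs_mult using w0[OF i] DF(2)[OF i] by (auto intro!: mult_mono)
      moreover have "\<bar>Dw i v * (F i x - c)\<bar> \<le> e i * n v"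
      proof -
        have "\<bar>Dw i v * (F i x - c)\<bar> \<le> \<kappa> i * n v * \<bar>F i x - c\<bar>"
          unfolding abs_mult by (intro mult_right_mono Dw i) auto
        also have "\<dots> = \<bar>F i x - c\<bar> * \<kappa> i * n v" by simp
        also have "\<dots> \<le> e i * n v" by (intro mult_right_mono dev i n0)
        finally show ?thesis .
      qed
      ultimately show "\<bar>w i x * DF i v + Dw i v * (F i x - c)\<bar> \<le> w i x * (K * n v) + e i * n v"
        by linarith
    qed
    also have "\<dots> = (K + sum e I) * n v"
      using T(3)[OF T(2)] by (simp add: sum.distrib sum_distrib_right[symmetric] distrib_right)
    finally show "\<bar>\<Sum>i\<in>I. w i x * DF i v + Dw i v * F i x\<bar> \<le> (K + sum e I) * n v" .
  qed
qed

text \<open>Differentiability of \<open>D 0\<close> says that \<open>D 1 x [v]\<close> is the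
  derivative. Differentiability of \<open>D 1\<close>, uniform over bounded arguments, together with
  boundedness of \<open>D 2 x\<close>, makes this derivative continuous in the operator
  norm.\<close>

lemma smooth_on_imp_C1_on:
  fixes f :: "'a::real_normed_vector \<Rightarrow> 'b::real_normed_vector"
  assumes S: "open S" and f: "smooth_on S f"
  shows "C1_on S f"
proof -
  obtain D :: "nat \<Rightarrow> 'a \<Rightarrow> 'a list \<Rightarrow> 'b" where
    D0: "\<And>x. x \<in> S \<Longrightarrow> D 0 x [] = f x" and
    ml: "\<And>k x. x \<in> S \<Longrightarrow> bounded_multilinear k (D k x)" and
    d: "\<And>k x e. x \<in> S \<Longrightarrow> e > 0 \<Longrightarrow> \<exists>d>0. \<forall>y\<in>S. dist y x < d \<longrightarrow>
          (\<forall>vs. length vs = k \<longrightarrow>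
             norm (D k y vs - D k x vs - D (Suc k) x ((y - x) # vs))
               \<le> e * norm (y - x) * prod_list (map norm vs))"
    using f unfolding smooth_on_def by blast
  have bl: "bounded_linear (\<lambda>v. D 1 x [v])" if "x \<in> S" for x
  proof -
    have lin: "\<And>vs i. length vs = 1 \<Longrightarrow> i < 1 \<Longrightarrow> linear (\<lambda>v. D 1 x (vs[i := v]))"
      and "\<exists>C. \<forall>vs. length vs = 1 \<longrightarrow> norm (D 1 x vs) \<le> C * prod_list (map norm vs)"
      using ml[OF that, of 1] unfolding bounded_multilinear_def by blast+
    then obtain C where C: "\<And>vs. length vs = 1 \<Longrightarrow> norm (D 1 x vs) \<le> C * prod_list (map norm vs)"
      by blast
    have "norm (D 1 x [v]) \<le> norm v * C" for v using C[of "[v]"] by (simp add: mult.commute)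
    moreover have "linear (\<lambda>v. D 1 x [v])" using lin[of "[undefined]" 0] by simp
    ultimately show ?thesis unfolding bounded_linear_def bounded_linear_axioms_def by blast
  qed
  define DD where "DD = (\<lambda>x. Blinfun (\<lambda>v. D 1 x [v]))"
  have DD: "blinfun_apply (DD x) v = D 1 x [v]" if "x \<in> S" for x v
    unfolding DD_def bounded_linear_Blinfun_apply[OF bl[OF that]] ..
  have der: "(f has_derivative blinfun_apply (DD x)) (at x)" if x: "x \<in> S" for x
    unfolding has_derivative_at_alt
  proof (intro conjI allI impI blinfun.bounded_linear_right)
    fix e :: real assume "e > 0"
    obtain d1 where d1: "d1 > 0" "ball x d1 \<subseteq> S" using S x openE by blast
    obtain d2 where d2: "d2 > 0" and H: "\<And>y. y \<in> S \<Longrightarrow> dist y x < d2 \<Longrightarrow>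
        norm (D 0 y [] - D 0 x [] - D (Suc 0) x [y - x]) \<le> e * norm (y - x)"
      using d[OF x \<open>e > 0\<close>, of 0] by auto
    show "\<exists>d>0. \<forall>y. norm (y - x) < d \<longrightarrow> norm (f y - f x - DD x (y - x)) \<le> e * norm (y - x)"
    proof (intro exI[of _ "min d1 d2"] conjI allI impI)
      fix y assume y: "norm (y - x) < min d1 d2"
      then have "y \<in> S" using d1 by (auto simp: dist_norm norm_minus_commute)
      with H[OF this] y show "norm (f y - f x - DD x (y - x)) \<le> e * norm (y - x)"
        by (simp add: D0 x DD dist_norm)
    qed (use d1 d2 in auto)
  qed
  have "continuous (at x) DD" if x: "x \<in> S" for x
  proof -
    obtain d1 where d1: "d1 > 0" "ball x d1 \<subseteq> S" using S x openE by blast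
    obtain d2 where d2: "d2 > 0" and H': "\<And>y vs. y \<in> S \<Longrightarrow> dist y x < d2 \<Longrightarrow> length vs = 1 \<Longrightarrow>
        norm (D 1 y vs - D 1 x vs - D (Suc 1) x ((y - x) # vs)) \<le> 1 * norm (y - x) * prod_list (map norm vs)"
      using d[OF x zero_less_one, of 1] by blast
    have H: "norm (D 1 y [v] - D 1 x [v] - D 2 x [y - x, v]) \<le> 1 * norm (y - x) * norm v"
      if "y \<in> S" "dist y x < d2" for y v
      using H'[OF that, of "[v]"] by (simp add: numeral_2_eq_2)
    obtain C where C: "\<And>vs. length vs = 2 \<Longrightarrow> norm (D 2 x vs) \<le> C * prod_list (map norm vs)"
      using ml[OF x, of 2] unfolding bounded_multilinear_def by blast
    have bound: "norm (DD y - DD x) \<le> (1 + \<bar>C\<bar>) * norm (y - x)" if "norm (y - x) < min d1 d2" for y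
    proof (rule norm_blinfun_bound)
      fix v
      have y: "y \<in> S" using that d1 by (auto simp: dist_norm norm_minus_commute)
      have "norm (D 2 x [y - x, v]) \<le> \<bar>C\<bar> * (norm (y - x) * norm v)"
        using C[of "[y - x, v]"] mult_right_mono[OF abs_ge_self, of "norm (y - x) * norm v" C] by simp
      moreover have "norm (D 1 y [v] - D 1 x [v]) \<le>
          norm (D 1 y [v] - D 1 x [v] - D 2 x [y - x, v]) + norm (D 2 x [y - x, v])"
        by (metis diff_add_cancel norm_triangle_ineq)
      ultimately have "norm (D 1 y [v] - D 1 x [v]) \<le> (1 + \<bar>C\<bar>) * norm (y - x) * norm v"
        using H[OF y, of v] that by (simp add: dist_norm algebra_simps)
      then show "norm ((DD y - DD x) v) \<le> (1 + \<bar>C\<bar>) * norm (y - x) * norm v"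
        by (simp add: blinfun.diff_left DD x y)
    qed auto
    have "((\<lambda>y. DD y - DD x) \<longlongrightarrow> 0) (at x)"
    proof (rule Lim_null_comparison)
      show "\<forall>\<^sub>F y in at x. norm (DD y - DD x) \<le> (1 + \<bar>C\<bar>) * norm (y - x)"
        unfolding eventually_at using d1 d2 bound
        by (intro exI[of _ "min d1 d2"]) (auto simp: dist_norm)
      show "((\<lambda>y. (1 + \<bar>C\<bar>) * norm (y - x)) \<longlongrightarrow> 0) (at x)"
        by (rule tendsto_eq_intros refl | simp)+
    qed
    then show ?thesis unfolding continuous_at by (simp add: LIM_zero_iff)
  qed
  then show ?thesis using der unfolding C1_on_def
    by (intro exI[of _ DD]) (auto intro!: continuous_at_imp_continuous_on)
qed

section \<open>Tangent norms, differentials and lengths of paths\<close>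

locale riem_mfd =
  fixes A :: "('m::t2_space, 'h::{real_inner, complete_space}) chart set"
    and \<rho> :: "'m \<Rightarrow> ('m, 'h) tangent \<Rightarrow> ('m, 'h) tangent \<Rightarrow> real"
  assumes mfd: "riemannian_manifold A \<rho>"
begin

lemma atlas: "smooth_atlas A" and metric: "riemannian_metric A \<rho>"
  using mfd unfolding riemannian_manifold_def by auto

lemma chart_exists: obtains c where "c \<in> A" "q \<in> fst c"
  using atlas unfolding smooth_atlas_def by blast

lemma
  assumes "c \<in> A"
  shows open_dom: "open (fst c)" and open_range: "open (chart_range c)"
    and chart_homeo: "homeomorphism (fst c) (chart_range c) (snd c) (chart_inv c)"
  using assms atlas unfolding smooth_atlas_def by auto

lemma
  assumes "c \<in> A"
  shows inv_chart: "q \<in> fst c \<Longrightarrow> chart_inv c (snd c q) = q"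
    and chart_inv: "x \<in> chart_range c \<Longrightarrow> snd c (chart_inv c x) = x"
    and chart_mem: "q \<in> fst c \<Longrightarrow> snd c q \<in> chart_range c"
    and inv_mem: "x \<in> chart_range c \<Longrightarrow> chart_inv c x \<in> fst c"
    and cont_chart: "continuous_on (fst c) (snd c)"
    and cont_inv: "continuous_on (chart_range c) (chart_inv c)"
  using chart_homeo[OF assms] unfolding homeomorphism_def by auto

lemma open_chart_image:
  assumes "c \<in> A" "open W" "W \<subseteq> fst c"
  shows "open (snd c ` W)"
  using homeomorphism_imp_open_map[OF chart_homeo[OF assms(1)], of W] assms open_range[OF assms(1)]
  by (metis inf.absorb_iff2 inf_commute openin_open_eq open_dom)

lemma open_inv_image:
  assumes "c \<in> A" "open W" "W \<subseteq> chart_range c"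
  shows "open (chart_inv c ` W)"
  using homeomorphism_imp_open_map[OF homeomorphism_symD[OF chart_homeo[OF assms(1)]], of W] assms
    open_dom[OF assms(1)] open_range[OF assms(1)]
  by (metis inf.absorb_iff2 inf_commute openin_open_eq)

lemma transition_C1:
  assumes "c \<in> A" "d \<in> A"
  shows "C1_on (snd c ` (fst c \<inter> fst d)) (snd d \<circ> chart_inv c)"
proof (rule smooth_on_imp_C1_on)
  show "open (snd c ` (fst c \<inter> fst d))"
    using assms by (intro open_chart_image open_Int open_dom) auto
  show "smooth_on (snd c ` (fst c \<inter> fst d)) (snd d \<circ> chart_inv c)"
    using atlas assms unfolding smooth_atlas_def by blast
qed

lemma transition_C1_at:
  assumes "c \<in> A" "d \<in> A" "q \<in> fst c" "q \<in> fst d"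
  shows "C1_at (snd c q) (snd d \<circ> chart_inv c)"
  unfolding C1_at_def using transition_C1[OF assms(1,2)] assms
    open_chart_image[of c "fst c \<inter> fst d"] open_dom by (metis IntI Int_lower1 image_eqI open_Int)

lemma change_chart_on:
  assumes "c \<in> A" "d \<in> A" "y \<in> snd d ` (fst c \<inter> fst d)"
  shows "(F \<circ> chart_inv c \<circ> (snd c \<circ> chart_inv d)) y = (F \<circ> chart_inv d) y"
  using assms by (auto simp: inv_chart)

lemma open_overlap: "c \<in> A \<Longrightarrow> d \<in> A \<Longrightarrow> open (snd d ` (fst c \<inter> fst d))"
  by (intro open_chart_image open_Int open_dom) auto

text \<open>By the chain rule, the transition to any third chart \<open>e\<close> factors through
  \<open>d\<close>. So a tangent vector does not depend on the chart that names it, and tangent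
  norms can be compared between charts.\<close>

lemma tangent_vector_change:
  assumes c: "c \<in> A" "q \<in> fst c" and d: "d \<in> A" "q \<in> fst d"
  shows "tangent_vector A q d (frechet_derivative (snd d \<circ> chart_inv c) (at (snd c q)) u)
    = tangent_vector A q c u"
proof -
  have "frechet_derivative (snd e \<circ> chart_inv c) (at (snd c q)) u =
     frechet_derivative (snd e \<circ> chart_inv d) (at (snd d q))
       (frechet_derivative (snd d \<circ> chart_inv c) (at (snd c q)) u)" if e: "e \<in> A" "q \<in> fst e" for e
  proof -
    let ?D = "frechet_derivative (snd d \<circ> chart_inv c) (at (snd c q))"
    let ?E = "frechet_derivative (snd e \<circ> chart_inv d) (at (snd d q))"
    have q: "(snd d \<circ> chart_inv c) (snd c q) = snd d q" using inv_chart c by simp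
    have 1: "((snd d \<circ> chart_inv c) has_derivative ?D) (at (snd c q))"
      by (intro C1_at_has_derivative transition_C1_at c d)
    have "((snd e \<circ> chart_inv d) has_derivative ?E) (at (snd d q))"
      by (intro C1_at_has_derivative transition_C1_at e d)
    then have "((snd e \<circ> chart_inv d \<circ> (snd d \<circ> chart_inv c)) has_derivative ?E \<circ> ?D) (at (snd c q))"
      by (intro diff_chain_at[OF 1]) (simp only: q)
    then have "((snd e \<circ> chart_inv c) has_derivative ?E \<circ> ?D) (at (snd c q))"
      by (rule has_derivative_transform_within_open[OF _ open_overlap[OF d(1) c(1)]
            _ change_chart_on[OF d(1) c(1)]]) (use c d in auto)
    from frechet_derivative_at[OF this] show ?thesis by (metis comp_apply)
  qed
  then show ?thesis unfolding tangent_vector_def by auto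
qed

text \<open>One chart derivative of the curve determines all others by the chain rule. Continuity on
  the open set \<open>S\<close> keeps the curve in the domain of \<open>c\<close> near
  \<open>t\<close>, where \<open>chart_inv c\<close> undoes \<open>snd c\<close>.\<close>

lemma velocity_eq:
  assumes c: "c \<in> A" "\<gamma> t \<in> fst c" and S: "open S" "t \<in> S" "continuous_on S \<gamma>"
    and u: "((snd c \<circ> \<gamma>) has_vector_derivative u) (at t)"
  shows "velocity A \<gamma> t = tangent_vector A (\<gamma> t) c u"
proof -
  have "((snd d \<circ> \<gamma>) has_vector_derivative
      frechet_derivative (snd d \<circ> chart_inv c) (at (snd c (\<gamma> t))) u) (at t)"
    if d: "d \<in> A" "\<gamma> t \<in> fst d" for d
  proof -
    let ?D = "frechet_derivative (snd d \<circ> chart_inv c) (at (snd c (\<gamma> t)))"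
    have 1: "((snd d \<circ> chart_inv c) has_derivative ?D) (at ((snd c \<circ> \<gamma>) t))"
      using C1_at_has_derivative[OF transition_C1_at[OF c(1) d(1) c(2) d(2)]] by simp
    have op: "open (S \<inter> \<gamma> -` fst c)" by (intro continuous_open_preimage S open_dom c)
    have "((snd d \<circ> chart_inv c \<circ> (snd c \<circ> \<gamma>)) has_derivative ?D \<circ> (\<lambda>h. h *\<^sub>R u)) (at t)"
      by (intro diff_chain_at[OF u[unfolded has_vector_derivative_def] 1])
    then have "((snd d \<circ> \<gamma>) has_derivative ?D \<circ> (\<lambda>h. h *\<^sub>R u)) (at t)"
      by (rule has_derivative_transform_within_open[OF _ op]) (use c S in \<open>auto simp: inv_chart\<close>)
    moreover have "?D \<circ> (\<lambda>h. h *\<^sub>R u) = (\<lambda>h. h *\<^sub>R ?D u)"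
      using linear_cmul[OF has_derivative_linear[OF 1]] by auto
    ultimately show ?thesis unfolding has_vector_derivative_def by simp
  qed
  then show ?thesis
    unfolding velocity_def tangent_vector_def by (auto intro: vector_derivative_unique_at)
qed

section \<open>Tangent norms and bounded differentials on the manifold\<close>

definition tnorm :: "'m \<Rightarrow> ('m, 'h) chart \<Rightarrow> 'h \<Rightarrow> real" where
  "tnorm q c v = sqrt (\<rho> q (tangent_vector A q c v) (tangent_vector A q c v))"

lemma metric_in_chart:
  assumes "c \<in> A"
  obtains G :: "'h \<Rightarrow> 'h \<Rightarrow>\<^sub>L 'h \<Rightarrow>\<^sub>L real" where
    "continuous_on (chart_range c) G"
    "\<And>x u. x \<in> chart_range c \<Longrightarrow> tnorm (chart_inv c x) c u = sqrt (G x u u)"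
    "\<And>x u v. x \<in> chart_range c \<Longrightarrow> G x u v = G x v u"
    "\<And>x u. x \<in> chart_range c \<Longrightarrow> 0 \<le> G x u u"
    "\<And>x. x \<in> chart_range c \<Longrightarrow> \<exists>a>0. \<exists>b>0. \<forall>u. a * norm u \<le> sqrt (G x u u) \<and> sqrt (G x u u) \<le> b * norm u"
proof -
  obtain G :: "'h \<Rightarrow> 'h \<Rightarrow>\<^sub>L 'h \<Rightarrow>\<^sub>L real" where
    sm: "smooth_on (chart_range c) G" and
    G: "\<forall>x\<in>chart_range c.
           (\<forall>u v. \<rho> (chart_inv c x) (tangent_vector A (chart_inv c x) c u)
                                     (tangent_vector A (chart_inv c x) c v)
                  = blinfun_apply (blinfun_apply (G x) u) v) \<and>
           (\<forall>u v. blinfun_apply (blinfun_apply (G x) u) v = blinfun_apply (blinfun_apply (G x) v) u) \<and>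
           (\<forall>u. u \<noteq> 0 \<longrightarrow> 0 < blinfun_apply (blinfun_apply (G x) u) u) \<and>
           (\<exists>a>0. \<exists>b>0. \<forall>u.
              a * norm u \<le> sqrt (blinfun_apply (blinfun_apply (G x) u) u) \<and>
              sqrt (blinfun_apply (blinfun_apply (G x) u) u) \<le> b * norm u)"
    using metric assms unfolding riemannian_metric_def by meson
  have "0 \<le> G x u u" if "x \<in> chart_range c" for x u
    using G that by (cases "u = 0") (auto simp: less_imp_le)
  moreover have "continuous_on (chart_range c) G"
    by (rule C1_on_continuous[OF smooth_on_imp_C1_on[OF open_range[OF assms] sm]])
  ultimately show ?thesis using G by (intro that[of G]) (auto simp: tnorm_def)
qed

lemma tnorm_nonneg:
  assumes "c \<in> A" "q \<in> fst c"
  shows "0 \<le> tnorm q c v"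
proof -
  obtain G :: "'h \<Rightarrow> 'h \<Rightarrow>\<^sub>L 'h \<Rightarrow>\<^sub>L real" where
    "\<And>x u. x \<in> chart_range c \<Longrightarrow> tnorm (chart_inv c x) c u = sqrt (G x u u)"
    "\<And>x u. x \<in> chart_range c \<Longrightarrow> 0 \<le> G x u u"
    using metric_in_chart[OF assms(1)] by metis
  from this[of "snd c q"] show ?thesis using assms by (simp add: inv_chart chart_mem)
qed

text \<open>The function is C1 near \<open>q\<close>, and its differential at \<open>q\<close> alone
  has dual norm at most \<open>K\<close>. One chart is asked for; \<open>MC1b_chart\<close> passes
  to every other chart around \<open>q\<close>.\<close>

definition MC1b :: "'m \<Rightarrow> real \<Rightarrow> ('m \<Rightarrow> real) \<Rightarrow> bool" where
  "MC1b q K g \<longleftrightarrow> (\<exists>c\<in>A. q \<in> fst c \<and> C1b (snd c q) (tnorm q c) K (g \<circ> chart_inv c))"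

lemma MC1bI: "c \<in> A \<Longrightarrow> q \<in> fst c \<Longrightarrow> C1b (snd c q) (tnorm q c) K (g \<circ> chart_inv c) \<Longrightarrow> MC1b q K g"
  unfolding MC1b_def by blast

text \<open>The differential and the tangent norm are transported by the same linear map, the
  derivative of the transition, so the constant \<open>K\<close> does not change.\<close>

lemma MC1b_chart:
  assumes "MC1b q K g" and d: "d \<in> A" "q \<in> fst d"
  shows "C1b (snd d q) (tnorm q d) K (g \<circ> chart_inv d)"
proof -
  obtain c where c: "c \<in> A" "q \<in> fst c" and C: "C1b (snd c q) (tnorm q c) K (g \<circ> chart_inv c)"
    using assms(1) unfolding MC1b_def by blast
  obtain D where D: "C1_at (snd c q) (g \<circ> chart_inv c)"
    "((g \<circ> chart_inv c) has_derivative D) (at (snd c q))" "\<And>v. \<bar>D v\<bar> \<le> K * tnorm q c v"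
    using C1bE[OF C] by metis
  let ?\<Phi> = "snd c \<circ> chart_inv d"
  let ?T = "frechet_derivative ?\<Phi> (at (snd d q))"
  have q: "?\<Phi> (snd d q) = snd c q" using d by (simp add: inv_chart)
  have T: "C1_at (snd d q) ?\<Phi>" by (intro transition_C1_at c d)
  have qmem: "snd d q \<in> snd d ` (fst c \<inter> fst d)" using c d by auto
  note cong = open_overlap[OF c(1) d(1)] qmem change_chart_on[OF c(1) d(1)]
  show ?thesis
  proof (rule C1bI)
    have "C1_at (snd d q) (g \<circ> chart_inv c \<circ> ?\<Phi>)"
      by (rule C1_at_compose[OF T]) (simp only: q D)
    then show "C1_at (snd d q) (g \<circ> chart_inv d)" by (rule C1_at_cong[OF _ cong])
    have "((g \<circ> chart_inv c \<circ> ?\<Phi>) has_derivative D \<circ> ?T) (at (snd d q))"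
      by (rule diff_chain_at[OF C1_at_has_derivative[OF T]]) (simp only: q D)
    then show "((g \<circ> chart_inv d) has_derivative D \<circ> ?T) (at (snd d q))"
      by (rule has_derivative_transform_within_open[OF _ cong])
    show "\<bar>(D \<circ> ?T) v\<bar> \<le> K * tnorm q d v" for v
      using D(3)[of "?T v"] tangent_vector_change[OF d c, of v] by (simp add: tnorm_def)
  qed
qed

lemma C1_smoothI:
  assumes "\<And>q. \<exists>K. MC1b q K g"
  shows "C1_smooth A g"
  unfolding C1_smooth_def
proof
  fix c assume c: "c \<in> A"
  have "C1_at x (g \<circ> chart_inv c)" if x: "x \<in> chart_range c" for x
  proof -
    obtain K where K: "MC1b (chart_inv c x) K g" using assms by blast
    show ?thesis using MC1b_chart[OF K c inv_mem[OF c x]] unfolding chart_inv[OF c x] C1b_def by blast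
  qed
  then show "C1_on (chart_range c) (g \<circ> chart_inv c)"
    using C1_on_open_iff[OF open_range[OF c]] by blast
qed

text \<open>The fundamental theorem of calculus in a chart, patched together along the path.
  Integrability of the speed \<open>h\<close> is part of the claim because \<open>integral\<close>,
  and with it \<open>path_length\<close>, would default to 0 without it.\<close>

lemma path_piece_bound:
  assumes g: "\<And>q. MC1b q K g" and st: "s \<le> t" and \<gamma>: "C1_path_on A \<gamma> s t"
  defines "h \<equiv> \<lambda>u. sqrt (\<rho> (\<gamma> u) (velocity A \<gamma> u) (velocity A \<gamma> u))"
  shows "h integrable_on {s..t} \<and> \<bar>g (\<gamma> t) - g (\<gamma> s)\<bar> \<le> K * integral {s..t} h"
proof -
  define P where "P = (\<lambda>a b. s \<le> a \<and> b \<le> t \<longrightarrow>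
     h integrable_on {a..b} \<and> \<bar>g (\<gamma> b) - g (\<gamma> a)\<bar> \<le> K * integral {a..b} h)"
  have contg: "continuous_on {s..t} \<gamma>" using \<gamma> unfolding C1_path_on_def by blast
  \<comment> \<open>Bisection: \<open>P\<close> passes to the union of adjacent intervals and holds
    for all short intervals around each point, those being mapped into a single chart. Hence it
    holds on the whole interval.\<close>
  have "P s t"
  proof (rule Bolzano[OF st])
    fix a b c assume ab: "P a b" "P b c" "a \<le> b" "b \<le> c"
    show "P a c" unfolding P_def
    proof (intro impI)
      assume st: "s \<le> a \<and> c \<le> t"
      have 1: "h integrable_on {a..b}" "\<bar>g (\<gamma> b) - g (\<gamma> a)\<bar> \<le> K * integral {a..b} h"
        "h integrable_on {b..c}" "\<bar>g (\<gamma> c) - g (\<gamma> b)\<bar> \<le> K * integral {b..c} h"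
        using ab st unfolding P_def by auto
      have 2: "h integrable_on {a..c}"
        using Henstock_Kurzweil_Integration.integrable_combine[OF ab(3,4) 1(1,3)] .
      have "integral {a..b} h + integral {b..c} h = integral {a..c} h"
        using Henstock_Kurzweil_Integration.integral_combine[OF ab(3,4) 2] .
      then have "K * integral {a..c} h = K * integral {a..b} h + K * integral {b..c} h"
        by (simp add: distrib_left[symmetric])
      then show "h integrable_on {a..c} \<and> \<bar>g (\<gamma> c) - g (\<gamma> a)\<bar> \<le> K * integral {a..c} h"
        using 1 2 by linarith
    qed
  next
    fix x assume x: "s \<le> x" "x \<le> t"
    obtain c where c: "c \<in> A" "\<gamma> x \<in> fst c" using chart_exists .
    obtain D where D: "\<forall>u\<in>{s..t} \<inter> \<gamma> -` fst c. ((snd c \<circ> \<gamma>) has_vector_derivative D u) (at u within {s..t})"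
      "continuous_on ({s..t} \<inter> \<gamma> -` fst c) D"
      using \<gamma> c(1) unfolding C1_path_on_def by blast
    obtain G :: "'h \<Rightarrow> 'h \<Rightarrow>\<^sub>L 'h \<Rightarrow>\<^sub>L real" where G: "continuous_on (chart_range c) G"
      "\<And>x u. x \<in> chart_range c \<Longrightarrow> tnorm (chart_inv c x) c u = sqrt (G x u u)"
      using metric_in_chart[OF c(1)] by metis
    obtain B where B: "open B" "x \<in> B" "\<And>u. u \<in> B \<Longrightarrow> u \<in> {s..t} \<Longrightarrow> \<gamma> u \<in> fst c"
      using contg[unfolded continuous_on_topological] open_dom[OF c(1)] c(2) x by (metis atLeastAtMost_iff)
    obtain d where d: "d > 0" "ball x d \<subseteq> B" using B openE by blast
    have "P a b" if ab: "a \<le> x \<and> x \<le> b \<and> b - a < d" for a b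
      unfolding P_def
    proof (intro impI)
      assume ab': "s \<le> a \<and> b \<le> t"
      have dom: "u \<in> {s..t}" "\<gamma> u \<in> fst c" if "u \<in> {a..b}" for u
      proof -
        show u: "u \<in> {s..t}" using that ab' by auto
        have "u \<in> ball x d" using that ab by (auto simp: dist_real_def)
        then show "\<gamma> u \<in> fst c" using B(3) d u by auto
      qed
      then have sub: "{a..b} \<subseteq> {s..t} \<inter> \<gamma> -` fst c" by auto
      define \<sigma> where "\<sigma> = (\<lambda>u. tnorm (\<gamma> u) c (D u))"
      define F where "F = g \<circ> chart_inv c"
      define y where "y = snd c \<circ> \<gamma>"
      have yr: "y u \<in> chart_range c" "chart_inv c (y u) = \<gamma> u" if "u \<in> {a..b}" for u
        unfolding y_def using dom[OF that] c by (auto simp: chart_mem inv_chart)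
      have conty: "continuous_on {a..b} y" unfolding y_def
        by (rule continuous_on_compose[OF continuous_on_subset[OF contg] continuous_on_subset[OF cont_chart[OF c(1)]]])
           (use dom in auto)
      have contD: "continuous_on {a..b} D" by (rule continuous_on_subset[OF D(2) sub])
      have "continuous_on {a..b} (\<lambda>u. sqrt (blinfun_apply (blinfun_apply (G (y u)) (D u)) (D u)))"
        by (intro continuous_intros contD continuous_on_compose2[OF G(1) conty]) (use yr in auto)
      then have "continuous_on {a..b} \<sigma>"
        by (rule continuous_on_eq) (use G(2)[OF yr(1)] yr(2) in \<open>simp add: \<sigma>_def\<close>)
      then have int\<sigma>: "\<sigma> integrable_on {a..b}" by (rule integrable_continuous_real)
      \<comment> \<open>At an end of the piece the path may be differentiable from one side only,
        and \<open>velocity\<close> is then empty. The integrands are compared on the open interval;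
        two points are negligible.\<close>
      have h\<sigma>: "h u = \<sigma> u" if u: "u \<in> {a<..<b}" for u
      proof -
        have u': "u \<in> {a..b}" "u \<in> {s<..<t}" using u ab' by auto
        have "((snd c \<circ> \<gamma>) has_vector_derivative D u) (at u)"
          using D(1) sub u' by (metis at_within_interior interior_atLeastAtMost_real subsetD)
        then have "velocity A \<gamma> u = tangent_vector A (\<gamma> u) c (D u)"
          using u' dom c by (intro velocity_eq[where S = "{s<..<t}"])
            (auto intro: continuous_on_subset[OF contg])
        then show ?thesis unfolding h_def \<sigma>_def tnorm_def by simp
      qed
      have inth: "h integrable_on {a..b}"
        by (rule integrable_spike[OF int\<sigma>, of "{a,b}"]) (auto intro!: h\<sigma>)
      have eqh: "integral {a..b} h = integral {a..b} \<sigma>"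
        by (rule integral_spike[of "{a,b}"]) (auto intro!: h\<sigma>[symmetric])
      define F' where "F' = (\<lambda>u. frechet_derivative F (at (y u)))"
      have F: "C1b (y u) (tnorm (\<gamma> u) c) K F" if "u \<in> {a..b}" for u
        unfolding y_def F_def using MC1b_chart[OF g c(1) dom(2)[OF that]] by simp
      \<comment> \<open>The gauge integral integrates every derivative, so the integrability of
        \<open>F' u (D u)\<close> comes together with its value.\<close>
      have "((\<lambda>u. F' u (D u)) has_integral F (y b) - F (y a)) {a..b}"
      proof (rule fundamental_theorem_of_calculus)
        show "a \<le> b" using ab by simp
        fix u assume u: "u \<in> {a..b}"
        have 1: "(y has_vector_derivative D u) (at u within {a..b})"
          unfolding y_def using D(1) sub u ab'
          by (intro has_vector_derivative_within_subset[of _ _ _ "{s..t}" "{a..b}"]) auto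
        have "C1_at (y u) F" using F[OF u] unfolding C1b_def by blast
        then have 2: "(F has_derivative F' u) (at (y u))" unfolding F'_def by (rule C1_at_has_derivative)
        then have "(F has_derivative F' u) (at (y u) within y ` {a..b})" by (rule has_derivative_at_withinI)
        from vector_derivative_diff_chain_within[OF 1 this]
        show "((\<lambda>u. F (y u)) has_vector_derivative F' u (D u)) (at u within {a..b})" by (simp add: o_def)
      qed
      moreover have "F (y b) = g (\<gamma> b)" "F (y a) = g (\<gamma> a)"
        using yr[of a] yr[of b] ab unfolding F_def by auto
      ultimately have int: "((\<lambda>u. F' u (D u)) has_integral g (\<gamma> b) - g (\<gamma> a)) {a..b}" by simp
      have "norm (integral {a..b} (\<lambda>u. F' u (D u))) \<le> integral {a..b} (\<lambda>u. K * \<sigma> u)"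
      proof (rule Henstock_Kurzweil_Integration.integral_norm_bound_integral)
        show "(\<lambda>u. F' u (D u)) integrable_on {a..b}" using int by blast
        show "(\<lambda>u. K * \<sigma> u) integrable_on {a..b}" using integrable_on_mult_right[OF int\<sigma>] by simp
        show "norm (F' u (D u)) \<le> K * \<sigma> u" if "u \<in> {a..b}" for u
          using F[OF that] unfolding C1b_def F'_def \<sigma>_def by simp
      qed
      then show "h integrable_on {a..b} \<and> \<bar>g (\<gamma> b) - g (\<gamma> a)\<bar> \<le> K * integral {a..b} h"
        using int inth eqh by (simp add: integral_unique)
    qed
    then show "\<exists>d>0. \<forall>a b. a \<le> x \<and> x \<le> b \<and> b - a < d \<longrightarrow> P a b" using d by blast
  qed
  then show ?thesis unfolding P_def by simp
qed

lemma path_bound: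
  assumes g: "\<And>q. MC1b q K g" and \<gamma>: "piecewise_C1_path_on A \<gamma> a b"
  shows "\<bar>g (\<gamma> b) - g (\<gamma> a)\<bar> \<le> K * path_length A \<rho> \<gamma> a b"
proof -
  define h where "h = (\<lambda>u. sqrt (\<rho> (\<gamma> u) (velocity A \<gamma> u) (velocity A \<gamma> u)))"
  obtain n \<tau> where \<tau>: "\<tau> 0 = a" "\<tau> n = b" "\<And>i. i < n \<Longrightarrow> \<tau> i < \<tau> (Suc i)"
    "\<And>i. i < n \<Longrightarrow> C1_path_on A \<gamma> (\<tau> i) (\<tau> (Suc i))"
    using \<gamma> unfolding piecewise_C1_path_on_def by blast
  have "a \<le> \<tau> k \<and> h integrable_on {a..\<tau> k} \<and> \<bar>g (\<gamma> (\<tau> k)) - g (\<gamma> a)\<bar> \<le> K * integral {a..\<tau> k} h"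
    if "k \<le> n" for k
    using that
  proof (induction k)
    case 0
    then show ?case using \<tau>(1) integrable_on_refl[of h a] by simp
  next
    case (Suc k)
    let ?p = "\<tau> k" and ?q = "\<tau> (Suc k)"
    have le: "a \<le> ?p" "?p \<le> ?q" using Suc \<tau>(3)[of k] by auto
    have 1: "h integrable_on {a..?p}" "\<bar>g (\<gamma> ?p) - g (\<gamma> a)\<bar> \<le> K * integral {a..?p} h"
      using Suc by auto
    have 3: "h integrable_on {?p..?q}" "\<bar>g (\<gamma> ?q) - g (\<gamma> ?p)\<bar> \<le> K * integral {?p..?q} h"
      using path_piece_bound[OF g le(2) \<tau>(4)[of k]] Suc(2) unfolding h_def by auto
    have 2: "h integrable_on {a..?q}"
      using Henstock_Kurzweil_Integration.integrable_combine[OF le 1(1) 3(1)] .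
    have "integral {a..?p} h + integral {?p..?q} h = integral {a..?q} h"
      using Henstock_Kurzweil_Integration.integral_combine[OF le 2] .
    then have "K * integral {a..?q} h = K * integral {a..?p} h + K * integral {?p..?q} h"
      by (simp add: distrib_left[symmetric])
    then show ?case using 1 2 3 le by linarith
  qed
  from this[of n] show ?thesis unfolding \<tau>(2) path_length_def h_def by simp
qed

text \<open>Division by \<open>K\<close> turns the estimate along paths into a lower bound for every
  length and so for their infimum. Finiteness of the distance then permits the return from
  \<open>ennreal\<close> to the reals.\<close>

lemma lip_boundI:
  assumes g: "\<And>q. MC1b q K g" and K: "0 < K"
  shows "lip_bound A \<rho> g K"
  unfolding lip_bound_def
proof (intro conjI allI impI)
  fix p q assume fin: "riem_dist A \<rho> p q < \<infinity>"
  have "ennreal (\<bar>g p - g q\<bar> / K) \<le> riem_dist A \<rho> p q"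
    unfolding riem_dist_def
  proof (rule Inf_greatest)
    fix z assume "z \<in> {ennreal (path_length A \<rho> \<gamma> a b) | \<gamma> a b.
            a < b \<and> piecewise_C1_path_on A \<gamma> a b \<and> \<gamma> a = p \<and> \<gamma> b = q}"
    then obtain \<gamma> a b where z: "z = ennreal (path_length A \<rho> \<gamma> a b)"
      "piecewise_C1_path_on A \<gamma> a b" "\<gamma> a = p" "\<gamma> b = q" by blast
    have "\<bar>g p - g q\<bar> / K \<le> path_length A \<rho> \<gamma> a b"
      using path_bound[OF g z(2)] z K by (simp add: pos_divide_le_eq abs_minus_commute mult.commute)
    then show "ennreal (\<bar>g p - g q\<bar> / K) \<le> z" unfolding z(1) by (rule ennreal_leI)
  qed
  then have "\<bar>g p - g q\<bar> / K \<le> enn2real (riem_dist A \<rho> p q)"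
    using fin K by (metis enn2real_ennreal enn2real_mono abs_ge_zero divide_nonneg_pos infinity_ennreal_def)
  then show "\<bar>g p - g q\<bar> \<le> K * enn2real (riem_dist A \<rho> p q)"
    using K by (simp add: pos_divide_le_eq mult.commute)
qed (use K in simp)

end

section \<open>Hilbert norms and bump functions\<close>

lemma DERIV_pos_part_square:
  "((\<lambda>t. (max 0 t)\<^sup>2) has_real_derivative 2 * max 0 t) (at (t::real))"
proof -
  consider "t < 0" | "t > 0" | "t = 0" by linarith
  then show ?thesis
  proof cases
    case 1
    have "((\<lambda>t. 0) has_real_derivative 0) (at t)" by simp
    then have "((\<lambda>t. (max 0 t)\<^sup>2) has_real_derivative 0) (at t)"
      by (rule has_field_derivative_transform_within_open[of _ _ _ "{..<0}"]) (use 1 in auto)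
    then show ?thesis using 1 by simp
  next
    case 2
    have "((\<lambda>t. t\<^sup>2) has_real_derivative 2 * t) (at t)" by (auto intro!: derivative_eq_intros)
    then have "((\<lambda>t. (max 0 t)\<^sup>2) has_real_derivative 2 * t) (at t)"
      by (rule has_field_derivative_transform_within_open[of _ _ _ "{0<..}"]) (use 2 in auto)
    then show ?thesis using 2 by simp
  next
    case 3
    have "(\<lambda>h. ((max 0 (0 + h))\<^sup>2 - (max 0 0)\<^sup>2) / h) \<midarrow>0\<rightarrow> (0::real)"
    proof (rule Lim_null_comparison[OF always_eventually tendsto_rabs_zero[OF tendsto_ident_at]], rule allI)
      show "norm (((max 0 (0 + h))\<^sup>2 - (max 0 0)\<^sup>2) / h) \<le> \<bar>h\<bar>" for h :: real
        by (auto simp: max_def power2_eq_square)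
    qed
    then show ?thesis unfolding 3 DERIV_def by simp
  qed
qed

text \<open>A step from 0 on \<open>t \<le> 0\<close> to 1 on \<open>t \<ge> 1\<close>. Squaring
  makes both positive parts continuously differentiable where they vanish; the two squares
  contribute the bound 4 = 2 * 2 on the slope.\<close>

definition cutoff :: "real \<Rightarrow> real" where
  "cutoff t = 1 - (max 0 (1 - (max 0 t)\<^sup>2))\<^sup>2"

definition cutoff' :: "real \<Rightarrow> real" where
  "cutoff' t = 4 * max 0 (1 - (max 0 t)\<^sup>2) * max 0 t"

lemma DERIV_cutoff: "(cutoff has_real_derivative cutoff' t) (at t)"
proof -
  have "((\<lambda>t. 1 - (max 0 t)\<^sup>2) has_real_derivative 0 - 2 * max 0 t) (at t)"
    by (intro DERIV_diff DERIV_const DERIV_pos_part_square)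
  from DERIV_chain2[OF DERIV_pos_part_square this]
  have "((\<lambda>t. 1 - (max 0 (1 - (max 0 t)\<^sup>2))\<^sup>2) has_real_derivative
     0 - 2 * max 0 (1 - (max 0 t)\<^sup>2) * (0 - 2 * max 0 t)) (at t)"
    by (intro DERIV_diff DERIV_const)
  then show ?thesis unfolding cutoff_def[abs_def] cutoff'_def by (simp add: mult_ac)
qed

lemma continuous_cutoff': "continuous_on UNIV cutoff'"
  unfolding cutoff'_def by (intro continuous_intros)

lemma cutoff'_bound: "\<bar>cutoff' t\<bar> \<le> 4"
proof (cases "t \<le> 1")
  case True
  have "max 0 (1 - (max 0 t)\<^sup>2) * max 0 t \<le> 1 * 1"
    using True by (intro mult_mono) auto
  then show ?thesis unfolding cutoff'_def by (simp add: abs_mult mult.assoc)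
next
  case False
  then have "1 \<le> t\<^sup>2" by (simp add: one_le_power)
  then have "max 0 (1 - (max 0 t)\<^sup>2) = 0" using False by (simp add: max_absorb1 max_absorb2)
  then show ?thesis unfolding cutoff'_def by simp
qed

lemma cutoff_range: "0 \<le> cutoff t" "cutoff t \<le> 1"
proof -
  have "(max 0 (1 - (max 0 t)\<^sup>2))\<^sup>2 \<le> 1" by (intro power_le_one) auto
  then show "0 \<le> cutoff t" "cutoff t \<le> 1" unfolding cutoff_def by auto
qed

lemma cutoff_zero: "t \<le> 0 \<Longrightarrow> cutoff t = 0"
  unfolding cutoff_def by (simp add: max_def)

lemma cutoff_one:
  assumes "1 \<le> t" shows "cutoff t = 1"
proof -
  have "1 \<le> t\<^sup>2" using assms by (simp add: one_le_power)
  then have "max 0 t = t" "max 0 (1 - t\<^sup>2) = 0" using assms by (simp_all add: max_absorb1)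
  then show ?thesis unfolding cutoff_def by simp
qed

text \<open>A substitute for \<open>1 / t\<close>: the correction of the denominator vanishes for \<open>t \<ge> 1\<close> and
  keeps it away from 0 for all \<open>t\<close>.\<close>

definition recip :: "real \<Rightarrow> real" where
  "recip t = 1 / (t + (max 0 (1 - t))\<^sup>2)"

definition recip' :: "real \<Rightarrow> real" where
  "recip' t = - (1 - 2 * max 0 (1 - t)) / (t + (max 0 (1 - t))\<^sup>2)\<^sup>2"

lemma recip_denom: "3 / 4 \<le> t + (max 0 (1 - t))\<^sup>2" for t :: real
proof (cases "t \<le> 1")
  case True
  \<comment> \<open>For \<open>t \<le> 1\<close> the denominator equals t^2 - t + 1 = (t - 1/2)^2 +
    3/4.\<close>
  have "0 \<le> (t - 1 / 2)\<^sup>2" by simp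
  then show ?thesis using True by (simp add: max_def power2_eq_square algebra_simps)
qed simp

lemma DERIV_recip: "(recip has_real_derivative recip' t) (at t)"
proof -
  have "((\<lambda>t. 1 - t) has_real_derivative 0 - 1) (at t)"
    by (intro DERIV_diff DERIV_const DERIV_ident)
  from DERIV_chain2[OF DERIV_pos_part_square this]
  have "((\<lambda>t. t + (max 0 (1 - t))\<^sup>2) has_real_derivative 1 + 2 * max 0 (1 - t) * (0 - 1)) (at t)"
    by (intro DERIV_add DERIV_ident)
  from DERIV_divide[OF DERIV_const[of 1] this] recip_denom[of t]
  show ?thesis unfolding recip_def[abs_def] recip'_def
    by (simp add: power2_eq_square)
qed

lemma recip_nz: "t + (max 0 (1 - t))\<^sup>2 \<noteq> (0::real)"
  using recip_denom[of t] by linarith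

lemma continuous_recip': "continuous_on UNIV recip'"
  unfolding recip'_def by (intro continuous_intros) (simp add: recip_nz)

text \<open>The numerator lies between -1 and 1, and the squared denominator is at least 9/16. The
  arguments to come are sums of bumps, hence nonnegative.\<close>

lemma recip'_bound: "0 \<le> t \<Longrightarrow> \<bar>recip' t\<bar> \<le> 2"
proof -
  assume t: "0 \<le> t"
  have "(3/4)\<^sup>2 \<le> (t + (max 0 (1 - t))\<^sup>2)\<^sup>2" by (intro power_mono recip_denom) simp
  then have "1 \<le> 2 * (t + (max 0 (1 - t))\<^sup>2)\<^sup>2" by (simp add: power2_eq_square)
  moreover have "\<bar>1 - 2 * max 0 (1 - t)\<bar> \<le> 1" using t by (simp add: max_def abs_le_iff)
  ultimately have "\<bar>1 - 2 * max 0 (1 - t)\<bar> \<le> 2 * (t + (max 0 (1 - t))\<^sup>2)\<^sup>2" by linarith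
  moreover have "0 < (t + (max 0 (1 - t))\<^sup>2)\<^sup>2" using recip_nz[of t] by simp
  ultimately show ?thesis unfolding recip'_def by (simp add: abs_divide pos_divide_le_eq)
qed

lemma recip_range: "0 \<le> recip t" "recip t \<le> 2"
proof -
  define s where "s = t + (max 0 (1 - t))\<^sup>2"
  have "3 / 4 \<le> s" unfolding s_def by (rule recip_denom)
  then show "0 \<le> recip t" "recip t \<le> 2" unfolding recip_def s_def[symmetric]
    by (simp_all add: divide_le_eq)
qed

lemma recip_mult_le: "0 \<le> t \<Longrightarrow> t * recip t \<le> 1"
  unfolding recip_def using recip_denom[of t] by (simp add: divide_le_eq)

lemma recip_mult_eq: "1 \<le> t \<Longrightarrow> t * recip t = 1"
  unfolding recip_def by simp

text \<open>Meant for the Riemannian norm frozen at one point of a chart, which differs from the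
  norm of the type. The parallelogram law stands in for an inner product; \<open>a\<close> and
  \<open>b\<close> record the comparison with the norm of the type.\<close>

locale hilbert_norm =
  fixes N :: "'a::real_normed_vector \<Rightarrow> real" and a b :: real
  assumes par: "\<And>u v. (N (u + v))\<^sup>2 + (N (u - v))\<^sup>2 = 2 * (N u)\<^sup>2 + 2 * (N v)\<^sup>2"
    and nonneg: "\<And>v. 0 \<le> N v"
    and tri: "\<And>u v. N (u + v) \<le> N u + N v"
    and hom: "\<And>t v. N (t *\<^sub>R v) = \<bar>t\<bar> * N v"
    and a: "0 < a" and lower: "\<And>v. a * norm v \<le> N v"
    and upper: "\<And>v. N v \<le> b * norm v"
begin

lemma N_zero: "N 0 = 0" using hom[of 0 0] by simp

lemma N_minus: "N (x - y) = N (y - x)" using hom[of "-1" "x - y"] by simp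

lemma N_tri: "N (x - z) \<le> N (x - y) + N (y - z)" using tri[of "x - y" "y - z"] by simp

text \<open>Difference quotients along a line are at most \<open>L * N v\<close>. The bound is in
  \<open>N\<close> itself, so no factor from the comparison of norms is lost.\<close>

lemma derivative_bound:
  assumes g: "\<And>x y. \<bar>g x - g y\<bar> \<le> L * N (x - y)" and D: "(g has_derivative D) (at x)"
  shows "\<bar>D v\<bar> \<le> L * N v"
proof -
  have 1: "((\<lambda>t. x + t *\<^sub>R v) has_derivative (\<lambda>t. t *\<^sub>R v)) (at 0)"
    by (auto intro!: derivative_eq_intros)
  have "(g has_derivative D) (at (x + 0 *\<^sub>R v))" using D by simp
  from has_derivative_compose[OF 1 this]
  have "((\<lambda>t. g (x + t *\<^sub>R v)) has_derivative (\<lambda>t. D (t *\<^sub>R v))) (at 0)" .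
  moreover have "(\<lambda>t. D (t *\<^sub>R v)) = (*) (D v)"
    using linear_cmul[OF has_derivative_linear[OF D]] by (auto simp: mult.commute)
  ultimately have "((\<lambda>t. g (x + t *\<^sub>R v)) has_real_derivative D v) (at 0)"
    unfolding has_field_derivative_def by simp
  then have "(\<lambda>h. (g (x + h *\<^sub>R v) - g x) / h) \<midarrow>0\<rightarrow> D v" unfolding DERIV_def by simp
  then have lim: "(\<lambda>h. \<bar>(g (x + h *\<^sub>R v) - g x) / h\<bar>) \<midarrow>0\<rightarrow> \<bar>D v\<bar>" by (rule tendsto_rabs)
  show ?thesis
  proof (rule tendsto_upperbound[OF lim])
    have "\<bar>(g (x + h *\<^sub>R v) - g x) / h\<bar> \<le> L * N v" if "h \<noteq> 0" for h
      using g[of "x + h *\<^sub>R v" x] that by (simp add: hom abs_divide pos_divide_le_eq mult_ac)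
    then show "\<forall>\<^sub>F h in at 0. \<bar>(g (x + h *\<^sub>R v) - g x) / h\<bar> \<le> L * N v"
      by (auto simp: eventually_at_filter)
  qed simp
qed

text \<open>The McShane formula, giving the largest extension with the same constant. It is wanted
  because the convolutions range over the whole space, while a function read in a chart is
  controlled on a ball.\<close>

lemma mcshane_extension:
  assumes S: "S \<noteq> {}" and L: "0 \<le> L" and F: "\<And>x y. x \<in> S \<Longrightarrow> y \<in> S \<Longrightarrow> F x - F y \<le> L * N (x - y)"
  shows "\<exists>F'. (\<forall>x\<in>S. F' x = F x) \<and> (\<forall>x y. F' x - F' y \<le> L * N (x - y))"
proof -
  define F' where "F' = (\<lambda>x. INF y\<in>S. F y + L * N (x - y))"
  obtain s where s: "s \<in> S" using S by blast
  have bdd: "bdd_below ((\<lambda>y. F y + L * N (x - y)) ` S)" for x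
  proof (rule bdd_belowI2)
    fix y assume y: "y \<in> S"
    show "F s - L * N (s - x) \<le> F y + L * N (x - y)"
      using F[OF s y] mult_left_mono[OF N_tri[of s y x] L] by (simp add: distrib_left)
  qed
  have low: "F' x \<le> F y + L * N (x - y)" if "y \<in> S" for x y
    unfolding F'_def by (rule cINF_lower[OF bdd that])
  have ge: "c \<le> F' x" if "\<And>y. y \<in> S \<Longrightarrow> c \<le> F y + L * N (x - y)" for c x
    unfolding F'_def by (rule cINF_greatest[OF S that])
  have "F' x = F x" if x: "x \<in> S" for x
  proof (rule antisym)
    show "F' x \<le> F x" using low[OF x, of x] by (simp add: N_zero)
    show "F x \<le> F' x" by (rule ge) (use F[OF x] in \<open>simp add: algebra_simps\<close>)
  qed
  moreover have "F' x - F' y \<le> L * N (x - y)" for x y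
  proof -
    have "F' x - L * N (x - y) \<le> F' y"
    proof (rule ge)
      fix z assume "z \<in> S"
      then show "F' x - L * N (x - y) \<le> F z + L * N (y - z)"
        using low[of z x] mult_left_mono[OF N_tri[of x z y] L] by (simp add: distrib_left)
    qed
    then show ?thesis by simp
  qed
  ultimately show ?thesis by blast
qed

lemma C1_approximation:
  assumes S: "S \<noteq> {}" and L: "0 \<le> L" and F: "\<And>x y. x \<in> S \<Longrightarrow> y \<in> S \<Longrightarrow> F x - F y \<le> L * N (x - y)"
    and \<delta>: "0 < \<delta>"
  shows "\<exists>g. (\<forall>x. C1b x N L g) \<and> (\<forall>x\<in>S. \<bar>g x - F x\<bar> \<le> \<delta>)"
proof -
  obtain F' where F': "\<And>x. x \<in> S \<Longrightarrow> F' x = F x" "\<And>x y. F' x - F' y \<le> L * N (x - y)"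
    using mcshane_extension[OF S L F] by blast
  obtain g where g: "C1_on UNIV g" "\<And>x. \<bar>g x - F' x\<bar> \<le> \<delta>" "\<And>x y. \<bar>g x - g y\<bar> \<le> L * N (x - y)"
    using lasry_lions[of N b L F' \<delta>, OF par nonneg upper L F'(2) \<delta>] by blast
  have "C1b x N L g" for x
  proof -
    have "C1_at x g" using g(1) unfolding C1_at_def by blast
    then show ?thesis using derivative_bound[OF g(3) C1_at_has_derivative] unfolding C1b_def by blast
  qed
  then show ?thesis using g(2) F'(1) by metis
qed

text \<open>A smoothed distance to the complement of \<open>W\<close>. The constant 12 is the slope
  4 of \<open>cutoff\<close> times the 3 from the tolerance \<open>1 / (3 * m)\<close>; it depends
  neither on \<open>W\<close> nor on the norm. A ball of radius \<open>1 / (a * m)\<close> around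
  \<open>x\<close> inside \<open>W\<close> puts the complement at \<open>N\<close>-distance at least
  \<open>1 / m\<close>.\<close>

lemma C1_bump:
  assumes m: "1 \<le> m"
  shows "\<exists>\<beta>. (\<forall>x. C1b x N (12 * m) \<beta> \<and> 0 \<le> \<beta> x \<and> \<beta> x \<le> 1 \<and> (\<beta> x \<noteq> 0 \<longrightarrow> x \<in> W)
     \<and> (ball x (1 / (a * m)) \<subseteq> W \<longrightarrow> \<beta> x = 1))"
proof -
  \<comment> \<open>The element 1 truncates the distance and covers the case that \<open>W\<close>
    is the whole space.\<close>
  define d where "d = (\<lambda>x. Inf (insert 1 ((\<lambda>y. N (x - y)) ` (- W))))"
  have bdd: "bdd_below (insert 1 ((\<lambda>y. N (x - y)) ` (- W)))" for x
    by (rule bdd_belowI[of _ 0]) (use nonneg in auto)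
  have d1: "d x \<le> 1" for x unfolding d_def by (rule cInf_lower[OF _ bdd]) simp
  have dN: "d x \<le> N (x - y)" if "y \<notin> W" for x y
    unfolding d_def by (rule cInf_lower[OF _ bdd]) (use that in simp)
  have d_ge: "c \<le> d x" if "c \<le> 1" "\<And>y. y \<notin> W \<Longrightarrow> c \<le> N (x - y)" for c x
    unfolding d_def by (rule cInf_greatest) (use that in auto)
  have "d x - N (x - y) \<le> d y" for x y
  proof (rule d_ge)
    show "d x - N (x - y) \<le> 1" using d1[of x] nonneg[of "x - y"] by linarith
    show "d x - N (x - y) \<le> N (y - z)" if "z \<notin> W" for z using dN[OF that, of x] N_tri[of x z y] by linarith
  qed
  then have "d x - d y \<le> 1 * N (x - y)" for x y by (smt (verit))
  then obtain e where e: "\<And>x. C1b x N 1 e" "\<And>x. \<bar>e x - d x\<bar> \<le> 1 / (3 * m)"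
    using C1_approximation[of UNIV 1 d "1 / (3 * m)"] m by auto
  \<comment> \<open>Outside \<open>W\<close> the smoothed \<open>e\<close> is at most
    \<open>1 / (3 * m)\<close>, so the argument is at most 0; where \<open>d\<close> is at least
    \<open>1 / m\<close>, \<open>e\<close> is at least \<open>2 / (3 * m)\<close> and the argument
    is at least 1.\<close>
  define \<beta> where "\<beta> = (\<lambda>x. cutoff (3 * m * e x + (- 1)))"
  have "C1b x N (4 * (3 * m)) \<beta>" for x
    unfolding \<beta>_def
  proof (rule C1b_compose[OF _ DERIV_cutoff continuous_cutoff' cutoff'_bound])
    have "C1b x N (\<bar>3 * m\<bar> * 1 + \<bar>e x\<bar> * 0 + 0) (\<lambda>y. 3 * m * e y + (- 1))"
      by (rule C1b_add[OF C1b_mult[OF C1b_const e(1) order_refl order_refl] C1b_const])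
    then show "C1b x N (3 * m) (\<lambda>y. 3 * m * e y + (- 1))" using m by simp
  qed
  moreover have "x \<in> W" if "\<beta> x \<noteq> 0" for x
  proof (rule ccontr)
    assume "x \<notin> W"
    then have "d x \<le> 0" using dN[of x x] N_zero by simp
    then have "e x \<le> 1 / (3 * m)" using e(2)[of x] by linarith
    then have "3 * m * e x \<le> 1" using m by (simp add: pos_le_divide_eq mult.commute)
    then show False using that cutoff_zero unfolding \<beta>_def by simp
  qed
  moreover have "\<beta> x = 1" if ball: "ball x (1 / (a * m)) \<subseteq> W" for x
  proof -
    have "1 / m \<le> d x"
    proof (rule d_ge)
      show "1 / m \<le> 1" using m by simp
      fix y assume "y \<notin> W"
      then have "1 / (a * m) \<le> norm (x - y)" using ball by (force simp: dist_norm)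
      then have "1 / m \<le> a * norm (x - y)" using a m by (simp add: field_simps)
      then show "1 / m \<le> N (x - y)" using lower[of "x - y"] by linarith
    qed
    then have "1 / m - 1 / (3 * m) \<le> e x" using e(2)[of x] by linarith
    then have "2 \<le> 3 * m * e x" using m by (simp add: field_simps)
    then show ?thesis unfolding \<beta>_def by (intro cutoff_one) simp
  qed
  moreover have "0 \<le> \<beta> x" "\<beta> x \<le> 1" for x unfolding \<beta>_def using cutoff_range by auto
  ultimately show ?thesis by (intro exI[of _ \<beta>]) simp
qed

end

lemma C1b_change_gauge:
  assumes "C1b x N K F" "\<And>v. N v \<le> k * n v" "0 \<le> K"
  shows "C1b x n (K * k) F"
  using assms unfolding C1b_def by (metis mult.assoc mult_left_mono order_trans)

text \<open>\<open>G\<close> is the value of a metric at a point and not the inner product of a type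
  class, so Cauchy-Schwarz is derived directly: expand \<open>G\<close> on
  \<open>u - t *\<^sub>R v\<close> at the minimizing \<open>t = G u v / G v v\<close>.\<close>

lemma hilbert_norm_bilinear:
  fixes G :: "'a::real_normed_vector \<Rightarrow>\<^sub>L 'a \<Rightarrow>\<^sub>L real"
  assumes sym: "\<And>u v. G u v = G v u" and pos: "\<And>u. 0 \<le> G u u"
    and a: "0 < a" "\<And>u. a * norm u \<le> sqrt (G u u)" and b: "\<And>u. sqrt (G u u) \<le> b * norm u"
  shows "hilbert_norm (\<lambda>v. sqrt (G v v)) a b"
proof
  note bil = blinfun.add_left blinfun.add_right blinfun.diff_left blinfun.diff_right
     blinfun.scaleR_left blinfun.scaleR_right
  show "(sqrt (G (u + v) (u + v)))\<^sup>2 + (sqrt (G (u - v) (u - v)))\<^sup>2 =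
      2 * (sqrt (G u u))\<^sup>2 + 2 * (sqrt (G v v))\<^sup>2" for u v
    by (simp only: real_sqrt_pow2[OF pos]) (simp add: bil)
  show "sqrt (G (t *\<^sub>R v) (t *\<^sub>R v)) = \<bar>t\<bar> * sqrt (G v v)" for t v
    by (simp add: bil real_sqrt_mult mult.assoc[symmetric])
  show "sqrt (G (u + v) (u + v)) \<le> sqrt (G u u) + sqrt (G v v)" for u v
  proof (cases "v = 0")
    case False
    then have "0 < a * norm v" using a(1) by simp
    then have "0 < sqrt (G v v)" using a(2)[of v] by linarith
    then have v: "0 < G v v" by simp
    define t where "t = G u v / G v v"
    have tv: "t * G v v = G u v" unfolding t_def using v by simp
    have "0 \<le> G (u - t *\<^sub>R v) (u - t *\<^sub>R v)" by (rule pos)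
    also have "\<dots> = G u u - 2 * t * G u v + t * (t * G v v)" by (simp add: bil sym[of v u] algebra_simps)
    also have "\<dots> = G u u - t * G u v" unfolding tv by simp
    finally have "t * G u v \<le> G u u" by simp
    then have "(G u v)\<^sup>2 \<le> G u u * G v v"
      unfolding t_def using v by (simp add: pos_divide_le_eq power2_eq_square)
    then have "sqrt ((G u v)\<^sup>2) \<le> sqrt (G u u * G v v)" by (rule real_sqrt_le_mono)
    then have cs: "G u v \<le> sqrt (G u u) * sqrt (G v v)" by (simp add: real_sqrt_mult)
    show ?thesis
    proof (rule real_le_lsqrt)
      show "G (u + v) (u + v) \<le> (sqrt (G u u) + sqrt (G v v))\<^sup>2"
        using cs by (simp add: power2_sum real_sqrt_pow2[OF pos] bil sym[of v u] pos)
    qed (use pos in auto)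
  qed simp
qed (use a b pos in auto)

section \<open>Local approximations and bump functions on the manifold\<close>

lemma paracompact_refine:
  fixes \<U> :: "'m::t2_space set set"
  assumes "paracompact_space TYPE('m)" "\<And>U. U \<in> \<U> \<Longrightarrow> open U" "\<Union>\<U> = UNIV"
  obtains \<V> where "\<And>V. V \<in> \<V> \<Longrightarrow> open V" "\<Union>\<V> = UNIV" "\<And>V. V \<in> \<V> \<Longrightarrow> \<exists>U\<in>\<U>. V \<subseteq> U"
    "locally_finite_in euclidean \<V>"
proof -
  have "(\<forall>U\<in>\<U>. open U) \<and> \<Union>\<U> = UNIV" using assms(2,3) by blast
  then have "\<exists>\<V>. (\<forall>V\<in>\<V>. open V) \<and> \<Union>\<V> = UNIV \<and> (\<forall>V\<in>\<V>. \<exists>U\<in>\<U>. V \<subseteq> U) \<and>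
             locally_finite_in euclidean \<V>"
    by (rule spec[OF assms(1)[unfolded paracompact_space_def], of \<U>, THEN mp])
  then show ?thesis using that by metis
qed

text \<open>Refine the cover by \<open>U\<close> and all open sets whose closure misses
  \<open>p\<close>. Members not inside \<open>U\<close> have closures missing \<open>p\<close>, and
  by local finiteness so does the closure of their union; its complement is the neighbourhood
  sought.\<close>

lemma paracompact_regular:
  fixes U :: "'m::t2_space set"
  assumes para: "paracompact_space TYPE('m)" and U: "open U" "p \<in> U"
  obtains U' where "open U'" "p \<in> U'" "closure U' \<subseteq> U"
proof -
  define \<U> where "\<U> = insert U {W. open W \<and> p \<notin> closure W}"
  have "\<exists>W. open W \<and> q \<in> W \<and> p \<notin> closure W" if "q \<noteq> p" for q
  proof -
    obtain W W' where "open W" "open W'" "q \<in> W" "p \<in> W'" "W \<inter> W' = {}"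
      using hausdorff[OF \<open>q \<noteq> p\<close>] by blast
    then show ?thesis using open_Int_closure_eq_empty[of W' W] by (metis IntI Int_commute empty_iff)
  qed
  then have "q \<in> \<Union>\<U>" for q using U(2) unfolding \<U>_def by (cases "q = p") auto
  then have cover: "\<Union>\<U> = UNIV" by blast
  have "\<And>W. W \<in> \<U> \<Longrightarrow> open W" unfolding \<U>_def using U(1) by auto
  then obtain \<V> where \<V>: "\<And>V. V \<in> \<V> \<Longrightarrow> open V" "\<Union>\<V> = UNIV" "\<And>V. V \<in> \<V> \<Longrightarrow> \<exists>W\<in>\<U>. V \<subseteq> W"
    "locally_finite_in euclidean \<V>"
    using paracompact_refine[OF para _ cover] by metis
  define T where "T = \<Union>{V \<in> \<V>. \<not> V \<subseteq> U}"
  have "locally_finite_in euclidean {V \<in> \<V>. \<not> V \<subseteq> U}"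
    by (rule locally_finite_in_subset[OF \<V>(4)]) auto
  then have clT: "closure T = \<Union>(closure ` {V \<in> \<V>. \<not> V \<subseteq> U})"
    using closure_of_locally_finite_Union[of euclidean "{V \<in> \<V>. \<not> V \<subseteq> U}"] unfolding T_def by simp
  have "p \<notin> closure V" if V: "V \<in> \<V>" "\<not> V \<subseteq> U" for V
  proof -
    obtain W where "W \<in> \<U>" "V \<subseteq> W" using \<V>(3) V(1) by blast
    then have "p \<notin> closure W" using V(2) unfolding \<U>_def by auto
    then show ?thesis using closure_mono[OF \<open>V \<subseteq> W\<close>] by blast
  qed
  then have p: "p \<in> - closure T" unfolding clT by auto
  have "open T" unfolding T_def using \<V>(1) by auto
  have "closure (- closure T) \<subseteq> - T"
    by (rule closure_minimal) (use \<open>open T\<close> closure_subset in auto)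
  also have "- T \<subseteq> U" using \<V>(2) unfolding T_def by fastforce
  finally show ?thesis using that[of "- closure T"] p by auto
qed

text \<open>Neighbourhoods are shrunk before refining, so that closures of members stay in the
  original sets. Closures matter because local approximations are also needed at boundary points of
  a member.\<close>

lemma paracompact_cover:
  fixes U :: "'m::t2_space \<Rightarrow> 'm set"
  assumes para: "paracompact_space TYPE('m)" and U: "\<And>p. open (U p)" "\<And>p. p \<in> U p"
  shows "\<exists>\<V>. (\<forall>V\<in>\<V>. open V) \<and> \<Union>\<V> = UNIV \<and> (\<forall>V\<in>\<V>. \<exists>p. closure V \<subseteq> U p) \<and>
    (\<forall>q. \<exists>W. open W \<and> q \<in> W \<and> finite {V \<in> \<V>. V \<inter> W \<noteq> {}})"
proof -
  have "\<exists>U'. open U' \<and> p \<in> U' \<and> closure U' \<subseteq> U p" for p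
    using paracompact_regular[OF para U] by blast
  then obtain U' where U': "\<And>p. open (U' p)" "\<And>p. p \<in> U' p" "\<And>p. closure (U' p) \<subseteq> U p"
    by metis
  have op: "\<And>W. W \<in> range U' \<Longrightarrow> open W" and cov: "\<Union>(range U') = UNIV" using U' by auto
  obtain \<V> where \<V>: "\<And>V. V \<in> \<V> \<Longrightarrow> open V" "\<Union>\<V> = UNIV" "\<And>V. V \<in> \<V> \<Longrightarrow> \<exists>W\<in>range U'. V \<subseteq> W"
    "locally_finite_in euclidean \<V>"
    using paracompact_refine[OF para op cov] by metis
  show ?thesis
  proof (intro exI[of _ \<V>] conjI ballI allI \<V>(1,2))
    show "\<exists>p. closure V \<subseteq> U p" if "V \<in> \<V>" for V
      using \<V>(3)[OF that] closure_mono U'(3) by blast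
    show "\<exists>W. open W \<and> q \<in> W \<and> finite {V \<in> \<V>. V \<inter> W \<noteq> {}}" for q
      using \<V>(4) unfolding locally_finite_in_def by auto
  qed
qed

context riem_mfd
begin

lemma MC1b_cong:
  assumes "MC1b q K g" "open T" "q \<in> T" "\<And>p. p \<in> T \<Longrightarrow> g p = g' p"
  shows "MC1b q K g'"
proof -
  obtain c where c: "c \<in> A" "q \<in> fst c" and C: "C1b (snd c q) (tnorm q c) K (g \<circ> chart_inv c)"
    using assms(1) unfolding MC1b_def by blast
  have "open (snd c ` (fst c \<inter> T))" using c assms by (intro open_chart_image open_Int open_dom) auto
  then have "C1b (snd c q) (tnorm q c) K (g' \<circ> chart_inv c)"
    by (rule C1b_cong[OF C]) (use c assms in \<open>auto simp: inv_chart\<close>)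
  then show ?thesis using c by (intro MC1bI)
qed

lemma MC1b_const: "MC1b q 0 (\<lambda>_. k)"
proof -
  obtain c where c: "c \<in> A" "q \<in> fst c" using chart_exists .
  then show ?thesis by (intro MC1bI[OF c]) (simp add: o_def C1b_const)
qed

lemma MC1b_mono:
  assumes "MC1b q K g" "K \<le> K'"
  shows "MC1b q K' g"
  using assms unfolding MC1b_def by (meson C1b_mono tnorm_nonneg)

text \<open>The straight segment in the chart is an admissible path of length at most
  \<open>N (y - x)\<close> and so bounds the Riemannian distance of its ends.\<close>

lemma chart_segment:
  assumes f: "lip_bound A \<rho> f L" and c: "c \<in> A" and ball: "ball x0 R \<subseteq> chart_range c"
    and N: "\<And>x v. x \<in> ball x0 R \<Longrightarrow> tnorm (chart_inv c x) c v \<le> N v"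
    and xy: "x \<in> ball x0 R" "y \<in> ball x0 R"
  shows "\<bar>f (chart_inv c x) - f (chart_inv c y)\<bar> \<le> L * N (y - x)"
proof -
  define l where "l = (\<lambda>t::real. x + t *\<^sub>R (y - x))"
  define \<gamma> where "\<gamma> = (\<lambda>t. chart_inv c (l t))"
  have l: "l t \<in> ball x0 R" if "t \<in> {0..1}" for t
    using convexD_alt[OF convex_ball xy, of t] that unfolding l_def by (simp add: algebra_simps)
  have lr: "l t \<in> chart_range c" if "t \<in> {0..1}" for t using l[OF that] ball by blast
  have contl: "continuous_on S l" for S unfolding l_def by (intro continuous_intros)
  have derl: "(l has_vector_derivative (y - x)) (at t within S)" for t S
    unfolding l_def has_vector_derivative_def by (auto intro!: derivative_eq_intros)
  have cont\<gamma>: "continuous_on {0..1} \<gamma>"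
    unfolding \<gamma>_def by (rule continuous_on_compose2[OF cont_inv[OF c] contl]) (use lr in auto)
  have \<gamma>c: "\<gamma> t \<in> fst c" "snd c (\<gamma> t) = l t" if "t \<in> {0..1}" for t
    unfolding \<gamma>_def using lr[OF that] c by (auto simp: inv_mem chart_inv)
  have "C1_path_on A \<gamma> 0 1"
    unfolding C1_path_on_def
  proof (intro conjI ballI cont\<gamma>)
    fix d assume d: "d \<in> A"
    obtain E where E: "\<forall>z\<in>snd c ` (fst c \<inter> fst d). ((snd d \<circ> chart_inv c) has_derivative blinfun_apply (E z)) (at z)"
      "continuous_on (snd c ` (fst c \<inter> fst d)) E"
      using transition_C1[OF c d] unfolding C1_on_def by auto
    have mem: "l t \<in> snd c ` (fst c \<inter> fst d)" if "t \<in> {0..1} \<inter> \<gamma> -` fst d" for t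
      using \<gamma>c[of t] that by (metis IntD1 IntD2 IntI image_eqI vimageE)
    show "\<exists>D. (\<forall>t\<in>{0..1} \<inter> \<gamma> -` fst d.
                      ((snd d \<circ> \<gamma>) has_vector_derivative D t) (at t within {0..1})) \<and>
                 continuous_on ({0..1} \<inter> \<gamma> -` fst d) D"
    proof (intro exI[of _ "\<lambda>t. E (l t) (y - x)"] conjI ballI)
      fix t assume t: "t \<in> {0..1} \<inter> \<gamma> -` fst d"
      have "((snd d \<circ> chart_inv c) has_derivative blinfun_apply (E (l t))) (at (l t) within l ` {0..1})"
        by (rule has_derivative_at_withinI) (use E(1) mem[OF t] in blast)
      from vector_derivative_diff_chain_within[OF derl this]
      show "((snd d \<circ> \<gamma>) has_vector_derivative E (l t) (y - x)) (at t within {0..1})"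
        unfolding \<gamma>_def by (simp add: o_def)
    next
      show "continuous_on ({0..1} \<inter> \<gamma> -` fst d) (\<lambda>t. E (l t) (y - x))"
        by (intro continuous_intros continuous_on_compose2[OF E(2) contl]) (use mem in auto)
    qed
  qed
  then have "\<exists>(n::nat) \<tau>. \<tau> 0 = (0::real) \<and> \<tau> n = 1 \<and>
        (\<forall>i<n. \<tau> i < \<tau> (Suc i) \<and> C1_path_on A \<gamma> (\<tau> i) (\<tau> (Suc i)))"
    by (intro exI[of _ "1::nat"] exI[of _ real]) simp
  then have pw: "piecewise_C1_path_on A \<gamma> 0 1" unfolding piecewise_C1_path_on_def .
  have len: "path_length A \<rho> \<gamma> 0 1 \<le> N (y - x)"
  proof -
    define h where "h = (\<lambda>t. sqrt (\<rho> (\<gamma> t) (velocity A \<gamma> t) (velocity A \<gamma> t)))"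
    have N0: "0 \<le> N (y - x)"
      using N[OF xy(1), of "y - x"] tnorm_nonneg[OF c inv_mem[OF c], of x "y - x"] xy(1) ball by force
    have h: "h t \<le> N (y - x)" if t: "t \<in> {0<..<1}" for t
    proof -
      have t': "t \<in> {0..1}" using t by auto
      have "((snd c \<circ> \<gamma>) has_vector_derivative (y - x)) (at t)"
        by (rule has_vector_derivative_transform_within_open[OF derl open_greaterThanLessThan t])
          (simp add: \<gamma>c)
      then have "velocity A \<gamma> t = tangent_vector A (\<gamma> t) c (y - x)"
        using t \<gamma>c[OF t'] c by (intro velocity_eq[where S = "{0<..<1}"])
          (auto intro: continuous_on_subset[OF cont\<gamma>])
      then have "h t = tnorm (chart_inv c (l t)) c (y - x)" unfolding h_def tnorm_def \<gamma>_def by simp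
      then show ?thesis using N[OF l[OF t']] by simp
    qed
    \<comment> \<open>The bound holds whether or not \<open>h\<close> is integrable: otherwise
      \<open>integral\<close> returns 0, and \<open>N (y - x)\<close> is nonnegative. The
      modification \<open>h'\<close> discards the values at the ends, where \<open>velocity\<close>
      may fail to represent the segment.\<close>
    have "integral {0..1} h \<le> N (y - x)"
    proof (cases "h integrable_on {0..1}")
      case True
      define h' where "h' = (\<lambda>t. if t \<in> {0<..<1} then h t else 0)"
      have "h' integrable_on {0..1}"
        by (rule integrable_spike[OF True, of "{0,1}"]) (auto simp: h'_def)
      then have "integral {0..1} h' \<le> integral {0..1} (\<lambda>t::real. N (y - x))"
        by (rule integral_le) (use h N0 in \<open>auto simp: h'_def\<close>)
      moreover have "integral {0..1} h = integral {0..1} h'"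
        by (rule integral_spike[of "{0,1}"]) (auto simp: h'_def)
      ultimately show ?thesis by simp
    next
      case False
      then show ?thesis using N0 by (simp add: not_integrable_integral)
    qed
    then show ?thesis unfolding path_length_def h_def .
  qed
  let ?p = "chart_inv c x" and ?q = "chart_inv c y"
  have ends: "\<gamma> 0 = ?p" "\<gamma> 1 = ?q" unfolding \<gamma>_def l_def by auto
  have "riem_dist A \<rho> ?p ?q \<le> ennreal (path_length A \<rho> \<gamma> 0 1)"
    unfolding riem_dist_def using pw ends
    by (intro Inf_lower CollectI exI[of _ \<gamma>] exI[of _ "0::real"] exI[of _ "1::real"] conjI) auto
  also have "\<dots> \<le> ennreal (N (y - x))" by (rule ennreal_leI[OF len])
  finally have d: "riem_dist A \<rho> ?p ?q \<le> ennreal (N (y - x))" .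
  then have fin: "riem_dist A \<rho> ?p ?q < \<infinity>"
    using ennreal_less_top le_less_trans by (metis infinity_ennreal_def)
  have "0 \<le> N (y - x)"
    using N[OF xy(1), of "y - x"] tnorm_nonneg[OF c inv_mem[OF c], of x "y - x"] xy(1) ball by force
  then have "enn2real (riem_dist A \<rho> ?p ?q) \<le> N (y - x)" using d by (rule enn2real_leI)
  then have "L * enn2real (riem_dist A \<rho> ?p ?q) \<le> L * N (y - x)"
    using f unfolding lip_bound_def by (intro mult_left_mono) auto
  moreover have "\<bar>f ?p - f ?q\<bar> \<le> L * enn2real (riem_dist A \<rho> ?p ?q)"
    using f fin unfolding lip_bound_def by blast
  ultimately show ?thesis by linarith
qed

text \<open>\<open>N\<close> is the metric frozen at \<open>x0\<close>. Closeness of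
  \<open>G x\<close> to \<open>G x0\<close> in operator norm becomes relative closeness of the
  quadratic forms because \<open>a * norm v \<le> N v\<close>.\<close>

lemma metric_almost_constant:
  assumes c: "c \<in> A" and x0: "x0 \<in> chart_range c" and \<eta>: "0 < \<eta>"
  shows "\<exists>R>0. \<exists>N a b. hilbert_norm N a b \<and> ball x0 R \<subseteq> chart_range c \<and>
    (\<forall>x\<in>ball x0 R. \<forall>v. tnorm (chart_inv c x) c v \<le> (1 + \<eta>) * N v \<and>
       N v \<le> (1 + \<eta>) * tnorm (chart_inv c x) c v)"
proof -
  obtain G :: "'h \<Rightarrow> 'h \<Rightarrow>\<^sub>L 'h \<Rightarrow>\<^sub>L real" where G: "continuous_on (chart_range c) G"
    "\<And>x u. x \<in> chart_range c \<Longrightarrow> tnorm (chart_inv c x) c u = sqrt (G x u u)"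
    "\<And>x u v. x \<in> chart_range c \<Longrightarrow> G x u v = G x v u"
    "\<And>x u. x \<in> chart_range c \<Longrightarrow> 0 \<le> G x u u"
    "\<And>x. x \<in> chart_range c \<Longrightarrow> \<exists>a>0. \<exists>b>0. \<forall>u. a * norm u \<le> sqrt (G x u u) \<and> sqrt (G x u u) \<le> b * norm u"
    using metric_in_chart[OF c] by metis
  obtain a b where ab: "a > 0" "\<And>u. a * norm u \<le> sqrt (G x0 u u)" "\<And>u. sqrt (G x0 u u) \<le> b * norm u"
    using G(5)[OF x0] by blast
  define N where "N = (\<lambda>v. sqrt (G x0 v v))"
  have hN: "hilbert_norm N a b"
    unfolding N_def by (rule hilbert_norm_bilinear[OF G(3)[OF x0] G(4)[OF x0] ab])
  \<comment> \<open>Chosen so that \<open>1 - \<kappa>\<close> is the inverse of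
    \<open>1 + \<eta>\<close>; a relative error \<open>\<kappa>\<close> of the forms then yields the
    factor \<open>1 + \<eta>\<close> in both directions after taking roots.\<close>
  define \<kappa> where "\<kappa> = \<eta> / (1 + \<eta>)"
  have \<kappa>: "\<kappa> > 0" "\<kappa> \<le> \<eta>" "1 - \<kappa> = 1 / (1 + \<eta>)" unfolding \<kappa>_def using \<eta> by (auto simp: field_simps)
  obtain R1 where R1: "R1 > 0" "ball x0 R1 \<subseteq> chart_range c"
    using openE[OF open_range[OF c] x0] .
  have "0 < \<kappa> * a\<^sup>2" using \<kappa> ab by simp
  then obtain R2 where R2: "R2 > 0" "\<And>x. x \<in> chart_range c \<Longrightarrow> dist x x0 < R2 \<Longrightarrow> dist (G x) (G x0) < \<kappa> * a\<^sup>2"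
    using G(1) x0 unfolding continuous_on_iff by blast
  have "tnorm (chart_inv c x) c v \<le> (1 + \<eta>) * N v \<and> N v \<le> (1 + \<eta>) * tnorm (chart_inv c x) c v"
    if x: "x \<in> ball x0 (min R1 R2)" for x v
  proof -
    have xr: "x \<in> chart_range c" using x R1 by auto
    have "norm (G x - G x0) < \<kappa> * a\<^sup>2" using R2(2)[OF xr] x by (simp add: dist_norm norm_minus_commute)
    moreover have "\<bar>G x v v - G x0 v v\<bar> \<le> norm (G x - G x0) * norm v * norm v"
      using norm_blinfun[of "(G x - G x0) v" v] mult_right_mono[OF norm_blinfun[of "G x - G x0" v], of "norm v"]
      by (simp add: blinfun.diff_left)
    moreover have "norm (G x - G x0) * norm v * norm v \<le> \<kappa> * a\<^sup>2 * norm v * norm v"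
      using calculation(1) by (intro mult_right_mono) auto
    moreover have "\<kappa> * a\<^sup>2 * norm v * norm v \<le> \<kappa> * G x0 v v"
    proof -
      have "(a * norm v)\<^sup>2 \<le> (sqrt (G x0 v v))\<^sup>2" using ab by (intro power_mono) auto
      then have "\<kappa> * (a * norm v)\<^sup>2 \<le> \<kappa> * G x0 v v" using \<kappa> G(4)[OF x0] by simp
      then show ?thesis by (simp add: power2_eq_square mult_ac)
    qed
    ultimately have close: "\<bar>G x v v - G x0 v v\<bar> \<le> \<kappa> * G x0 v v" by linarith
    have sq: "(1 + \<eta>) * sqrt z = sqrt ((1 + \<eta>)\<^sup>2 * z)" for z using \<eta> by (simp add: real_sqrt_mult)
    have g0: "0 \<le> G x0 v v" by (rule G(4)[OF x0])
    have "(1 + \<eta>)\<^sup>2 = 1 + 2 * \<eta> + \<eta> * \<eta>" by (simp add: power2_eq_square algebra_simps)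
    moreover have "0 \<le> \<eta> * \<eta>" by simp
    ultimately have \<kappa>\<eta>: "1 + \<kappa> \<le> (1 + \<eta>)\<^sup>2" using \<kappa>(2) \<eta> by linarith
    have "G x v v \<le> (1 + \<kappa>) * G x0 v v" using close by (simp add: algebra_simps)
    also have "\<dots> \<le> (1 + \<eta>)\<^sup>2 * G x0 v v"
      by (intro mult_right_mono g0 \<kappa>\<eta>)
    finally have 1: "G x v v \<le> (1 + \<eta>)\<^sup>2 * G x0 v v" .
    have "(1 - \<kappa>) * G x0 v v \<le> G x v v" using close by (simp add: algebra_simps)
    then have "G x0 v v \<le> (1 + \<eta>) * G x v v" unfolding \<kappa>(3) using \<eta> by (simp add: field_simps)
    also have "\<dots> \<le> (1 + \<eta>)\<^sup>2 * G x v v"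
      using \<eta> by (intro mult_right_mono G(4)[OF xr]) (simp add: power2_eq_square)
    finally have 2: "G x0 v v \<le> (1 + \<eta>)\<^sup>2 * G x v v" .
    show ?thesis unfolding G(2)[OF xr] N_def sq using 1 2 by simp
  qed
  then show ?thesis using R1 R2 hN
    by (intro exI[of _ "min R1 R2"] conjI exI[of _ N] exI[of _ a] exI[of _ b]) auto
qed

text \<open>The bounds \<open>L + r\<close> and \<open>24 * m\<close> are the same for all
  \<open>p\<close>. What varies from point to point is confined to the neighbourhood
  \<open>U\<close> and the radius \<open>k\<close>, about which no uniformity in \<open>p\<close> is
  claimed.\<close>

lemma local_structure:
  assumes f: "lip_bound A \<rho> f L" and r: "0 < r"
  shows "\<exists>U c k. open U \<and> p \<in> U \<and> c \<in> A \<and> U \<subseteq> fst c \<and> 0 < k \<and>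
    (\<forall>\<delta>>0. \<exists>F. \<forall>q\<in>U. MC1b q (L + r) F \<and> \<bar>F q - f q\<bar> \<le> \<delta>) \<and>
    (\<forall>V m. closure V \<subseteq> U \<and> 1 \<le> m \<longrightarrow>
       (\<exists>\<beta>. \<forall>q. MC1b q (24 * m) \<beta> \<and> 0 \<le> \<beta> q \<and> \<beta> q \<le> 1 \<and> (\<beta> q \<noteq> 0 \<longrightarrow> q \<in> V) \<and>
          (q \<in> U \<and> ball (snd c q) (k / m) \<subseteq> snd c ` V \<longrightarrow> \<beta> q = 1)))"
proof -
  have L: "0 \<le> L" using f unfolding lip_bound_def by blast
  \<comment> \<open>The factor \<open>1 + \<eta>\<close> enters twice: when segments are measured by
    \<open>N\<close>, and when \<open>N\<close> is turned back into tangent norms. For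
    \<open>\<eta> \<le> 1\<close> the product is at most \<open>L + 3 * L * \<eta>\<close>. The 1 in
    the denominator covers \<open>L = 0\<close>, and \<open>\<eta> \<le> 1\<close> also turns the 12
    of the bumps into 24.\<close>
  define \<eta> where "\<eta> = min 1 (r / (3 * L + 1))"
  have \<eta>: "0 < \<eta>" "\<eta> \<le> 1" unfolding \<eta>_def using L r by auto
  have "L * ((1 + \<eta>) * (1 + \<eta>)) \<le> L + r"
  proof -
    have "(3 * L + 1) * \<eta> \<le> (3 * L + 1) * (r / (3 * L + 1))"
      using L by (intro mult_left_mono) (auto simp: \<eta>_def)
    also have "\<dots> = r" using L by simp
    finally have "3 * L * \<eta> \<le> r" using L \<eta> by (simp add: distrib_right)
    moreover have "L * (\<eta> * \<eta>) \<le> L * (1 * \<eta>)" using L \<eta> by (intro mult_left_mono mult_right_mono) auto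
    ultimately show ?thesis by (simp add: algebra_simps)
  qed
  then have L\<eta>: "L * (1 + \<eta>) * (1 + \<eta>) \<le> L + r" by (simp add: mult.assoc)
  obtain c where c: "c \<in> A" "p \<in> fst c" using chart_exists .
  obtain R N a b where R: "R > 0" and N: "hilbert_norm N a b" and ball: "ball (snd c p) R \<subseteq> chart_range c"
    and tN: "\<And>x v. x \<in> ball (snd c p) R \<Longrightarrow> tnorm (chart_inv c x) c v \<le> (1 + \<eta>) * N v"
    and Nt: "\<And>x v. x \<in> ball (snd c p) R \<Longrightarrow> N v \<le> (1 + \<eta>) * tnorm (chart_inv c x) c v"
    using metric_almost_constant[OF c(1) chart_mem[OF c] \<eta>(1)] by blast
  interpret hilbert_norm N a b by (rule N)
  define U where "U = chart_inv c ` ball (snd c p) R"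
  have opU: "open U" unfolding U_def using open_inv_image[OF c(1) open_ball ball] .
  have pU: "p \<in> U" unfolding U_def using R c inv_chart[OF c] by (metis centre_in_ball image_eqI)
  have Uc: "U \<subseteq> fst c" unfolding U_def using ball inv_mem[OF c(1)] by auto
  have Ub: "snd c q \<in> ball (snd c p) R" if "q \<in> U" for q
    using that ball chart_inv[OF c(1)] unfolding U_def by auto
  have MC: "MC1b q (K * (1 + \<eta>)) g" if "q \<in> U" "C1b (snd c q) N K F" "0 \<le> K"
    "\<And>x. x \<in> ball (snd c p) R \<Longrightarrow> g (chart_inv c x) = F x" for q K F g
  proof -
    have qc: "q \<in> fst c" using that Uc by blast
    have "C1b (snd c q) (tnorm q c) (K * (1 + \<eta>)) F"
      by (rule C1b_change_gauge[OF that(2) _ that(3)]) (use Nt[OF Ub[OF that(1)]] inv_chart[OF c(1) qc] in simp)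
    then have "C1b (snd c q) (tnorm q c) (K * (1 + \<eta>)) (g \<circ> chart_inv c)"
      by (rule C1b_cong[OF _ open_ball Ub[OF that(1)]]) (simp add: that(4))
    then show ?thesis by (rule MC1bI[OF c(1) qc])
  qed
  have "\<exists>F. \<forall>q\<in>U. MC1b q (L + r) F \<and> \<bar>F q - f q\<bar> \<le> \<delta>" if \<delta>: "\<delta> > 0" for \<delta>
  proof -
    have ne: "ball (snd c p) R \<noteq> {}" using R by simp
    have "f (chart_inv c x) - f (chart_inv c y) \<le> L * (1 + \<eta>) * N (x - y)"
      if "x \<in> ball (snd c p) R" "y \<in> ball (snd c p) R" for x y
      using chart_segment[OF f c(1) ball tN that] N_minus[of x y] by (simp add: mult.assoc abs_le_iff)
    from C1_approximation[OF ne _ this \<delta>] obtain g where g: "\<And>x. C1b x N (L * (1 + \<eta>)) g"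
      "\<And>x. x \<in> ball (snd c p) R \<Longrightarrow> \<bar>g x - f (chart_inv c x)\<bar> \<le> \<delta>"
      using L \<eta> by (metis add_nonneg_nonneg less_imp_le mult_nonneg_nonneg zero_le_one)
    have "MC1b q (L + r) (g \<circ> snd c)" if q: "q \<in> U" for q
    proof (rule MC1b_mono[OF MC[OF q g(1)] L\<eta>])
      show "0 \<le> L * (1 + \<eta>)" using L \<eta> by simp
      show "(g \<circ> snd c) (chart_inv c x) = g x" if "x \<in> ball (snd c p) R" for x
        using that ball chart_inv[OF c(1)] by auto
    qed
    moreover have "\<bar>(g \<circ> snd c) q - f q\<bar> \<le> \<delta>" if q: "q \<in> U" for q
      using g(2)[OF Ub[OF q]] inv_chart[OF c(1)] Uc q by auto
    ultimately show ?thesis by blast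
  qed
  moreover have "\<exists>\<beta>. \<forall>q. MC1b q (24 * m) \<beta> \<and> 0 \<le> \<beta> q \<and> \<beta> q \<le> 1 \<and> (\<beta> q \<noteq> 0 \<longrightarrow> q \<in> V) \<and>
          (q \<in> U \<and> ball (snd c q) (1 / a / m) \<subseteq> snd c ` V \<longrightarrow> \<beta> q = 1)"
    if V: "closure V \<subseteq> U" and m: "1 \<le> m" for V m
  proof -
    have VU: "V \<subseteq> U" using V closure_subset by blast
    obtain \<phi> where b: "\<And>x. C1b x N (12 * m) \<phi>" "\<And>x. 0 \<le> \<phi> x" "\<And>x. \<phi> x \<le> 1"
      "\<And>x. \<phi> x \<noteq> 0 \<Longrightarrow> x \<in> snd c ` V" "\<And>x. ball x (1 / (a * m)) \<subseteq> snd c ` V \<Longrightarrow> \<phi> x = 1"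
      using C1_bump[OF m, of "snd c ` V"] by blast
    define \<beta> where "\<beta> = (\<lambda>q. if q \<in> U then \<phi> (snd c q) else 0)"
    have supp: "q \<in> V" if "\<beta> q \<noteq> 0" for q
    proof -
      have q: "q \<in> U" "\<phi> (snd c q) \<noteq> 0" using that unfolding \<beta>_def by (auto split: if_splits)
      then obtain q' where "q' \<in> V" "snd c q' = snd c q" using b(4) by force
      then show ?thesis using q(1) VU Uc inv_chart[OF c(1)] by (metis subsetD)
    qed
    have "MC1b q (24 * m) \<beta>" for q
    proof (cases "q \<in> U")
      case True
      have "MC1b q (12 * m * (1 + \<eta>)) \<beta>"
        by (rule MC[OF True b(1)]) (use m ball chart_inv[OF c(1)] in \<open>auto simp: \<beta>_def U_def\<close>)
      then show ?thesis by (rule MC1b_mono) (use m \<eta> in simp)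
    next
      case False
      \<comment> \<open>A point outside \<open>U\<close> has the open neighbourhood
        \<open>- closure V\<close>, on which the bump is 0; hence the extension by 0 is C1.\<close>
      have "MC1b q 0 \<beta>"
        by (rule MC1b_cong[OF MC1b_const, of "- closure V" q 0])
          (use False V supp closure_subset in \<open>auto\<close>)
      then show ?thesis by (rule MC1b_mono) (use m in simp)
    qed
    moreover have "\<beta> q = 1" if "q \<in> U" "ball (snd c q) (1 / a / m) \<subseteq> snd c ` V" for q
      using b(5) that unfolding \<beta>_def by simp
    ultimately show ?thesis using supp b(2,3) by (intro exI[of _ \<beta>]) (auto simp: \<beta>_def)
  qed
  moreover have "0 < 1 / a" using a by simp
  ultimately show ?thesis using opU pU c(1) Uc
    by (intro exI[of _ U] exI[of _ c] exI[of _ "1 / a"] conjI allI impI) auto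
qed

end

section \<open>Gluing\<close>

text \<open>\<open>LEAST\<close> on the reals gives a Lipschitz bound only if the least one is
  attained. The infimum of all bounds is again a bound, the conditions on \<open>L\<close> being
  closed; pairs at distance 0 are treated apart because the others are handled by division.\<close>

lemma
  assumes "riem_lipschitz A \<rho> f"
  shows lip_bound_Lip: "lip_bound A \<rho> f (Lip A \<rho> f)"
    and Lip_le: "lip_bound A \<rho> f K \<Longrightarrow> Lip A \<rho> f \<le> K"
proof -
  define S where "S = {L. lip_bound A \<rho> f L}"
  have ne: "S \<noteq> {}" using assms unfolding S_def riem_lipschitz_def by blast
  have bdd: "bdd_below S" by (rule bdd_belowI[of _ 0]) (auto simp: S_def lip_bound_def)
  have "lip_bound A \<rho> f (Inf S)"
    unfolding lip_bound_def
  proof (intro conjI allI impI)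
    show "0 \<le> Inf S" by (rule cInf_greatest[OF ne]) (auto simp: S_def lip_bound_def)
    fix p q assume fin: "riem_dist A \<rho> p q < \<infinity>"
    define d where "d = enn2real (riem_dist A \<rho> p q)"
    have S: "\<bar>f p - f q\<bar> \<le> L * d" if "L \<in> S" for L
      using that fin unfolding S_def lip_bound_def d_def by blast
    show "\<bar>f p - f q\<bar> \<le> Inf S * enn2real (riem_dist A \<rho> p q)"
      unfolding d_def[symmetric]
    proof (cases "d = 0")
      case True
      then show "\<bar>f p - f q\<bar> \<le> Inf S * d" using ne S by auto
    next
      case False
      then have d: "d > 0" unfolding d_def using enn2real_nonneg[of "riem_dist A \<rho> p q"] by linarith
      have "\<bar>f p - f q\<bar> / d \<le> Inf S"
        by (rule cInf_greatest[OF ne]) (use S d in \<open>simp add: pos_divide_le_eq\<close>)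
      then show "\<bar>f p - f q\<bar> \<le> Inf S * d" using d by (simp add: pos_divide_le_eq)
    qed
  qed
  moreover have "Inf S \<le> K" if "lip_bound A \<rho> f K" for K
    by (rule cInf_lower[OF _ bdd]) (use that in \<open>simp add: S_def\<close>)
  ultimately have "Lip A \<rho> f = Inf S" unfolding Lip_def by (intro Least_equality) auto
  then show "lip_bound A \<rho> f (Lip A \<rho> f)" "lip_bound A \<rho> f K \<Longrightarrow> Lip A \<rho> f \<le> K"
    using \<open>lip_bound A \<rho> f (Inf S)\<close> \<open>\<And>K. lip_bound A \<rho> f K \<Longrightarrow> Inf S \<le> K\<close> by auto
qed

context riem_mfd
begin

section \<open>Rules for bounded differentials, transferred to the manifold through a chart\<close>

lemma MC1b_sum:
  assumes "finite I" "\<And>i. i \<in> I \<Longrightarrow> MC1b q (K i) (g i)"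
  shows "MC1b q (sum K I) (\<lambda>p. \<Sum>i\<in>I. g i p)"
proof -
  obtain c where c: "c \<in> A" "q \<in> fst c" using chart_exists .
  show ?thesis
    using C1b_sum[OF assms(1) MC1b_chart[OF assms(2) c]] by (intro MC1bI[OF c]) (simp add: o_def)
qed

lemma MC1b_add:
  assumes "MC1b q K g" "MC1b q K' g'"
  shows "MC1b q (K + K') (\<lambda>p. g p + g' p)"
proof -
  obtain c where c: "c \<in> A" "q \<in> fst c" using chart_exists .
  show ?thesis
    using C1b_add[OF MC1b_chart[OF assms(1) c] MC1b_chart[OF assms(2) c]]
    by (intro MC1bI[OF c]) (simp add: o_def)
qed

lemma MC1b_mult:
  assumes "MC1b q K g" "MC1b q K' g'" "\<bar>g q\<bar> \<le> a" "\<bar>g' q\<bar> \<le> b"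
  shows "MC1b q (a * K' + b * K) (\<lambda>p. g p * g' p)"
proof -
  obtain c where c: "c \<in> A" "q \<in> fst c" using chart_exists .
  show ?thesis
    using C1b_mult[OF MC1b_chart[OF assms(1) c] MC1b_chart[OF assms(2) c], of a b] assms(3,4)
    by (intro MC1bI[OF c]) (simp add: o_def inv_chart[OF c])
qed

lemma MC1b_compose:
  assumes "MC1b q K g" "\<And>t. (\<phi> has_real_derivative \<phi>' t) (at t)" "continuous_on UNIV \<phi>'"
    "\<bar>\<phi>' (g q)\<bar> \<le> a"
  shows "MC1b q (a * K) (\<lambda>p. \<phi> (g p))"
proof -
  obtain c where c: "c \<in> A" "q \<in> fst c" using chart_exists .
  show ?thesis
    using C1b_compose[OF MC1b_chart[OF assms(1) c] assms(2,3), of a] assms(4)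
    by (intro MC1bI[OF c]) (simp add: o_def inv_chart[OF c])
qed

lemma MC1b_zero_min:
  assumes "MC1b q K g" "g q = 0" "\<And>p. 0 \<le> g p"
  shows "MC1b q 0 g"
proof -
  obtain c where c: "c \<in> A" "q \<in> fst c" using chart_exists .
  show ?thesis
    using C1b_zero_min[OF MC1b_chart[OF assms(1) c]] assms(2,3)
    by (intro MC1bI[OF c]) (simp add: o_def inv_chart[OF c])
qed

lemma MC1b_partition:
  assumes fin: "finite I"
    and w: "\<And>i. i \<in> I \<Longrightarrow> MC1b q (\<kappa> i) (w i)" and F: "\<And>i. i \<in> I \<Longrightarrow> MC1b q K (F i)"
    and w0: "\<And>i. i \<in> I \<Longrightarrow> 0 \<le> w i q"
    and T: "open T" "q \<in> T" "\<And>p. p \<in> T \<Longrightarrow> (\<Sum>i\<in>I. w i p) = 1"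
    and dev: "\<And>i. i \<in> I \<Longrightarrow> \<bar>F i q - k\<bar> * \<kappa> i \<le> e i"
  shows "MC1b q (K + sum e I) (\<lambda>p. \<Sum>i\<in>I. w i p * F i p)"
proof -
  obtain c where c: "c \<in> A" "q \<in> fst c" using chart_exists .
  have "C1b (snd c q) (tnorm q c) (K + sum e I)
      (\<lambda>x. \<Sum>i\<in>I. (w i \<circ> chart_inv c) x * (F i \<circ> chart_inv c) x)"
  proof (rule C1b_partition[OF fin MC1b_chart[OF w c] MC1b_chart[OF F c]])
    show "open (snd c ` (fst c \<inter> T))" using c T by (intro open_chart_image open_Int open_dom) auto
    show "snd c q \<in> snd c ` (fst c \<inter> T)" using c T by blast
    show "(\<Sum>i\<in>I. (w i \<circ> chart_inv c) y) = 1" if "y \<in> snd c ` (fst c \<inter> T)" for y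
      using that T(3) inv_chart[OF c(1)] by auto
    show "\<bar>(F i \<circ> chart_inv c) (snd c q) - k\<bar> * \<kappa> i \<le> e i" if "i \<in> I" for i
      using dev[OF that] inv_chart[OF c] by simp
  qed (use w0 inv_chart[OF c] tnorm_nonneg[OF c] in auto)
  then show ?thesis by (intro MC1bI[OF c]) (simp add: o_def)
qed

text \<open>
  In layer \<open>m\<close> at most \<open>m\<close> members overlap, and the bound \<open>C m\<close> of the differentials is uniform
  in \<open>V\<close>. No local finiteness in \<open>m\<close> is required: the weights below vanish near a point as soon
  as an earlier layer contains a function that is 1 there.
\<close>

definition layered_bumps ::
  "'m set set \<Rightarrow> (nat \<Rightarrow> 'm set) \<Rightarrow> (nat \<Rightarrow> real) \<Rightarrow> ('m set \<Rightarrow> nat \<Rightarrow> 'm \<Rightarrow> real) \<Rightarrow> bool" where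
  "layered_bumps \<V> Q C \<beta> \<longleftrightarrow>
     (\<forall>q. \<exists>W. open W \<and> q \<in> W \<and> finite {V \<in> \<V>. V \<inter> W \<noteq> {}}) \<and>
     (\<forall>V\<in>\<V>. \<forall>m q. MC1b q (C m) (\<beta> V m) \<and> 0 \<le> \<beta> V m q \<and> \<beta> V m q \<le> 1 \<and>
        (\<beta> V m q \<noteq> 0 \<longrightarrow> q \<in> V \<inter> Q m)) \<and>
     (\<forall>m. \<forall>q\<in>Q m. card {V \<in> \<V>. q \<in> V} \<le> m) \<and>
     (\<forall>q. \<exists>V\<in>\<V>. \<exists>m T. open T \<and> q \<in> T \<and> (\<forall>p\<in>T. \<beta> V m p = 1))"

lemma layered_bumpsD:
  assumes "layered_bumps \<V> Q C \<beta>"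
  shows "\<exists>W. open W \<and> q \<in> W \<and> finite {V \<in> \<V>. V \<inter> W \<noteq> {}}"
    and "V \<in> \<V> \<Longrightarrow> MC1b q (C m) (\<beta> V m)"
    and "V \<in> \<V> \<Longrightarrow> 0 \<le> \<beta> V m q" "V \<in> \<V> \<Longrightarrow> \<beta> V m q \<le> 1"
    and "V \<in> \<V> \<Longrightarrow> \<beta> V m q \<noteq> 0 \<Longrightarrow> q \<in> V \<inter> Q m"
    and "q \<in> Q m \<Longrightarrow> card {V \<in> \<V>. q \<in> V} \<le> m"
    and "\<exists>V\<in>\<V>. \<exists>m T. open T \<and> q \<in> T \<and> (\<forall>p\<in>T. \<beta> V m p = 1)"
  using assms unfolding layered_bumps_def by simp_all

text \<open>\<open>S m * recip (S m)\<close> lies between 0 and 1 and equals 1 once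
  \<open>S m \<ge> 1\<close>. \<open>R m\<close> is the product of
  \<open>1 - S j * recip (S j)\<close> over \<open>j < m\<close>, the share left over by earlier
  layers. The weights of layer \<open>m\<close> add up to \<open>R m - R (Suc m)\<close>, so the sum
  telescopes to \<open>1 - R (Suc M)\<close>, and \<open>R (Suc M)\<close> vanishes where a bump of
  layer \<open>M\<close> is 1. Using \<open>recip\<close> for division by \<open>S m\<close> keeps
  the differentials bounded where \<open>S m\<close> is small.\<close>

lemma partition_of_unity:
  assumes bumps: "layered_bumps \<V> Q C \<beta>" and C: "\<And>m. 0 \<le> C m"
  shows "\<exists>w. (\<forall>V\<in>\<V>. \<forall>m q. 0 \<le> w V m q \<and> (w V m q \<noteq> 0 \<longrightarrow> q \<in> V \<inter> Q m)) \<and>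
     (\<forall>m. \<exists>K\<ge>0. \<forall>V\<in>\<V>. \<forall>q. MC1b q K (w V m)) \<and>
     (\<forall>q. \<exists>T M I. open T \<and> q \<in> T \<and> finite I \<and> I \<subseteq> \<V> \<and> (\<forall>V\<in>I. q \<in> closure V) \<and>
        (\<forall>p\<in>T. \<forall>V\<in>\<V>. \<forall>m. V \<notin> I \<or> M < m \<longrightarrow> w V m p = 0) \<and>
        (\<forall>p\<in>T. (\<Sum>m\<le>M. \<Sum>V\<in>I. w V m p) = (1::real)))"
proof -
  note lf = layered_bumpsD(1)[OF bumps] and \<beta> = layered_bumpsD(2)[OF bumps]
    and \<beta>0 = layered_bumpsD(3)[OF bumps] and \<beta>1 = layered_bumpsD(4)[OF bumps]
    and supp = layered_bumpsD(5)[OF bumps] and Q = layered_bumpsD(6)[OF bumps]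
    and cover = layered_bumpsD(7)[OF bumps]
  \<comment> \<open>The finitely many members that meet \<open>W\<close> but whose closure misses
    \<open>q\<close> are cut out of it. Every remaining \<open>V\<close> has \<open>q\<close> in its
    closure, where its local approximation will be available.\<close>
  have loc: "\<exists>W I. open W \<and> q \<in> W \<and> finite I \<and> I \<subseteq> \<V> \<and> (\<forall>V\<in>I. q \<in> closure V) \<and>
      (\<forall>V\<in>\<V>. V \<inter> W \<noteq> {} \<longrightarrow> V \<in> I)" for q
  proof -
    obtain W where W: "open W" "q \<in> W" "finite {V \<in> \<V>. V \<inter> W \<noteq> {}}" using lf by blast
    define I where "I = {V \<in> \<V>. V \<inter> W \<noteq> {} \<and> q \<in> closure V}"
    define J where "J = {V \<in> \<V>. V \<inter> W \<noteq> {} \<and> q \<notin> closure V}"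
    have "finite I" "finite J" unfolding I_def J_def using W(3) by (auto elim: rev_finite_subset)
    moreover have "V \<in> I" if "V \<in> \<V>" "V \<inter> (W - \<Union>(closure ` J)) \<noteq> {}" for V
    proof (rule ccontr)
      assume "V \<notin> I"
      then have "V \<in> J" using that unfolding I_def J_def by blast
      then show False using that closure_subset[of V] by blast
    qed
    moreover have "open (W - \<Union>(closure ` J))" using W(1) \<open>finite J\<close> by (intro open_Diff closed_UN) auto
    moreover have "q \<in> W - \<Union>(closure ` J)" using W(2) unfolding J_def by auto
    ultimately show ?thesis by (intro exI[of _ "W - \<Union>(closure ` J)"] exI[of _ I]) (auto simp: I_def)
  qed
  have fin: "finite {V \<in> \<V>. q \<in> V}" for q
  proof -
    obtain W where "q \<in> W" "finite {V \<in> \<V>. V \<inter> W \<noteq> {}}" using lf by blast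
    then show ?thesis by (rule_tac finite_subset[of _ "{V \<in> \<V>. V \<inter> W \<noteq> {}}"]) auto
  qed
  define S where "S = (\<lambda>m q. \<Sum>V\<in>{V \<in> \<V>. q \<in> V}. \<beta> V m q)"
  have S_eq: "S m p = (\<Sum>V\<in>I. \<beta> V m p)" if "finite I" "I \<subseteq> \<V>" "\<And>V. V \<in> \<V> \<Longrightarrow> p \<in> V \<Longrightarrow> V \<in> I" for m p I
    unfolding S_def by (rule sum.mono_neutral_left) (use that supp in auto)
  have S0: "0 \<le> S m q" for m q unfolding S_def by (intro sum_nonneg \<beta>0) auto
  have Sm: "S m q \<le> real m" for m q
  proof (cases "q \<in> Q m")
    case True
    have "S m q \<le> (\<Sum>V\<in>{V \<in> \<V>. q \<in> V}. 1)" unfolding S_def by (intro sum_mono \<beta>1) auto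
    also have "\<dots> \<le> real m" using Q[OF True] by simp
    finally show ?thesis .
  next
    case False
    have "S m q = 0" unfolding S_def by (rule sum.neutral) (use False supp in blast)
    then show ?thesis by simp
  qed
  have MCS: "MC1b q (real m * C m) (S m)" for m q
  proof -
    obtain W I where W: "open W" "q \<in> W" "finite I" "I \<subseteq> \<V>" "\<forall>V\<in>\<V>. V \<inter> W \<noteq> {} \<longrightarrow> V \<in> I"
      using loc[of q] by metis
    \<comment> \<open>Outside \<open>V \<inter> Q m\<close> the bump has a minimum and no
      differential, so at most \<open>m\<close> members count. Charging \<open>C m\<close> for all
      of \<open>I\<close> would give a constant that depends on \<open>q\<close>.\<close>
    define \<kappa> where "\<kappa> = (\<lambda>V. if q \<in> V \<inter> Q m then C m else 0)"
    have "MC1b q (\<kappa> V) (\<beta> V m)" if "V \<in> I" for V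
    proof (cases "q \<in> V \<inter> Q m")
      case True then show ?thesis using \<beta> W(4) that by (auto simp: \<kappa>_def)
    next
      case False
      then have "MC1b q 0 (\<beta> V m)" using \<beta> supp \<beta>0 W(4) that by (intro MC1b_zero_min[of q "C m"]) blast+
      moreover have "\<kappa> V = 0" using False unfolding \<kappa>_def by (rule if_not_P)
      ultimately show ?thesis by simp
    qed
    then have "MC1b q (sum \<kappa> I) (\<lambda>p. \<Sum>V\<in>I. \<beta> V m p)" by (rule MC1b_sum[OF W(3)])
    then have 1: "MC1b q (sum \<kappa> I) (S m)"
      by (rule MC1b_cong[OF _ W(1,2)]) (use W(3-5) S_eq in \<open>metis IntI empty_iff\<close>)
    have "sum \<kappa> I \<le> real m * C m"
    proof (cases "q \<in> Q m")
      case True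
      have "sum \<kappa> I = (\<Sum>V\<in>I. if q \<in> V then C m else 0)" unfolding \<kappa>_def using True by simp
      also have "\<dots> = (\<Sum>V\<in>{V \<in> I. q \<in> V}. C m)" by (rule sum.inter_filter[OF W(3), symmetric])
      also have "\<dots> = real (card {V \<in> I. q \<in> V}) * C m" by simp
      also have "\<dots> \<le> real m * C m"
      proof (rule mult_right_mono[OF _ C])
        have "card {V \<in> I. q \<in> V} \<le> card {V \<in> \<V>. q \<in> V}" using W(4) by (intro card_mono fin) auto
        then show "real (card {V \<in> I. q \<in> V}) \<le> real m" using Q[OF True] by simp
      qed
      finally show ?thesis .
    next
      case False
      then show ?thesis using C by (simp add: \<kappa>_def)
    qed
    then show ?thesis by (rule MC1b_mono[OF 1])
  qed
  have MCr: "MC1b q (2 * (real m * C m)) (\<lambda>p. recip (S m p))" for m q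
    by (rule MC1b_compose[OF MCS DERIV_recip continuous_recip' recip'_bound[OF S0]])
  \<comment> \<open>Subtraction is written as addition of a multiple by -1, to match the rules for
    sums and products.\<close>
  define R where "R = rec_nat (\<lambda>q. 1) (\<lambda>m Rm q. Rm q * (1 + (- 1) * (S m q * recip (S m q))))"
  have R0: "R 0 q = 1" and RS: "R (Suc m) q = R m q * (1 + (- 1) * (S m q * recip (S m q)))" for m q
    unfolding R_def by auto
  have h: "0 \<le> S m q * recip (S m q)" "S m q * recip (S m q) \<le> 1" for m q
    using S0 recip_range recip_mult_le by auto
  have Rr: "0 \<le> R m q \<and> R m q \<le> 1" for m q
  proof (induction m)
    case (Suc m)
    then show ?case unfolding RS using h[of m q] by (auto intro!: mult_le_one)
  qed (simp add: R0)
  have MCR: "\<exists>K\<ge>0. \<forall>q. MC1b q K (R m)" for m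
  proof (induction m)
    case 0
    have "R 0 = (\<lambda>_. 1)" using R0 by auto
    then show ?case using MC1b_const by (intro exI[of _ 0]) simp
  next
    case (Suc m)
    then obtain K where K: "K \<ge> 0" "\<And>q. MC1b q K (R m)" by blast
    define K1 where "K1 = real m * (2 * (real m * C m)) + 2 * (real m * C m)"
    have K1: "K1 \<ge> 0" unfolding K1_def using C by simp
    have "MC1b q K1 (\<lambda>p. S m p * recip (S m p))" for q
      unfolding K1_def by (rule MC1b_mult[OF MCS MCr]) (use S0 Sm recip_range in auto)
    then have "MC1b q (0 + (1 * K1 + 1 * 0)) (\<lambda>p. 1 + (- 1) * (S m p * recip (S m p)))" for q
      by (rule MC1b_add[OF MC1b_const MC1b_mult[OF MC1b_const]]) (use h in auto)
    then have "MC1b q (1 * (0 + (1 * K1 + 1 * 0)) + 1 * K) (\<lambda>p. R m p * (1 + (- 1) * (S m p * recip (S m p))))" for q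
      by (rule MC1b_mult[OF K(2)]) (use Rr[of m q] h[of m q] in auto)
    then show ?case unfolding RS[abs_def, symmetric] using K1 K(1)
      by (intro exI[of _ "1 * (0 + (1 * K1 + 1 * 0)) + 1 * K"]) simp
  qed
  define w where "w = (\<lambda>V m q. \<beta> V m q * (recip (S m q) * R m q))"
  have w0: "0 \<le> w V m q \<and> (w V m q \<noteq> 0 \<longrightarrow> q \<in> V \<inter> Q m)" if "V \<in> \<V>" for V m q
    using \<beta>0[OF that] supp[OF that, of m q] recip_range(1) Rr unfolding w_def
    by (auto intro!: mult_nonneg_nonneg)
  have "\<exists>K\<ge>0. \<forall>V\<in>\<V>. \<forall>q. MC1b q K (w V m)" for m
  proof -
    obtain K where K: "K \<ge> 0" "\<And>q. MC1b q K (R m)" using MCR by blast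
    define K2 where "K2 = 2 * K + 1 * (2 * (real m * C m))"
    have 2: "MC1b q K2 (\<lambda>p. recip (S m p) * R m p)" for q
      unfolding K2_def by (rule MC1b_mult[OF MCr K(2)]) (use recip_range Rr in auto)
    have "\<bar>recip (S m q) * R m q\<bar> \<le> 2" for q
      using mult_mono[of "recip (S m q)" 2 "R m q" 1] recip_range Rr[of m q] by (simp add: abs_mult)
    then have "MC1b q (1 * K2 + 2 * C m) (w V m)" if "V \<in> \<V>" for V q
      unfolding w_def by (intro MC1b_mult[OF \<beta>[OF that] 2]) (use \<beta>0[OF that] \<beta>1[OF that] in auto)
    moreover have "1 * K2 + 2 * C m \<ge> 0" unfolding K2_def using K C by simp
    ultimately show ?thesis by blast
  qed
  moreover have "\<exists>T M I. open T \<and> q \<in> T \<and> finite I \<and> I \<subseteq> \<V> \<and> (\<forall>V\<in>I. q \<in> closure V) \<and>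
        (\<forall>p\<in>T. \<forall>V\<in>\<V>. \<forall>m. V \<notin> I \<or> M < m \<longrightarrow> w V m p = 0) \<and>
        (\<forall>p\<in>T. (\<Sum>m\<le>M. \<Sum>V\<in>I. w V m p) = 1)" for q
  proof -
    obtain W I where W: "open W" "q \<in> W" "finite I" "I \<subseteq> \<V>" "\<forall>V\<in>I. q \<in> closure V"
      "\<forall>V\<in>\<V>. V \<inter> W \<noteq> {} \<longrightarrow> V \<in> I"
      using loc[of q] by metis
    obtain V0 M T where T: "V0 \<in> \<V>" "open T" "q \<in> T" "\<And>p. p \<in> T \<Longrightarrow> \<beta> V0 M p = 1"
      using cover[of q] by metis
    have RM: "R (Suc M) p = 0" if "p \<in> T" for p
    proof -
      have "p \<in> V0" using supp[OF T(1), of M p] T(4)[OF that] by simp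
      then have "\<beta> V0 M p \<le> S M p" unfolding S_def using T(1) \<beta>0
        by (intro member_le_sum) (auto simp: fin)
      then have "S M p * recip (S M p) = 1" using T(4)[OF that] by (intro recip_mult_eq) simp
      then show ?thesis unfolding RS by simp
    qed
    have RM': "R m p = 0" if "p \<in> T" "M < m" for p m
      using that(2)
    proof (induction m)
      case (Suc m)
      then show ?case using RM[OF that(1)] by (cases "m = M") (auto simp: RS)
    qed simp
    have "w V m p = 0" if "p \<in> T \<inter> W" "V \<in> \<V>" "V \<notin> I \<or> M < m" for p V m
    proof (cases "V \<in> I")
      case True
      then show ?thesis using RM' that unfolding w_def by auto
    next
      case False
      then have "p \<notin> V" using W(6) that by blast
      then show ?thesis using w0[OF that(2)] by blast
    qed
    moreover have "(\<Sum>m\<le>M. \<Sum>V\<in>I. w V m p) = 1" if p: "p \<in> T \<inter> W" for p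
    proof -
      have "(\<Sum>V\<in>I. w V m p) = R m p - R (Suc m) p" for m
      proof -
        have "(\<Sum>V\<in>I. w V m p) = S m p * (recip (S m p) * R m p)"
          unfolding w_def sum_distrib_right[symmetric]
          using S_eq[OF W(3,4), of p m] W(6) p by (metis IntD2 IntI empty_iff)
        then show ?thesis unfolding RS by (simp add: algebra_simps)
      qed
      then have "(\<Sum>m\<le>M. \<Sum>V\<in>I. w V m p) = (\<Sum>m\<le>M. R m p - R (Suc m) p)" by simp
      also have "\<dots> = R 0 p - R (Suc M) p" by (rule sum_telescope)
      also have "\<dots> = 1" using RM p R0 by simp
      finally show ?thesis .
    qed
    moreover have "open (T \<inter> W)" "q \<in> T \<inter> W" using T W by auto
    ultimately show ?thesis using W by (intro exI[of _ "T \<inter> W"] exI[of _ M] exI[of _ I]) blast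
  qed
  ultimately show ?thesis using w0 by (intro exI[of _ w]) blast
qed

text \<open>The bump of \<open>(V, m)\<close> is built inside \<open>V \<inter> Q m\<close>. Every
  point lies in some \<open>Q n\<close>, and the margin \<open>k (pt V) / real (Suc m)\<close>
  shrinks as \<open>m\<close> grows, so around each point some bump is constantly 1 although the
  radii \<open>k\<close> are not controlled across the cover.\<close>

lemma bump_family:
  assumes U: "\<And>p. open (U p)" "\<And>p. p \<in> U p"
    and ball: "\<And>p. ch p \<in> A" "\<And>p. U p \<subseteq> fst (ch p)" "\<And>p. 0 < k p"
    and bump: "\<And>p V m. closure V \<subseteq> U p \<Longrightarrow> 1 \<le> m \<Longrightarrow>
       \<exists>\<beta>. \<forall>q. MC1b q (24 * m) \<beta> \<and> 0 \<le> \<beta> q \<and> \<beta> q \<le> 1 \<and> (\<beta> q \<noteq> 0 \<longrightarrow> q \<in> V) \<and>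
          (q \<in> U p \<and> ball (snd (ch p) q) (k p / m) \<subseteq> snd (ch p) ` V \<longrightarrow> \<beta> q = 1)"
    and U': "\<And>p. open (U' p)" "\<And>p. p \<in> U' p" "\<And>p. U' p \<subseteq> U p"
  shows "\<exists>\<V> pt Q \<beta>. (\<forall>V\<in>\<V>. closure V \<subseteq> U' (pt V)) \<and>
     layered_bumps \<V> Q (\<lambda>m. 24 * real (Suc m)) \<beta>"
proof -
  have para: "paracompact_space TYPE('m)" using mfd unfolding riemannian_manifold_def by blast
  obtain \<V> where \<V>': "(\<forall>V\<in>\<V>. open V) \<and> \<Union>\<V> = UNIV \<and> (\<forall>V\<in>\<V>. \<exists>p. closure V \<subseteq> U' p) \<and>
    (\<forall>q. \<exists>W. open W \<and> q \<in> W \<and> finite {V \<in> \<V>. V \<inter> W \<noteq> {}})"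
    using paracompact_cover[OF para U'(1,2)] ..
  then have \<V>: "\<And>V. V \<in> \<V> \<Longrightarrow> open V" "\<Union>\<V> = UNIV" "\<And>V. V \<in> \<V> \<Longrightarrow> \<exists>p. closure V \<subseteq> U' p"
    and lf: "\<And>q. \<exists>W. open W \<and> q \<in> W \<and> finite {V \<in> \<V>. V \<inter> W \<noteq> {}}"
    by auto
  obtain pt where pt: "\<And>V. V \<in> \<V> \<Longrightarrow> closure V \<subseteq> U' (pt V)" using \<V>(3) by metis
  \<comment> \<open>Counting over a neighbourhood and not at the point makes \<open>Q m\<close>
    open. Finiteness is required separately because \<open>card\<close> of an infinite set is
    0.\<close>
  define Q where "Q = (\<lambda>m. {q. \<exists>W. open W \<and> q \<in> W \<and> finite {V \<in> \<V>. V \<inter> W \<noteq> {}} \<and>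
      card {V \<in> \<V>. V \<inter> W \<noteq> {}} \<le> m})"
  have opQ: "open (Q m)" for m
  proof (subst open_subopen, rule ballI)
    fix q assume "q \<in> Q m"
    then obtain W where W: "open W" "q \<in> W" "finite {V \<in> \<V>. V \<inter> W \<noteq> {}}"
      "card {V \<in> \<V>. V \<inter> W \<noteq> {}} \<le> m" unfolding Q_def by blast
    then have "W \<subseteq> Q m" unfolding Q_def by blast
    with W show "\<exists>T. open T \<and> q \<in> T \<and> T \<subseteq> Q m" by blast
  qed
  have Qmono: "Q m \<subseteq> Q m'" if "m \<le> m'" for m m' unfolding Q_def using that le_trans by blast
  have Qcard: "card {V \<in> \<V>. q \<in> V} \<le> m" if q: "q \<in> Q m" for q m
  proof -
    obtain W where W: "q \<in> W" "finite {V \<in> \<V>. V \<inter> W \<noteq> {}}" "card {V \<in> \<V>. V \<inter> W \<noteq> {}} \<le> m"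
      using q unfolding Q_def by blast
    have "card {V \<in> \<V>. q \<in> V} \<le> card {V \<in> \<V>. V \<inter> W \<noteq> {}}" using W(1) by (intro card_mono W(2)) auto
    then show ?thesis using W(3) by simp
  qed
  \<comment> \<open>The parameter is \<open>Suc m\<close> because layers start at 0 while bumps ask
    for a parameter of at least 1.\<close>
  define P where "P = (\<lambda>V m \<beta>. \<forall>q. MC1b q (24 * real (Suc m)) \<beta> \<and> 0 \<le> \<beta> q \<and> \<beta> q \<le> 1 \<and>
      (\<beta> q \<noteq> 0 \<longrightarrow> q \<in> V \<inter> Q m) \<and> (q \<in> U (pt V) \<and>
       ball (snd (ch (pt V)) q) (k (pt V) / real (Suc m)) \<subseteq> snd (ch (pt V)) ` (V \<inter> Q m) \<longrightarrow> \<beta> q = 1))"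
  have "\<exists>\<beta>. P V m \<beta>" if V: "V \<in> \<V>" for V m
    unfolding P_def
  proof (rule bump)
    show "closure (V \<inter> Q m) \<subseteq> U (pt V)"
      using pt[OF V] U'(3) closure_mono[of "V \<inter> Q m" V] by blast
  qed simp
  then obtain \<beta> where P: "\<And>V m. V \<in> \<V> \<Longrightarrow> P V m (\<beta> V m)" by metis
  have \<beta>: "\<forall>V\<in>\<V>. \<forall>m q. MC1b q (24 * real (Suc m)) (\<beta> V m) \<and> 0 \<le> \<beta> V m q \<and> \<beta> V m q \<le> 1 \<and>
        (\<beta> V m q \<noteq> 0 \<longrightarrow> q \<in> V \<inter> Q m)"
  proof (intro ballI allI)
    fix V m q assume "V \<in> \<V>"
    from P[OF this, of m, unfolded P_def, THEN spec, of q]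
    show "MC1b q (24 * real (Suc m)) (\<beta> V m) \<and> 0 \<le> \<beta> V m q \<and> \<beta> V m q \<le> 1 \<and>
        (\<beta> V m q \<noteq> 0 \<longrightarrow> q \<in> V \<inter> Q m)" by (elim conjE) (intro conjI)
  qed
  have one: "\<beta> V m q = 1" if "V \<in> \<V>" "q \<in> U (pt V)"
       "ball (snd (ch (pt V)) q) (k (pt V) / real (Suc m)) \<subseteq> snd (ch (pt V)) ` (V \<inter> Q m)" for V m q
  proof -
    have "q \<in> U (pt V) \<and>
       ball (snd (ch (pt V)) q) (k (pt V) / real (Suc m)) \<subseteq> snd (ch (pt V)) ` (V \<inter> Q m) \<longrightarrow> \<beta> V m q = 1"
      using P[OF that(1), of m, unfolded P_def, THEN spec, of q] by (elim conjE)
    then show ?thesis using that(2,3) by (rule mp[OF _ conjI])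
  qed
  have "\<exists>V\<in>\<V>. \<exists>m T. open T \<and> q \<in> T \<and> (\<forall>p\<in>T. \<beta> V m p = 1)" for q
  proof -
    have "q \<in> \<Union>\<V>" unfolding \<V>(2) by simp
    then obtain V where V: "V \<in> \<V>" "q \<in> V" ..
    obtain W where "open W" "q \<in> W" "finite {V \<in> \<V>. V \<inter> W \<noteq> {}}" using lf[of q] by metis
    then obtain n where n: "q \<in> Q n" unfolding Q_def by blast
    let ?c = "ch (pt V)"
    have VU: "V \<subseteq> U (pt V)" using pt[OF V(1)] U'(3) closure_subset by blast
    have Vc: "V \<subseteq> fst ?c" using VU ball(2) by blast
    have op: "open (snd ?c ` (V \<inter> Q n))"
      using \<V>(1)[OF V(1)] opQ Vc by (intro open_chart_image ball) auto
    then obtain e where e: "e > 0" "ball (snd ?c q) e \<subseteq> snd ?c ` (V \<inter> Q n)"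
      using V(2) n openE by (metis IntI image_eqI)
    \<comment> \<open>\<open>m \<ge> n\<close> keeps the neighbourhood inside \<open>Q m\<close>;
      the second condition brings the margin below half of \<open>e\<close>, so that it fits around
      every point whose chart image is within \<open>e / 2\<close> of that of
      \<open>q\<close>.\<close>
    obtain m where m: "m \<ge> n" "k (pt V) / real (Suc m) \<le> e / 2"
    proof -
      obtain j :: nat where j: "2 * k (pt V) / e \<le> real j" using real_arch_simple by blast
      have "2 * k (pt V) / e \<le> real (Suc (max n j))" using j by linarith
      then have "k (pt V) / real (Suc (max n j)) \<le> e / 2" using e(1) by (simp add: field_simps)
      then show ?thesis using that[of "max n j"] by simp
    qed
    define T where "T = V \<inter> snd ?c -` ball (snd ?c q) (e / 2)"
    have "open T" unfolding T_def
      by (rule continuous_open_preimage[OF continuous_on_subset[OF cont_chart[OF ball(1)] Vc] \<V>(1)[OF V(1)] open_ball])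
    moreover have "q \<in> T" unfolding T_def using V e by simp
    moreover have "\<beta> V m p = 1" if p: "p \<in> T" for p
    proof (rule one[OF V(1)])
      show "p \<in> U (pt V)" using p VU unfolding T_def by blast
      have "ball (snd ?c p) (k (pt V) / real (Suc m)) \<subseteq> ball (snd ?c q) e"
      proof
        fix z assume "z \<in> ball (snd ?c p) (k (pt V) / real (Suc m))"
        then have "dist (snd ?c p) z < e / 2" using m(2) unfolding mem_ball by linarith
        moreover have "dist (snd ?c q) (snd ?c p) < e / 2" using p unfolding T_def by simp
        ultimately show "z \<in> ball (snd ?c q) e" using dist_triangle_half_r[of "snd ?c p" "snd ?c q" e z]
          by (simp add: dist_commute)
      qed
      also have "\<dots> \<subseteq> snd ?c ` (V \<inter> Q m)" using e(2) Qmono[OF m(1)] by blast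
      finally show "ball (snd ?c p) (k (pt V) / real (Suc m)) \<subseteq> snd ?c ` (V \<inter> Q m)" .
    qed
    ultimately show ?thesis using V(1) by blast
  qed
  then have "layered_bumps \<V> Q (\<lambda>m. 24 * real (Suc m)) \<beta>"
    unfolding layered_bumps_def using lf \<beta> Qcard by (intro conjI) simp_all
  then show ?thesis using pt
    by (intro exI[of _ \<V>] exI[of _ pt] exI[of _ Q] exI[of _ \<beta>]) simp
qed

text \<open>The slack is split: the local approximations have differentials at most
  \<open>L + r / 2\<close>, and the differentials of the weights cost \<open>r / 2\<close> in total.
  The weights depend on the cover alone, so the errors can be chosen after their bounds
  \<open>K m\<close> are known.\<close>

lemma C1_approximation_manifold:
  assumes f: "lip_bound A \<rho> f L" and \<epsilon>: "continuous_on UNIV \<epsilon>" "\<And>p. 0 < \<epsilon> p" and r: "0 < r"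
  shows "\<exists>g. \<forall>q. MC1b q (L + r) g \<and> \<bar>g q - f q\<bar> < \<epsilon> q"
proof -
  define P where "P = (\<lambda>p U c (k::real). open U \<and> p \<in> U \<and> c \<in> A \<and> U \<subseteq> fst c \<and> 0 < k \<and>
    (\<forall>\<delta>>0. \<exists>F. \<forall>q\<in>U. MC1b q (L + r / 2) F \<and> \<bar>F q - f q\<bar> \<le> \<delta>) \<and>
    (\<forall>V m. closure V \<subseteq> U \<and> 1 \<le> m \<longrightarrow>
       (\<exists>\<beta>. \<forall>q. MC1b q (24 * m) \<beta> \<and> 0 \<le> \<beta> q \<and> \<beta> q \<le> 1 \<and> (\<beta> q \<noteq> 0 \<longrightarrow> q \<in> V) \<and>
          (q \<in> U \<and> ball (snd c q) (k / m) \<subseteq> snd c ` V \<longrightarrow> \<beta> q = 1))))"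
  have "\<exists>U c k. P p U c k" for p
    unfolding P_def using local_structure[OF f, of "r / 2" p] r by simp
  then obtain U ch k where P: "\<And>p. P p (U p) (ch p) (k p)" by metis
  have U: "open (U p)" "p \<in> U p" and ball: "ch p \<in> A" "U p \<subseteq> fst (ch p)" "0 < k p" for p
    using P[of p] unfolding P_def by auto
  have approx: "\<exists>F. \<forall>q\<in>U p. MC1b q (L + r / 2) F \<and> \<bar>F q - f q\<bar> \<le> \<delta>" if "0 < \<delta>" for p \<delta>
    using P[of p] that unfolding P_def by simp
  have bump: "\<exists>\<beta>. \<forall>q. MC1b q (24 * m) \<beta> \<and> 0 \<le> \<beta> q \<and> \<beta> q \<le> 1 \<and> (\<beta> q \<noteq> 0 \<longrightarrow> q \<in> V) \<and>
          (q \<in> U p \<and> ball (snd (ch p) q) (k p / m) \<subseteq> snd (ch p) ` V \<longrightarrow> \<beta> q = 1)"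
    if "closure V \<subseteq> U p" "1 \<le> m" for p V m
    using P[of p] that unfolding P_def by simp
  \<comment> \<open>On \<open>U' p\<close> the tolerance exceeds half of
    \<open>\<epsilon> p\<close>, so the constant error \<open>\<epsilon> p / 4\<close> is below
    \<open>\<epsilon> q / 2\<close> for every \<open>q\<close> there.\<close>
  define U' where "U' = (\<lambda>p. U p \<inter> {q. \<epsilon> p / 2 < \<epsilon> q})"
  have U': "open (U' p)" "p \<in> U' p" "U' p \<subseteq> U p" for p
    unfolding U'_def using U \<epsilon>(2)[of p] by (auto intro!: open_Int open_Collect_less \<epsilon>(1) continuous_intros)
  obtain \<V> pt Q \<beta> where pt: "\<And>V. V \<in> \<V> \<Longrightarrow> closure V \<subseteq> U' (pt V)"
    and bumps: "layered_bumps \<V> Q (\<lambda>m. 24 * real (Suc m)) \<beta>"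
    using bump_family[OF U ball bump U'] by metis
  note lf = layered_bumpsD(1)[OF bumps] and Q = layered_bumpsD(6)[OF bumps]
  have C: "0 \<le> 24 * real (Suc m)" for m by simp
  obtain w where w': "(\<forall>V\<in>\<V>. \<forall>m q. 0 \<le> w V m q \<and> (w V m q \<noteq> 0 \<longrightarrow> q \<in> V \<inter> Q m)) \<and>
     (\<forall>m. \<exists>K\<ge>0. \<forall>V\<in>\<V>. \<forall>q. MC1b q K (w V m)) \<and>
     (\<forall>q. \<exists>T M I. open T \<and> q \<in> T \<and> finite I \<and> I \<subseteq> \<V> \<and> (\<forall>V\<in>I. q \<in> closure V) \<and>
        (\<forall>p\<in>T. \<forall>V\<in>\<V>. \<forall>m. V \<notin> I \<or> M < m \<longrightarrow> w V m p = 0) \<and>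
        (\<forall>p\<in>T. (\<Sum>m\<le>M. \<Sum>V\<in>I. w V m p) = (1::real)))"
    using partition_of_unity[OF bumps C] ..
  have w: "0 \<le> w V m q" "w V m q \<noteq> 0 \<Longrightarrow> q \<in> V \<inter> Q m" if "V \<in> \<V>" for V m q
    using conjunct1[OF w'] that by auto
  note wK = conjunct1[OF conjunct2[OF w'], rule_format] and wT = conjunct2[OF conjunct2[OF w'], THEN spec]
  obtain K where K: "\<And>m. 0 \<le> K m" "\<And>m V q. V \<in> \<V> \<Longrightarrow> MC1b q (K m) (w V m)" using wK by metis
  \<comment> \<open>The power of 1/2 makes the layers summable; the number of overlaps and the bound
    \<open>K m\<close> are divided out, each increased by 1 to keep the denominator
    positive.\<close>
  define \<delta> where "\<delta> = (\<lambda>m. r / 2 * (1 / 2) ^ Suc m / ((real m + 1) * (K m + 1)))"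
  have den: "0 < (real m + 1) * (K m + 1)" for m using K(1)[of m] by (simp add: add_nonneg_pos)
  have den0: "(real m + 1) * (K m + 1) \<noteq> 0" for m by (rule less_imp_neq[OF den, symmetric])
  have \<delta>: "0 < \<delta> m" for m unfolding \<delta>_def using r den[of m] by simp
  have \<delta>K: "real m * (\<delta> m * K m) \<le> r / 2 * (1 / 2) ^ Suc m" for m
  proof -
    have "real m * (\<delta> m * K m) = \<delta> m * (real m * K m)" by simp
    also have "\<dots> \<le> \<delta> m * ((real m + 1) * (K m + 1))"
      using \<delta>[of m] K(1)[of m] by (intro mult_left_mono mult_mono) auto
    also have "\<dots> = r / 2 * (1 / 2) ^ Suc m" unfolding \<delta>_def by (rule nonzero_eq_divide_eq[THEN iffD1, OF den0 refl])
    finally show ?thesis .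
  qed
  have "\<exists>F. \<forall>q\<in>U (pt V). MC1b q (L + r / 2) F \<and> \<bar>F q - f q\<bar> \<le> min (\<delta> m) (\<epsilon> (pt V) / 4)" for V m
    using \<delta>[of m] \<epsilon>(2)[of "pt V"] by (intro approx) simp
  then obtain F where F: "\<And>V m q. q \<in> U (pt V) \<Longrightarrow> MC1b q (L + r / 2) (F V m)"
    "\<And>V m q. q \<in> U (pt V) \<Longrightarrow> \<bar>F V m q - f q\<bar> \<le> min (\<delta> m) (\<epsilon> (pt V) / 4)" by metis
  \<comment> \<open>The index set at \<open>q\<close> will be contained in the finite set
    \<open>J\<close>, so the sum is not the default 0 of an infinite index set.\<close>
  define g where "g = (\<lambda>q. \<Sum>(V, m)\<in>{(V, m). V \<in> \<V> \<and> w V m q \<noteq> 0}. w V m q * F V m q)"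
  have "MC1b q (L + r) g \<and> \<bar>g q - f q\<bar> < \<epsilon> q" for q
  proof -
    obtain T M I where T: "open T" "q \<in> T" and I: "finite I" "I \<subseteq> \<V>" and cl: "\<forall>V\<in>I. q \<in> closure V"
      and z: "\<forall>p\<in>T. \<forall>V\<in>\<V>. \<forall>m. V \<notin> I \<or> M < m \<longrightarrow> w V m p = 0"
      and s1: "\<forall>p\<in>T. (\<Sum>m\<le>M. \<Sum>V\<in>I. w V m p) = 1"
      using wT[of q] by (elim exE conjE) simp
    define J where "J = I \<times> {..M}"
    have finJ: "finite J" unfolding J_def using I by simp
    have g_eq: "g p = (\<Sum>i\<in>J. w (fst i) (snd i) p * F (fst i) (snd i) p)" if p: "p \<in> T" for p
    proof -
      have "(\<Sum>(V, m)\<in>{(V, m). V \<in> \<V> \<and> w V m p \<noteq> 0}. w V m p * F V m p) = (\<Sum>(V, m)\<in>J. w V m p * F V m p)"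
        by (rule sum.mono_neutral_left[OF finJ])
          (use z p I(2) in \<open>force simp: J_def not_less[symmetric]\<close>)+
      then show ?thesis unfolding g_def by (simp add: case_prod_unfold)
    qed
    have sum1: "(\<Sum>i\<in>J. w (fst i) (snd i) p) = 1" if "p \<in> T" for p
      using bspec[OF s1 that] unfolding J_def
      by (subst (asm) sum.swap) (simp add: sum.cartesian_product case_prod_unfold)
    have qU: "q \<in> U' (pt V)" if "V \<in> I" for V using pt I(2) cl that by blast
    have qU2: "q \<in> U (pt V)" if "V \<in> I" for V using qU[OF that] U'(3) by blast
    \<comment> \<open>\<open>J\<close> also contains members with \<open>q\<close> merely in their
      closure; their weights have differential 0 at \<open>q\<close> and cause no error.\<close>
    define \<kappa> where "\<kappa> = (\<lambda>i. if q \<in> fst i \<inter> Q (snd i) then K (snd i) else 0)"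
    define e where "e = (\<lambda>i. if q \<in> fst i \<inter> Q (snd i) then \<delta> (snd i) * K (snd i) else 0)"
    \<comment> \<open>The common reference value is the number \<open>f q\<close>, so that
      \<open>f\<close> itself is never differentiated.\<close>
    have "MC1b q (L + r / 2 + sum e J) (\<lambda>p. \<Sum>i\<in>J. w (fst i) (snd i) p * F (fst i) (snd i) p)"
    proof (rule MC1b_partition[OF finJ _ _ _ T sum1])
      fix i assume "i \<in> J"
      then have i: "fst i \<in> I" "fst i \<in> \<V>" using I(2) unfolding J_def by auto
      show "MC1b q (\<kappa> i) (w (fst i) (snd i))"
      proof (cases "q \<in> fst i \<inter> Q (snd i)")
        case True then show ?thesis using K(2)[OF i(2)] by (simp add: \<kappa>_def)
      next
        case False
        then have "MC1b q 0 (w (fst i) (snd i))"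
          using w[OF i(2)] by (intro MC1b_zero_min[OF K(2)[OF i(2)]]) blast+
        moreover have "\<kappa> i = 0" using False unfolding \<kappa>_def by (rule if_not_P)
        ultimately show ?thesis by simp
      qed
      show "MC1b q (L + r / 2) (F (fst i) (snd i))" by (rule F(1)[OF qU2[OF i(1)]])
      show "0 \<le> w (fst i) (snd i) q" by (rule w(1)[OF i(2)])
      have "\<bar>F (fst i) (snd i) q - f q\<bar> \<le> \<delta> (snd i)" using F(2)[OF qU2[OF i(1)], of "snd i"] by simp
      then show "\<bar>F (fst i) (snd i) q - f q\<bar> * \<kappa> i \<le> e i"
        unfolding \<kappa>_def e_def using K(1) by (auto intro: mult_right_mono)
    qed
    then have 1: "MC1b q (L + r / 2 + sum e J) g"
      by (rule MC1b_cong[OF _ T]) (simp add: g_eq)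
    have "sum e J = (\<Sum>m\<le>M. \<Sum>V\<in>I. e (V, m))"
      unfolding J_def by (subst sum.swap) (simp add: sum.cartesian_product case_prod_unfold)
    also have "\<dots> \<le> (\<Sum>m\<le>M. r / 2 * (1 / 2) ^ Suc m)"
    proof (rule sum_mono)
      fix m
      show "(\<Sum>V\<in>I. e (V, m)) \<le> r / 2 * (1 / 2) ^ Suc m"
      proof (cases "q \<in> Q m")
        case True
        have fin: "finite {V \<in> \<V>. q \<in> V}"
        proof -
          obtain W where "q \<in> W" "finite {V \<in> \<V>. V \<inter> W \<noteq> {}}" using lf by blast
          then show ?thesis by (rule_tac finite_subset[of _ "{V \<in> \<V>. V \<inter> W \<noteq> {}}"]) auto
        qed
        have "(\<Sum>V\<in>I. e (V, m)) = (\<Sum>V\<in>I. if q \<in> V then \<delta> m * K m else 0)"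
          unfolding e_def using True by (intro sum.cong) auto
        also have "\<dots> = (\<Sum>V\<in>{V \<in> I. q \<in> V}. \<delta> m * K m)"
          by (rule sum.inter_filter[OF I(1), symmetric])
        also have "\<dots> = real (card {V \<in> I. q \<in> V}) * (\<delta> m * K m)" by simp
        also have "\<dots> \<le> real m * (\<delta> m * K m)"
        proof (rule mult_right_mono)
          have "card {V \<in> I. q \<in> V} \<le> card {V \<in> \<V>. q \<in> V}" using I(2) by (intro card_mono fin) auto
          then show "real (card {V \<in> I. q \<in> V}) \<le> real m" using Q[OF True] by simp
          show "0 \<le> \<delta> m * K m" using \<delta>[of m] K(1)[of m] by simp
        qed
        finally show ?thesis using \<delta>K[of m] by linarith
      next
        case False
        then show ?thesis using r by (simp add: e_def)
      qed
    qed
    also have "\<dots> \<le> r / 2"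
    proof -
      have "(\<Sum>m\<le>M. (1 / 2) ^ Suc m) = 1 - (1 / 2 :: real) ^ Suc M"
        by (induction M) simp_all
      then have "(\<Sum>m\<le>M. (1 / 2) ^ Suc m) \<le> (1 :: real)" by simp
      then have "r / 2 * (\<Sum>m\<le>M. (1 / 2) ^ Suc m) \<le> r / 2 * 1" using r by (intro mult_left_mono) auto
      then show ?thesis by (simp add: sum_distrib_left)
    qed
    finally have 2: "MC1b q (L + r) g" by (intro MC1b_mono[OF 1]) simp
    have "g q - f q = (\<Sum>i\<in>J. w (fst i) (snd i) q * (F (fst i) (snd i) q - f q))"
      using sum1[OF T(2)] unfolding g_eq[OF T(2)]
      by (simp add: right_diff_distrib sum_subtractf sum_distrib_right[symmetric])
    also have "\<bar>\<dots>\<bar> \<le> (\<Sum>i\<in>J. w (fst i) (snd i) q * (\<epsilon> q / 2))"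
    proof (rule order_trans[OF sum_abs], rule sum_mono)
      fix i assume "i \<in> J"
      then have i: "fst i \<in> I" "fst i \<in> \<V>" using I(2) unfolding J_def by auto
      have "\<bar>F (fst i) (snd i) q - f q\<bar> \<le> \<epsilon> q / 2"
        using F(2)[OF qU2[OF i(1)], of "snd i"] qU[OF i(1)] unfolding U'_def by simp
      then show "\<bar>w (fst i) (snd i) q * (F (fst i) (snd i) q - f q)\<bar> \<le> w (fst i) (snd i) q * (\<epsilon> q / 2)"
        unfolding abs_mult abs_of_nonneg[OF w(1)[OF i(2)]] by (rule mult_left_mono[OF _ w(1)[OF i(2)]])
    qed
    also have "\<dots> = \<epsilon> q / 2" unfolding sum_distrib_right[symmetric] sum1[OF T(2)] by simp
    also have "\<dots> < \<epsilon> q" using \<epsilon>(2)[of q] by simp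
    finally show ?thesis using 2 by blast
  qed
  then show ?thesis by blast
qed

end

theorem corollary4p3:
  fixes A :: "('m::t2_space, 'h::{real_inner, complete_space}) chart set"
    and \<rho> :: "'m \<Rightarrow> ('m, 'h) tangent \<Rightarrow> ('m, 'h) tangent \<Rightarrow> real"
    and f \<epsilon> :: "'m \<Rightarrow> real"
    and r :: real
  assumes "riemannian_manifold A \<rho>"
    and "riem_lipschitz A \<rho> f"
    and "continuous_on UNIV \<epsilon>" and "\<And>p. 0 < \<epsilon> p"
    and "0 < r"
  shows "\<exists>g :: 'm \<Rightarrow> real.
           C1_smooth A g \<and> riem_lipschitz A \<rho> g \<and>
           (\<forall>p. \<bar>g p - f p\<bar> < \<epsilon> p) \<and>
           Lip A \<rho> g \<le> Lip A \<rho> f + r"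
proof -
  interpret riem_mfd A \<rho> by unfold_locales (rule assms(1))
  have f: "lip_bound A \<rho> f (Lip A \<rho> f)" by (rule lip_bound_Lip[OF assms(2)])
  \<comment> \<open>\<open>Lip A \<rho> f\<close> may be 0, for instance if \<open>f\<close> is
    constant; the added \<open>r\<close> makes the constant positive, as \<open>lip_boundI\<close>
    requires.\<close>
  then have K: "0 < Lip A \<rho> f + r" using assms(5) unfolding lip_bound_def by linarith
  obtain g where g: "\<And>q. MC1b q (Lip A \<rho> f + r) g" "\<And>q. \<bar>g q - f q\<bar> < \<epsilon> q"
    using C1_approximation_manifold[OF f assms(3-5)] by blast
  have lg: "lip_bound A \<rho> g (Lip A \<rho> f + r)" by (rule lip_boundI[OF g(1) K])
  then have rl: "riem_lipschitz A \<rho> g" unfolding riem_lipschitz_def by blast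
  have "C1_smooth A g" by (rule C1_smoothI) (use g(1) in blast)
  then show ?thesis using g(2) rl Lip_le[OF rl lg] by blast
qed

end
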